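(* For any $\gamma>0$ and $\tau=\frac{i\pi}{\gamma^2}$ (rectangular lattice), the linearized problem $$i\partial_t v+\lambda v=\Pi\big[2|\Phi_0|^2v+\Phi_0^2\,\overline{v}\big]$$ is exponentially unstable (in $L^2(S_\gamma)\cap\mathcal F_\gamma$).
   Context: $L$ is Lebesgue measure on $\mathbb C$. For a function $u$ on $\mathbb C$ of at most polynomial growth, $$[\Pi u](z)=\frac1\pi e^{-|z|^2/2}\int_{\mathbb C}e^{\overline w z-|w|^2/2}u(w)\,dL(w).$$ $\widetilde{\mathcal E}$ is the set of functions $u(z)=e^{-|z|^2/2}f(z)$ with $f$ entire holomorphic such that $|u(z)|\lesssim\langle z\rangle^M$ for some $M$. For $\alpha\in\mathbb C$, the magnetic translation is $R_\alpha u(z)=e^{(\alpha\overline z-\overline\alpha z)/2}u(z+\alpha)$. For $\gamma>0$: $\mathcal F_\gamma=\{u\in\widetilde{\mathcal E}: R_\gamma u=u\}$ and $S_\gamma=\{z\in\mathbb C:-\gamma/2<\mathrm{Re}\,z\le\gamma/2\}$; $L^2(S_\gamma)\cap\mathcal F_\gamma$ carries the $L^2(S_\gamma)$ norm. For $\mathrm{Im}\,\tau>0$, $\Theta_\tau(z)=-i\sum_{n\in\mathbb Z}(-1)^n\exp\big(i\pi\tau(n+\tfrac12)^2+i(2n+1)\pi z\big)$. With $\tau=i\pi/\gamma^2$, $$\Phi_0(z)=\exp\Big(\frac{z^2}2-\frac{i\pi z}\gamma-\frac{|z|^2}2\Big)\Theta_\tau\Big(\frac z\gamma-\frac{\tau-1}2\Big),\qquad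 \lambda=\frac1{\sqrt2}e^{\pi^2/(2\gamma^2)}\Big(\sum_{q\in\mathbb Z}e^{-\pi^2q^2/\gamma^2}\Big)^2 ,$$ so that $e^{-i\lambda t}\Phi_0$ solves $i\partial_tu=\Pi(|u|^2u)$; the linearized problem is obtained by linearizing this equation around that solution and setting $v=e^{i\lambda t}u$. "Exponentially unstable in $L^2(S_\gamma)\cap\mathcal F_\gamma$" means: there exist an initial datum $v_0\in L^2(S_\gamma)\cap\mathcal F_\gamma$ and constants $c,\sigma>0$ such that the solution $v$ with $v(0)=v_0$ satisfies $\|v(t)\|_{L^2(S_\gamma)}\ge c\,e^{\sigma t}$ for all $t\ge0$. *)

theory Defs
  imports "HOL-Analysis.Analysis"
begin

definition bargmann_proj :: "(complex \<Rightarrow> complex) \<Rightarrow> complex \<Rightarrow> complex" where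
  "bargmann_proj u z =
     of_real (1 / pi) * of_real (exp (- (cmod z)\<^sup>2 / 2)) *
     (LINT w|lebesgue. exp (cnj w * z - of_real ((cmod w)\<^sup>2 / 2)) * u w)"

definition japanese_bracket :: "complex \<Rightarrow> real" where
  "japanese_bracket z = sqrt (1 + (cmod z)\<^sup>2)"

definition E_tilde :: "(complex \<Rightarrow> complex) set" where
  "E_tilde = {u.
     (\<exists>f. f holomorphic_on UNIV \<and> (\<forall>z. u z = of_real (exp (- (cmod z)\<^sup>2 / 2)) * f z)) \<and>
     (\<exists>(M::real) (C::real). \<forall>z. cmod (u z) \<le> C * japanese_bracket z powr M)}"

definition magnetic_translation :: "complex \<Rightarrow> (complex \<Rightarrow> complex) \<Rightarrow> complex \<Rightarrow> complex" where
  "magnetic_translation \<alpha> u z = exp ((\<alpha> * cnj z - cnj \<alpha> * z) / 2) * u (z + \<alpha>)"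

definition F_space :: "real \<Rightarrow> (complex \<Rightarrow> complex) set" where
  "F_space \<gamma> = {u \<in> E_tilde. magnetic_translation (of_real \<gamma>) u = u}"

definition strip :: "real \<Rightarrow> complex set" where
  "strip \<gamma> = {z. - \<gamma> / 2 < Re z \<and> Re z \<le> \<gamma> / 2}"

text \<open>Functions are not identified when equal almost everywhere. On the phase space used below
  this is harmless: members of \<open>F_space \<gamma>\<close> are continuous and determined by their values
  on \<open>strip \<gamma>\<close>, so \<open>L2_norm_on (strip \<gamma>)\<close> is a genuine norm there.\<close>

definition L2_on :: "complex set \<Rightarrow> (complex \<Rightarrow> complex) set" where
  "L2_on S = {u. set_borel_measurable lebesgue S u \<and>
                 set_integrable lebesgue S (\<lambda>z. (cmod (u z))\<^sup>2)}"

definition L2_norm_on :: "complex set \<Rightarrow> (complex \<Rightarrow> complex) \<Rightarrow> real" where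
  "L2_norm_on S u = sqrt (LINT z:S|lebesgue. (cmod (u z))\<^sup>2)"

definition Theta :: "complex \<Rightarrow> complex \<Rightarrow> complex" where
  "Theta \<tau> z = - \<i> * (\<Sum>\<^sub>\<infinity>n\<in>(UNIV::int set).
     (-1) powi n *
     exp (\<i> * of_real pi * \<tau> * (of_int n + 1/2)\<^sup>2 + \<i> * of_int (2 * n + 1) * of_real pi * z))"

definition Phi0 :: "real \<Rightarrow> complex \<Rightarrow> complex \<Rightarrow> complex" where
  "Phi0 \<gamma> \<tau> z =
     exp (z\<^sup>2 / 2 - \<i> * of_real pi * z / of_real \<gamma> - of_real ((cmod z)\<^sup>2 / 2)) *
     Theta \<tau> (z / of_real \<gamma> - (\<tau> - 1) / 2)"

definition lam :: "real \<Rightarrow> real" where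
  "lam \<gamma> = 1 / sqrt 2 * exp (pi\<^sup>2 / (2 * \<gamma>\<^sup>2)) *
     (\<Sum>\<^sub>\<infinity>q\<in>(UNIV::int set). exp (- (pi\<^sup>2 * (of_int q)\<^sup>2) / \<gamma>\<^sup>2))\<^sup>2"

text \<open>Differentiability in time with respect to the \<open>L\<^sup>2(S)\<close> norm, one-sided at \<open>t = 0\<close>.\<close>

definition has_L2_time_derivative ::
  "complex set \<Rightarrow> (real \<Rightarrow> complex \<Rightarrow> complex) \<Rightarrow> (complex \<Rightarrow> complex) \<Rightarrow> real \<Rightarrow> bool" where
  "has_L2_time_derivative S v v' t \<longleftrightarrow>
     ((\<lambda>s. L2_norm_on S (\<lambda>z. (v s z - v t z) / of_real (s - t) - v' z)) \<longlongrightarrow> 0)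
       (at t within {0..})"

text \<open>Solutions on \<open>[0,\<infinity>)\<close> of \<open>i \<partial>\<^sub>t v + \<lambda> v = \<Pi>[2 |\<Phi>\<^sub>0|\<^sup>2 v + \<Phi>\<^sub>0\<^sup>2 cnj v]\<close> with values in
  \<open>L\<^sup>2(S\<^sub>\<gamma>) \<inter> F\<^sub>\<gamma>\<close>. The right-hand side is a bounded real-linear operator on this
  space, so differentiable solutions are automatically continuously differentiable.\<close>

definition linearized_solution ::
  "real \<Rightarrow> complex \<Rightarrow> (real \<Rightarrow> complex \<Rightarrow> complex) \<Rightarrow> bool" where
  "linearized_solution \<gamma> \<tau> v \<longleftrightarrow>
     (\<forall>t\<ge>0. v t \<in> L2_on (strip \<gamma>) \<inter> F_space \<gamma> \<and>
       (\<exists>v' \<in> L2_on (strip \<gamma>) \<inter> F_space \<gamma>.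
          has_L2_time_derivative (strip \<gamma>) v v' t \<and>
          (\<forall>z. \<i> * v' z + of_real (lam \<gamma>) * v t z =
             bargmann_proj
               (\<lambda>w. 2 * of_real ((cmod (Phi0 \<gamma> \<tau> w))\<^sup>2) * v t w + (Phi0 \<gamma> \<tau> w)\<^sup>2 * cnj (v t w)) z)))"

text \<open>Here \<open>X\<close> is the phase space, \<open>N\<close> its norm and \<open>sol\<close> the solution predicate of the evolution
  equation. That one may speak of \<^emph>\<open>the\<close> solution with datum \<open>v0\<close> (existence and uniqueness for
  \<open>t \<ge> 0\<close>) is part of the definition.\<close>

definition exponentially_unstable ::
  "'a set \<Rightarrow> ('a \<Rightarrow> real) \<Rightarrow> ((real \<Rightarrow> 'a) \<Rightarrow> bool) \<Rightarrow> bool" where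
  "exponentially_unstable X N sol \<longleftrightarrow>
     (\<exists>v0\<in>X. \<exists>c>0. \<exists>\<sigma>>0. \<exists>v.
        sol v \<and> v 0 = v0 \<and>
        (\<forall>w. sol w \<and> w 0 = v0 \<longrightarrow> (\<forall>t\<ge>0. w t = v t)) \<and>
        (\<forall>t\<ge>0. N (v t) \<ge> c * exp (\<sigma> * t)))"

end

theory Submission
  imports Defs "HOL-Probability.Probability" "HOL-Complex_Analysis.Complex_Analysis"
begin


text \<open>
  With \<open>h = \<pi> / \<gamma>\<close>, the space \<open>F_space \<gamma>\<close> is spanned by the orthogonal modes
  \<open>psi h n z = exp (z\<^sup>2/2 - \<bar>z\<bar>\<^sup>2/2 + 2 i h n z - h\<^sup>2 n\<^sup>2)\<close>, and \<open>Phi0\<close> is a multiple of their sum.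
  The projection of \<open>psi a * cnj (psi b) * psi c\<close> is an explicit Gaussian factor times \<open>psi (a + c - b)\<close>.
  For \<open>v = \<Sum> (a n + i b n) psi n\<close> the linearized problem therefore becomes \<open>a' = - \<mu> N b\<close>, \<open>b' = - \<mu> L a\<close>,
  where \<open>N = (\<theta> - G)\<^sup>2\<close> and \<open>L = G\<^sup>2 + 2 \<theta> G - \<theta>\<^sup>2\<close> commute, \<open>G\<close> is the correlation with the Gaussian
  \<open>exp (- h\<^sup>2 p\<^sup>2)\<close> and \<open>\<theta>\<close> is the sum of that Gaussian, i.e. the maximum of the symbol of \<open>G\<close>.
  The symbol of \<open>L N\<close> is positive near this maximum, so slowly decaying wave packets have \<open>\<langle>b, L N b\<rangle> > 0\<close>.
  Since \<open>b'' = \<mu>\<^sup>2 L N b\<close> and \<open>\<bar>b'\<bar>\<^sup>2 - \<langle>b, b''\<rangle>\<close> is conserved, nonpositivity of this energy makes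
  \<open>\<bar>b\<bar>\<^sup>2\<close> logarithmically convex, which gives exponential growth without a spectral decomposition.
\<close>

section \<open>Growth for linear Hamiltonian systems\<close>

text \<open>On two-sided sequences \<open>G\<close> acts as multiplication by a nonconstant analytic
  symbol, so no square-summable sequence is an eigenvector and no growing mode can be written down;
  the packets \<open>expw k n * cos (n \<xi> - \<alpha>)\<close> are eigenvectors up to an error of
  order \<open>k\<close>, and \<open>k\<close> is fixed by that error. The weight
  \<open>expw k\<close> then also defines the space of the evolution: coefficients
  \<open>expw k n * x n\<close> with \<open>x\<close> bounded. It is Banach, \<open>G\<close> is
  bounded on it because the Gaussian beats \<open>exp (k * |p|)\<close>, and all mode series
  converge absolutely with exponential decay in \<open>Im z\<close>. Its sup norm serves for
  existence of the flow and for time derivatives; symmetry and growth use the plain l2 product of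
  the coefficients, which Bessel's inequality compares with the norm on the strip. Instability also
  asks for uniqueness, and a competing solution is an arbitrary member of
  \<open>L2_on (strip \<gamma>) \<inter> F_space \<gamma>\<close>. Instead of expanding it in modes,
  the projection is bounded on the strip directly: its kernel has Gaussian modulus, and
  \<open>|u|\<close> is periodic for \<open>u\<close> in \<open>F_space \<gamma>\<close>.\<close>

lemma bounded_linear_flow_exists:
  fixes A :: "'a::banach \<Rightarrow> 'a"
  assumes A: "bounded_linear A"
  shows "\<exists>U. U 0 = x \<and> (\<forall>t. (U has_vector_derivative A (U t)) (at t))"
proof -
  interpret A: bounded_linear A by fact
  obtain K where K0: "0 \<le> K" and K: "\<And>x. norm (A x) \<le> norm x * K"
    using A.nonneg_bounded by blast
  define e where "e n t = (t ^ n / fact n) *\<^sub>R ((A ^^ n) x)" for n and t :: real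
  have pow: "norm ((A ^^ n) x) \<le> norm x * K ^ n" for n
  proof (induction n)
    case (Suc n)
    have "norm ((A ^^ Suc n) x) \<le> norm ((A ^^ n) x) * K" using K by simp
    also have "\<dots> \<le> (norm x * K ^ n) * K" by (rule mult_right_mono[OF Suc K0])
    finally show ?case by (simp add: mult_ac)
  qed simp
  have e_le: "norm (e n t) \<le> norm x * (inverse (fact n) * (K * R) ^ n)" if "\<bar>t\<bar> \<le> R" for n t R
  proof -
    have "norm (e n t) = \<bar>t\<bar> ^ n / fact n * norm ((A ^^ n) x)"
      by (simp add: e_def power_abs)
    also have "\<dots> \<le> R ^ n / fact n * (norm x * K ^ n)"
      using that by (intro mult_mono divide_right_mono power_mono pow) auto
    finally show ?thesis by (simp add: power_mult_distrib field_simps)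
  qed
  have summ: "summable (\<lambda>n. norm x * (inverse (fact n) * (K * R) ^ n))" for R :: real
    by (intro summable_mult summable_exp)
  define U where "U t = (\<Sum>n. e n t)" for t
  have summ_e: "summable (\<lambda>n. e n t)" for t
    by (rule summable_comparison_test'[OF summ[of "\<bar>t\<bar>"]]) (use e_le[of t "\<bar>t\<bar>"] in auto)
  have "U 0 = x"
  proof -
    have "U 0 = (\<Sum>n\<in>{0}. e n 0)"
      unfolding U_def by (rule suminf_finite) (auto simp: e_def)
    then show ?thesis by (simp add: e_def)
  qed
  moreover have "(U has_vector_derivative A (U t)) (at t)" for t
  proof -
    define R where "R = \<bar>t\<bar> + 1"
    define S where "S = {-R<..<R}"
    \<comment> \<open>The derivative of \<open>e n\<close> is \<open>A\<close> of term
      \<open>n - 1\<close>. This shift costs one summand, hence the length \<open>Suc n\<close> in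
      \<open>part\<close> and the threshold \<open>Suc M\<close> below.\<close>
    define e' where "e' n s = (case n of 0 \<Rightarrow> 0 | Suc m \<Rightarrow> A (e m s))" for n and s :: real
    have tS: "t \<in> S" and S: "convex S" "open S" by (auto simp: S_def R_def)
    have ul: "uniform_limit S (\<lambda>n s. \<Sum>i<n. e i s) U sequentially"
      unfolding U_def by (rule Weierstrass_m_test[OF _ summ[of R]]) (auto intro!: e_le simp: S_def)
    have der: "(e n has_derivative (\<lambda>h. h *\<^sub>R e' n s)) (at s within S)" for n s
    proof (cases n)
      case 0
      then have "e n = (\<lambda>t. x)" by (auto simp: e_def)
      then show ?thesis by (simp add: e'_def 0)
    next
      case (Suc m)
      have "((\<lambda>s. s ^ n / fact n) has_real_derivative (s ^ m / fact m)) (at s within S)"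
        by (rule derivative_eq_intros refl | simp add: Suc field_simps del: of_nat_Suc)+
      then have "((\<lambda>s. (s ^ n / fact n) *\<^sub>R ((A ^^ n) x)) has_vector_derivative
            (s ^ m / fact m) *\<^sub>R ((A ^^ n) x)) (at s within S)"
        unfolding has_real_derivative_iff_has_vector_derivative
        by (rule bounded_linear.has_vector_derivative[OF bounded_linear_scaleR_left])
      moreover have "(s ^ m / fact m) *\<^sub>R ((A ^^ n) x) = e' n s"
        by (simp add: e'_def Suc e_def A.scaleR)
      ultimately show ?thesis
        by (simp add: has_vector_derivative_def e_def[abs_def])
    qed
    have part: "(\<Sum>i<Suc n. e' i s) = A (\<Sum>i<n. e i s)" for n s
      by (subst sum.lessThan_Suc_shift) (simp add: e'_def A.sum)
    have ev: "\<forall>\<^sub>F n in sequentially. \<forall>s\<in>S. \<forall>h. norm ((\<Sum>i<n. h *\<^sub>R e' i s) - h *\<^sub>R A (U s)) \<le> \<epsilon> * norm h"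
      if "\<epsilon> > 0" for \<epsilon>
    proof -
      have pos: "\<epsilon> / (K + 1) > 0" using that K0 by simp
      from uniform_limitD[OF ul pos] obtain M where
        M: "\<And>n s. n \<ge> M \<Longrightarrow> s \<in> S \<Longrightarrow> dist (\<Sum>i<n. e i s) (U s) < \<epsilon> / (K + 1)"
        unfolding eventually_sequentially by blast
      have "norm ((\<Sum>i<Suc n. h *\<^sub>R e' i s) - h *\<^sub>R A (U s)) \<le> \<epsilon> * norm h"
        if "n \<ge> M" "s \<in> S" for n s h
      proof -
        have "(\<Sum>i<Suc n. h *\<^sub>R e' i s) - h *\<^sub>R A (U s) = h *\<^sub>R A ((\<Sum>i<n. e i s) - U s)"
          by (simp only: scaleR_right.sum[symmetric] part A.diff scaleR_right_diff_distrib)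
        then have "norm ((\<Sum>i<Suc n. h *\<^sub>R e' i s) - h *\<^sub>R A (U s)) \<le> \<bar>h\<bar> * (norm ((\<Sum>i<n. e i s) - U s) * K)"
          using K by (simp add: mult_left_mono)
        also have "\<dots> \<le> \<bar>h\<bar> * (\<epsilon> / (K + 1) * (K + 1))"
          using M[OF that] K0 less_imp_le[OF pos] by (intro mult_left_mono mult_mono) (auto simp: dist_norm)
        finally show ?thesis using K0 by (simp add: mult.commute)
      qed
      then show ?thesis
        unfolding eventually_sequentially
        by (intro exI[of _ "Suc M"]) (metis Suc_le_D Suc_le_mono)
    qed
    obtain g where g: "\<And>s. s \<in> S \<Longrightarrow> (\<lambda>n. e n s) sums g s"
        "\<And>s. s \<in> S \<Longrightarrow> (g has_derivative (\<lambda>h. h *\<^sub>R A (U s))) (at s within S)"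
      using has_derivative_series[OF S(1) der ev tS summable_sums[OF summ_e]] by blast
    have gU: "g s = U s" if "s \<in> S" for s
      using g(1)[OF that] by (simp add: U_def sums_iff)
    have "(g has_derivative (\<lambda>h. h *\<^sub>R A (U t))) (at t)"
      using g(2)[OF tS] at_within_open[OF tS S(2)] by simp
    then have "(U has_derivative (\<lambda>h. h *\<^sub>R A (U t))) (at t)"
      by (rule has_derivative_transform_within_open[OF _ S(2) tS]) (rule gU)
    then show ?thesis by (simp add: has_vector_derivative_def)
  qed
  ultimately show ?thesis by blast
qed

text \<open>The choice of \<open>a 0\<close> makes the conserved energy \<open>B b' b' - B b b''\<close> nonpositive and \<open>B b b'\<close> positive
  at time \<open>0\<close>; then \<open>B b b\<close> is log-convex and initially increasing.\<close>

lemma hamiltonian_growth: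
  fixes B :: "'a::real_normed_vector \<Rightarrow> 'a \<Rightarrow> real" and a b :: "real \<Rightarrow> 'a"
  assumes B: "bounded_bilinear B" and sym: "\<And>x y. B x y = B y x"
    and pos: "\<And>x. x \<noteq> 0 \<Longrightarrow> 0 < B x x"
    and L: "bounded_linear L" and N: "bounded_linear N"
    and Lsa: "\<And>x y. B (L x) y = B x (L y)" and Nsa: "\<And>x y. B (N x) y = B x (N y)"
    and comm: "\<And>x. L (N x) = N (L x)" and mu: "0 < \<mu>" and eps: "0 < \<epsilon>"
    and a': "\<And>t. (a has_vector_derivative - (\<mu> *\<^sub>R N (b t))) (at t)"
    and b': "\<And>t. (b has_vector_derivative - (\<mu> *\<^sub>R L (a t))) (at t)"
    and a0: "a 0 = - (\<epsilon> *\<^sub>R L (b 0))"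
    and small: "\<epsilon>\<^sup>2 * B (L (L (b 0))) (L (L (b 0))) \<le> B (b 0) (L (N (b 0)))"
    and K: "0 < B (b 0) (L (N (b 0)))"
  shows "\<exists>c>0. \<exists>\<sigma>>0. \<forall>t\<ge>0. c * exp (\<sigma> * t) \<le> B (b t) (b t)"
proof -
  interpret B: bounded_bilinear B by fact
  interpret L: bounded_linear L by fact
  interpret N: bounded_linear N by fact
  have nonneg: "0 \<le> B x x" for x using pos[of x] by (cases "x = 0") (auto simp: B.zero_left)
  define b1 where "b1 t = - (\<mu> *\<^sub>R L (a t))" for t
  define b2 where "b2 t = \<mu>\<^sup>2 *\<^sub>R L (N (b t))" for t
  have Db: "(b has_vector_derivative b1 t) (at t)" for t using b' by (simp add: b1_def)
  have Db1: "(b1 has_vector_derivative b2 t) (at t)" for t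
  proof -
    have "((\<lambda>t. - (\<mu> *\<^sub>R L (a t))) has_vector_derivative - (\<mu> *\<^sub>R L (- (\<mu> *\<^sub>R N (b t))))) (at t)"
      by (intro derivative_intros bounded_linear.has_vector_derivative[OF L]
          bounded_linear.has_vector_derivative[OF bounded_linear_scaleR_right] a')
    then show ?thesis
      by (simp add: b1_def[abs_def] b2_def L.neg L.scaleR power2_eq_square)
  qed
  have Db2: "(b2 has_vector_derivative \<mu>\<^sup>2 *\<^sub>R L (N (b1 t))) (at t)" for t
    unfolding b2_def[abs_def]
    by (intro bounded_linear.has_vector_derivative[OF L] bounded_linear.has_vector_derivative[OF N]
          bounded_linear.has_vector_derivative[OF bounded_linear_scaleR_right] Db)
  define y where "y t = B (b t) (b t)" for t
  define z where "z t = B (b t) (b1 t)" for t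
  define E where "E t = B (b1 t) (b1 t) - B (b t) (b2 t)" for t
  have Dy: "(y has_real_derivative 2 * z t) (at t)" for t
    unfolding y_def[abs_def] has_real_derivative_iff_has_vector_derivative
    by (rule has_vector_derivative_eq_rhs[OF B.has_vector_derivative[OF Db Db]])
       (simp add: z_def sym)
  have Dz: "(z has_real_derivative B (b1 t) (b1 t) + B (b t) (b2 t)) (at t)" for t
    unfolding z_def[abs_def] has_real_derivative_iff_has_vector_derivative
    by (rule has_vector_derivative_eq_rhs[OF B.has_vector_derivative[OF Db Db1]]) simp
  \<comment> \<open>A product of symmetric operators is symmetric when they commute; this is what
    makes \<open>E\<close> constant.\<close>
  have LN: "B x (L (N w)) = B (L (N x)) w" for x w
    by (metis Lsa Nsa comm)
  have b1b2: "B (b1 t) (b2 t) = \<mu>\<^sup>2 * B (b t) (L (N (b1 t)))"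
    "B (b2 t) (b1 t) = \<mu>\<^sup>2 * B (b t) (L (N (b1 t)))" for t
    unfolding sym[of "b1 t" "b2 t"] unfolding b2_def B.scaleR_left real_scaleR_def LN by auto
  have DE: "(E has_real_derivative 0) (at t)" for t
    unfolding E_def[abs_def] has_real_derivative_iff_has_vector_derivative
    by (rule has_vector_derivative_eq_rhs[OF has_vector_derivative_diff[OF
          B.has_vector_derivative[OF Db1 Db1] B.has_vector_derivative[OF Db Db2]]])
       (simp add: b1b2 B.scaleR_right)
  have E_const: "E t = E 0" for t
    using DERIV_isconst_all[of E t 0] DE by blast
  have b10: "b1 0 = (\<mu> * \<epsilon>) *\<^sub>R L (L (b 0))"
    by (simp add: b1_def a0 L.neg L.scaleR)
  have E0: "E 0 \<le> 0"
  proof -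
    have "E 0 = \<mu>\<^sup>2 * (\<epsilon>\<^sup>2 * B (L (L (b 0))) (L (L (b 0))) - B (b 0) (L (N (b 0))))"
      by (simp add: E_def b10 b2_def B.scaleR_right B.scaleR_left power2_eq_square algebra_simps)
    then show ?thesis using small mu by (simp add: mult_le_0_iff)
  qed
  \<comment> \<open>If \<open>L (b 0)\<close> vanished, so would
    \<open>N (L (b 0)) = L (N (b 0))\<close>, against \<open>K\<close>.\<close>
  have Lb0: "L (b 0) \<noteq> 0"
    using K comm[of "b 0"] by (auto simp: N.zero B.zero_right)
  have b0: "b 0 \<noteq> 0" using Lb0 by (auto simp: L.zero)
  have y0: "0 < y 0" using pos[OF b0] by (simp add: y_def)
  have z0: "0 < z 0"
  proof -
    have "z 0 = \<mu> * \<epsilon> * B (L (b 0)) (L (b 0))"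
      by (simp add: z_def b10 B.scaleR_right Lsa)
    then show ?thesis using pos[OF Lb0] mu eps by simp
  qed
  \<comment> \<open>Half the logarithmic derivative of \<open>y\<close> at time 0. The aim
    \<open>0 \<le> p t\<close> says that this rate never drops, i.e.
    \<open>y' \<ge> 2 * \<rho> * y\<close>.\<close>
  define \<rho> where "\<rho> = z 0 / y 0"
  have rho: "0 < \<rho>" using z0 y0 by (simp add: \<rho>_def)
  define p where "p t = z t - \<rho> * y t" for t
  have p_nonneg: "0 \<le> p t" if "0 \<le> t" for t
  proof -
    let ?q = "\<lambda>t. exp (- (2 * \<rho> * t)) * p t"
    let ?q' = "\<lambda>t. exp (- (2 * \<rho> * t)) * (2 * B (b1 t - \<rho> *\<^sub>R b t) (b1 t - \<rho> *\<^sub>R b t) - E t)"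
    have Dq: "(?q has_real_derivative ?q' s) (at s)" for s
    proof -
      \<comment> \<open>Substituting \<open>E\<close> for \<open>B b b''\<close> completes the
        square: what remains is a nonnegative term minus \<open>E\<close>, and \<open>E\<close> is
        constant and nonpositive.\<close>
      have eq: "2 * B (b1 s - \<rho> *\<^sub>R b s) (b1 s - \<rho> *\<^sub>R b s) - E s
          = (B (b1 s) (b1 s) + B (b s) (b2 s)) - \<rho> * (2 * z s) - 2 * \<rho> * p s"
        by (simp add: B.diff_left B.diff_right B.scaleR_left B.scaleR_right E_def p_def z_def y_def
            sym[of "b1 s" "b s"] algebra_simps)
      show ?thesis unfolding p_def
        by (rule derivative_eq_intros Dy Dz refl)+
           (simp add: eq[unfolded p_def] algebra_simps)
    qed
    have "?q 0 \<le> ?q t"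
    proof (rule DERIV_nonneg_imp_nondecreasing[OF that])
      fix s :: real
      have "0 \<le> ?q' s"
        using nonneg[of "b1 s - \<rho> *\<^sub>R b s"] E0 E_const[of s] by simp
      then show "\<exists>d. (?q has_real_derivative d) (at s) \<and> 0 \<le> d" using Dq by blast
    qed
    moreover have "p 0 = 0" using y0 by (simp add: p_def \<rho>_def)
    ultimately show ?thesis by (simp add: zero_le_mult_iff)
  qed
  have "y 0 * exp (2 * \<rho> * t) \<le> y t" if "0 \<le> t" for t
  proof -
    let ?q = "\<lambda>t. exp (- (2 * \<rho> * t)) * y t"
    have Dq: "(?q has_real_derivative exp (- (2 * \<rho> * s)) * (2 * p s)) (at s)" for s
      unfolding p_def
      by (rule derivative_eq_intros Dy refl)+ (simp add: algebra_simps)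
    have "?q 0 \<le> ?q t"
    proof (rule DERIV_nonneg_imp_nondecreasing[OF that])
      fix s :: real assume "0 \<le> s" "s \<le> t"
      then show "\<exists>d. (?q has_real_derivative d) (at s) \<and> 0 \<le> d"
        using Dq[of s] p_nonneg[of s] by (intro exI[of _ "exp (- (2 * \<rho> * s)) * (2 * p s)"]) simp
    qed
    then show ?thesis by (simp add: exp_minus field_simps)
  qed
  then have "\<exists>\<sigma>>0. \<forall>t\<ge>0. y 0 * exp (\<sigma> * t) \<le> B (b t) (b t)"
    using rho by (intro exI[of _ "2 * \<rho>"]) (simp add: y_def)
  with y0 show ?thesis by blast
qed

text \<open>The pair \<open>(a, b)\<close> evolves under one bounded operator on the product space,
  so the flow exists. The datum \<open>b0\<close> is given; only the initial \<open>a\<close> is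
  adjusted to it.\<close>

lemma hamiltonian_instability:
  fixes B :: "'a::banach \<Rightarrow> 'a \<Rightarrow> real"
  assumes B: "bounded_bilinear B" and sym: "\<And>x y. B x y = B y x"
    and pos: "\<And>x. x \<noteq> 0 \<Longrightarrow> 0 < B x x"
    and L: "bounded_linear L" and N: "bounded_linear N"
    and Lsa: "\<And>x y. B (L x) y = B x (L y)" and Nsa: "\<And>x y. B (N x) y = B x (N y)"
    and comm: "\<And>x. L (N x) = N (L x)" and mu: "0 < \<mu>"
    and K: "0 < B b0 (L (N b0))"
  shows "\<exists>a b. (\<forall>t. (a has_vector_derivative - (\<mu> *\<^sub>R N (b t))) (at t)) \<and>
               (\<forall>t. (b has_vector_derivative - (\<mu> *\<^sub>R L (a t))) (at t)) \<and>
               (\<exists>c>0. \<exists>\<sigma>>0. \<forall>t\<ge>0. c * exp (\<sigma> * t) \<le> B (b t) (b t))"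
proof -
  interpret L: bounded_linear L by fact
  define k where "k = B b0 (L (N b0))"
  define m where "m = B (L (L b0)) (L (L b0))"
  have m0: "0 \<le> m" unfolding m_def using pos[of "L (L b0)"]
    by (cases "L (L b0) = 0") (auto simp: bounded_bilinear.zero_left[OF B])
  \<comment> \<open>Chosen for \<open>\<epsilon>^2 * m \<le> k\<close>, the smallness hypothesis of
    \<open>hamiltonian_growth\<close>; \<open>m + 1\<close> keeps the divisor positive.\<close>
  define \<epsilon> where "\<epsilon> = sqrt (k / (m + 1))"
  have k0: "0 < k" using K by (simp add: k_def)
  have eps: "0 < \<epsilon>" using k0 m0 by (simp add: \<epsilon>_def)
  have "\<epsilon>\<^sup>2 * m = k / (m + 1) * m" using k0 m0 by (simp add: \<epsilon>_def)
  also have "\<dots> \<le> k" using k0 m0 by (simp add: field_simps)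
  finally have small: "\<epsilon>\<^sup>2 * m \<le> k" .
  define A where "A = (\<lambda>(x, y). (- (\<mu> *\<^sub>R N y), - (\<mu> *\<^sub>R L x)))"
  have "bounded_linear (\<lambda>p. (- (\<mu> *\<^sub>R N (snd p)), - (\<mu> *\<^sub>R L (fst p))))"
    by (intro bounded_linear_Pair bounded_linear_minus bounded_linear_const_scaleR
        bounded_linear_compose[OF L] bounded_linear_compose[OF N] bounded_linear_fst bounded_linear_snd)
  then have "bounded_linear A" by (simp add: A_def case_prod_unfold)
  from bounded_linear_flow_exists[OF this, of "(- (\<epsilon> *\<^sub>R L b0), b0)"]
  obtain U where U0: "U 0 = (- (\<epsilon> *\<^sub>R L b0), b0)"
    and U: "\<And>t. (U has_vector_derivative A (U t)) (at t)" by blast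
  define a b where "a t = fst (U t)" and "b t = snd (U t)" for t
  have Da: "(a has_vector_derivative - (\<mu> *\<^sub>R N (b t))) (at t)" for t
    using bounded_linear.has_vector_derivative[OF bounded_linear_fst U]
    by (simp add: a_def[abs_def] b_def A_def case_prod_unfold)
  have Db: "(b has_vector_derivative - (\<mu> *\<^sub>R L (a t))) (at t)" for t
    using bounded_linear.has_vector_derivative[OF bounded_linear_snd U]
    by (simp add: a_def b_def[abs_def] A_def case_prod_unfold)
  have "\<exists>c>0. \<exists>\<sigma>>0. \<forall>t\<ge>0. c * exp (\<sigma> * t) \<le> B (b t) (b t)"
    by (rule hamiltonian_growth[OF B sym pos L N Lsa Nsa comm mu eps Da Db])
       (use U0 small K in \<open>simp_all add: a_def b_def k_def m_def\<close>)
  with Da Db show ?thesis by blast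
qed


section \<open>Gaussian correlation of weighted sequences\<close>

lemma summable_on_intI:
  fixes f :: "int \<Rightarrow> real"
  assumes "(\<lambda>n. f (int n)) summable_on UNIV" "(\<lambda>n. f (- int n)) summable_on UNIV"
  shows "f summable_on UNIV"
proof -
  have 1: "f summable_on range int"
    by (subst summable_on_reindex) (use assms(1) in \<open>auto simp: o_def\<close>)
  have 2: "f summable_on range (\<lambda>n. - int n)"
    by (subst summable_on_reindex) (use assms(2) in \<open>auto simp: o_def inj_def\<close>)
  have "n \<in> range int \<union> range (\<lambda>n. - int n)" for n
    by (cases n rule: int_cases2) auto
  then have "range int \<union> range (\<lambda>n. - int n) = UNIV" by blast
  with summable_on_union[OF 1 2] show ?thesis by simp
qed

lemma summable_on_exp_abs_int:
  assumes "0 < (c::real)"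
  shows "(\<lambda>n::int. exp (- (c * \<bar>of_int n\<bar>))) summable_on UNIV"
proof -
  have "(\<lambda>n::nat. exp (- c) ^ n) summable_on UNIV"
  proof (rule summable_nonneg_imp_summable_on)
    show "summable (\<lambda>n::nat. exp (- c) ^ n)"
      by (rule summable_geometric) (use assms in simp)
  qed simp
  moreover have "exp (- c) ^ n = exp (- (c * real n))" for n
    using exp_of_nat_mult[of n "- c"] by (simp add: mult.commute)
  ultimately have *: "(\<lambda>n::nat. exp (- (c * real n))) summable_on UNIV"
    by (simp only:)
  show ?thesis
  proof (rule summable_on_intI)
    show "(\<lambda>n. exp (- (c * \<bar>real_of_int (int n)\<bar>))) summable_on UNIV"
      using * by simp
    show "(\<lambda>n. exp (- (c * \<bar>real_of_int (- int n)\<bar>))) summable_on UNIV"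
      using * by simp
  qed
qed

lemma infsum_add_shift_int:
  fixes f :: "int \<Rightarrow> 'a::{t2_space,topological_comm_monoid_add}"
  shows "(\<Sum>\<^sub>\<infinity>n. f (n + m)) = (\<Sum>\<^sub>\<infinity>n. f n)"
  by (rule infsum_reindex_bij_witness[of _ "\<lambda>n. n - m" "\<lambda>n. n + m"]) simp_all

lemma summable_on_add_shift_int:
  fixes f :: "int \<Rightarrow> 'a::{t2_space,topological_comm_monoid_add}"
  assumes "f summable_on UNIV"
  shows "(\<lambda>n. f (n + m)) summable_on UNIV"
  using assms summable_on_reindex_bij_witness[of UNIV "\<lambda>n. n - m" "\<lambda>n. n + m" UNIV f "\<lambda>n. f (n + m)"]
  by simp

text \<open>These Gaussian factors arise when three modes are multiplied and projected. With
  \<open>h = pi / \<gamma>\<close> they are also the summands inside \<open>lam\<close>.\<close>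

definition gw :: "real \<Rightarrow> int \<Rightarrow> real" where
  "gw h p = exp (- (h\<^sup>2 * (of_int p)\<^sup>2))"

definition expw :: "real \<Rightarrow> int \<Rightarrow> real" where
  "expw k n = exp (- (k * \<bar>of_int n\<bar>))"

lemma gw_pos [simp]: "0 < gw h p" and gw_nonneg [simp]: "0 \<le> gw h p"
  and gw_minus [simp]: "gw h (- p) = gw h p" and gw_0 [simp]: "gw h 0 = 1"
  by (auto simp: gw_def)

lemma expw_pos [simp]: "0 < expw k n" and expw_nonneg [simp]: "0 \<le> expw k n"
  and expw_nonzero [simp]: "expw k n \<noteq> 0"
  by (auto simp: expw_def)

lemma expw_le_1: "0 \<le> k \<Longrightarrow> expw k n \<le> 1"
  by (simp add: expw_def)

lemma summable_on_expw: "0 < k \<Longrightarrow> expw k summable_on UNIV"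
  unfolding expw_def[abs_def] by (rule summable_on_exp_abs_int)

lemma summable_on_gw_exp:
  assumes "0 < h"
  shows "(\<lambda>p::int. gw h p * exp (k * \<bar>of_int p\<bar>)) summable_on UNIV"
proof (rule summable_on_comparison_test)
  \<comment> \<open>Completing the square in \<open>h * |p|\<close>. The extra 1 in
    \<open>k + 1\<close> leaves a factor \<open>exp (- |p|)\<close> over for the summation.\<close>
  define C where "C = exp ((k + 1)\<^sup>2 / (4 * h\<^sup>2))"
  show "(\<lambda>p::int. C * exp (- (1 * \<bar>of_int p\<bar>))) summable_on UNIV"
    by (intro summable_on_cmult_right summable_on_exp_abs_int) simp
  fix p :: int
  let ?x = "\<bar>of_int p\<bar> :: real"
  have "0 \<le> (h * ?x - (k + 1) / (2 * h))\<^sup>2" by simp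
  also have "\<dots> = h\<^sup>2 * ?x\<^sup>2 - (k + 1) * ?x + (k + 1)\<^sup>2 / (4 * h\<^sup>2)"
    using assms by (simp add: power2_diff power_mult_distrib power_divide)
  finally have "- (h\<^sup>2 * ?x\<^sup>2) + k * ?x \<le> (k + 1)\<^sup>2 / (4 * h\<^sup>2) + - ?x"
    by (simp add: algebra_simps)
  then show "gw h p * exp (k * ?x) \<le> C * exp (- (1 * ?x))"
    by (simp add: gw_def C_def exp_add[symmetric])
qed (auto simp: gw_nonneg)

lemma summable_on_gw: "0 < h \<Longrightarrow> gw h summable_on UNIV"
  using summable_on_gw_exp[of h 0] by simp

section \<open>Bounded two-sided sequences as a Banach space\<close>

lemma int_bcontfun_apply_inverse:
  fixes f :: "int \<Rightarrow> 'a::real_normed_vector"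
  assumes "\<And>n. norm (f n) \<le> C"
  shows "apply_bcontfun (Bcontfun f) = f"
proof (rule Bcontfun_inverse)
  show "f \<in> bcontfun" using assms by (intro bcontfun_normI) auto
qed

text \<open>This distance induces the discrete topology the integers already carry, so every bounded
  sequence is a bounded continuous function and the sup norm is complete.\<close>

instantiation int :: metric_space
begin

definition dist_int :: "int \<Rightarrow> int \<Rightarrow> real" where
  "dist_int m n = of_int \<bar>m - n\<bar>"

definition uniformity_int :: "(int \<times> int) filter" where
  "uniformity_int = (INF e\<in>{0<..}. principal {(m, n). dist m n < e})"

instance
proof
  fix U :: "int set"
  have eq: "n = m" if "dist m n < 1" for m n :: int
  proof -
    have "\<bar>m - n\<bar> < 1" using that unfolding dist_int_def by (simp only: of_int_less_1_iff)
    then show ?thesis by simp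
  qed
  have "\<forall>\<^sub>F (m', n) in uniformity. m' = m \<longrightarrow> n \<in> U" if "m \<in> U" for m
    unfolding uniformity_int_def
    by (rule eventually_INF1[of 1]) (use that eq in \<open>auto simp: eventually_principal\<close>)
  then show "open U \<longleftrightarrow> (\<forall>m\<in>U. \<forall>\<^sub>F (m', n) in uniformity. m' = m \<longrightarrow> n \<in> U)"
    by (simp add: discrete_topology_class.open_discrete)
  show "dist l m \<le> dist l n + dist m n" for l m n :: int
    unfolding dist_int_def of_int_add[symmetric] of_int_le_iff by linarith
qed (auto simp: dist_int_def uniformity_int_def)

end

instance bcontfun :: (metric_space, banach) banach ..

text \<open>At \<open>k = 0\<close> this is the theta constant \<open>\<theta>\<close> of the
  overview. At \<open>k > 0\<close> it bounds the norm of the correlation on weighted sequences; the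
  values at 1 and 2 bound norm and error uniformly for weights \<open>k \<le> 1\<close>.\<close>

definition gw_mass :: "real \<Rightarrow> real \<Rightarrow> real" where
  "gw_mass h k = (\<Sum>\<^sub>\<infinity>p. gw h p * exp (k * \<bar>of_int p\<bar>))"

lemma gw_mass_0: "gw_mass h 0 = (\<Sum>\<^sub>\<infinity>p. gw h p)"
  by (simp add: gw_mass_def)

lemma gw_mass_nonneg [simp]: "0 \<le> gw_mass h k"
  unfolding gw_mass_def by (intro infsum_nonneg) auto

lemma gw_mass_mono: "0 < h \<Longrightarrow> k \<le> l \<Longrightarrow> gw_mass h k \<le> gw_mass h l"
  unfolding gw_mass_def
  by (intro infsum_mono summable_on_gw_exp) (auto intro!: mult_left_mono mult_right_mono)

lemma gw_mass_pos: 
  assumes "0 < h" shows "0 < gw_mass h k"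
proof -
  have "(\<Sum>p\<in>{0::int}. gw h p * exp (k * \<bar>of_int p\<bar>)) \<le> gw_mass h k"
    unfolding gw_mass_def
    by (intro finite_sum_le_infsum summable_on_gw_exp assms) auto
  then show ?thesis by simp
qed

text \<open>A bounded sequence \<open>x\<close> stands for the coefficient sequence \<open>expw k n * x n\<close>; \<open>conv_gw h k\<close> is
  the correlation of coefficient sequences with the Gaussian \<open>gw h\<close>.\<close>

definition conv_gw :: "real \<Rightarrow> real \<Rightarrow> (int \<Rightarrow>\<^sub>C real) \<Rightarrow> (int \<Rightarrow>\<^sub>C real)" where
  "conv_gw h k x = Bcontfun (\<lambda>n. \<Sum>\<^sub>\<infinity>p. gw h p * (expw k (n + p) / expw k n) * x (n + p))"

text \<open>The weight is log-Lipschitz, since \<open>|n|\<close> and \<open>|n + p|\<close> differ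
  by at most \<open>|p|\<close>. A shift by \<open>p\<close> therefore costs a factor depending on
  \<open>p\<close> alone, which the Gaussian absorbs.\<close>

lemma expw_quotient: 
  "expw k (n + p) / expw k n \<le> exp (\<bar>k\<bar> * \<bar>of_int p\<bar>)" 
  "exp (- (\<bar>k\<bar> * \<bar>of_int p\<bar>)) \<le> expw k (n + p) / expw k n"
proof -
  have "\<bar>k * (\<bar>of_int n\<bar> - \<bar>of_int (n + p)\<bar>)\<bar> \<le> \<bar>k\<bar> * \<bar>of_int p :: real\<bar>"
    by (simp only: abs_mult) (intro mult_left_mono, auto)
  then show "expw k (n + p) / expw k n \<le> exp (\<bar>k\<bar> * \<bar>of_int p\<bar>)" 
    "exp (- (\<bar>k\<bar> * \<bar>of_int p\<bar>)) \<le> expw k (n + p) / expw k n"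
    by (auto simp: expw_def exp_diff[symmetric] right_diff_distrib abs_le_iff)
qed

lemma conv_gw_term_le:
  assumes "0 \<le> k"
  shows "\<bar>gw h p * (expw k (n + p) / expw k n) * (x :: int \<Rightarrow>\<^sub>C real) (n + p)\<bar>
    \<le> gw h p * exp (k * \<bar>of_int p\<bar>) * norm x"
proof -
  have "\<bar>gw h p * (expw k (n + p) / expw k n) * x (n + p)\<bar>
     = gw h p * (expw k (n + p) / expw k n) * \<bar>x (n + p)\<bar>"
    by (simp add: abs_mult)
  also have "\<dots> \<le> gw h p * exp (k * \<bar>of_int p\<bar>) * norm x"
    using norm_bounded[of x "n + p"] expw_quotient(1)[of k n p] assms
    by (intro mult_mono mult_left_mono) auto
  finally show ?thesis .
qed

lemma conv_gw_summable:
  assumes "0 < h" "0 \<le> k"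
  shows "(\<lambda>p. gw h p * (expw k (n + p) / expw k n) * (x :: int \<Rightarrow>\<^sub>C real) (n + p)) summable_on UNIV"
    (is "?f summable_on _")
proof -
  have "(\<lambda>p. gw h p * exp (k * \<bar>of_int p\<bar>) * norm x) summable_on UNIV"
    by (intro summable_on_cmult_left summable_on_gw_exp assms)
  then have "(\<lambda>n. norm (?f n)) summable_on UNIV"
    by (rule summable_on_comparison_test) (use conv_gw_term_le[OF assms(2)] in \<open>simp_all only: real_norm_def abs_ge_zero\<close>)
  then show ?thesis by (rule abs_summable_summable)
qed

lemma conv_gw_sum_le:
  assumes "0 < h" "0 \<le> k"
  shows "norm (\<Sum>\<^sub>\<infinity>p. gw h p * (expw k (n + p) / expw k n) * (x :: int \<Rightarrow>\<^sub>C real) (n + p))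
     \<le> norm x * gw_mass h k"
proof -
  have "norm (\<Sum>\<^sub>\<infinity>p. gw h p * (expw k (n + p) / expw k n) * x (n + p))
     \<le> (\<Sum>\<^sub>\<infinity>p. gw h p * exp (k * \<bar>of_int p\<bar>) * norm x)"
    by (rule norm_infsum_le[OF has_sum_infsum has_sum_infsum],
        rule conv_gw_summable[OF assms], rule summable_on_cmult_left[OF summable_on_gw_exp[OF assms(1)]])
       (use conv_gw_term_le[OF assms(2)] in \<open>simp only: real_norm_def\<close>)
  also have "\<dots> = norm x * gw_mass h k"
    unfolding gw_mass_def by (subst infsum_cmult_left') (rule mult.commute)
  finally show ?thesis .
qed

lemma conv_gw_apply:
  assumes "0 < h" "0 \<le> k"
  shows "apply_bcontfun (conv_gw h k x) n
    = (\<Sum>\<^sub>\<infinity>p. gw h p * (expw k (n + p) / expw k n) * x (n + p))"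
  unfolding conv_gw_def
  by (subst int_bcontfun_apply_inverse[OF conv_gw_sum_le[OF assms]]) simp

lemma norm_conv_gw:
  assumes "0 < h" "0 \<le> k"
  shows "norm (conv_gw h k x) \<le> norm x * gw_mass h k"
  by (rule norm_bound) (simp only: conv_gw_apply[OF assms] conv_gw_sum_le[OF assms])

lemma bounded_linear_conv_gw:
  assumes "0 < h" "0 \<le> k"
  shows "bounded_linear (conv_gw h k)"
proof (rule bounded_linear_intro)
  show "conv_gw h k (x + y) = conv_gw h k x + conv_gw h k y" for x y
    by (rule bcontfun_eqI)
       (simp only: plus_bcontfun.rep_eq conv_gw_apply[OF assms] distrib_left
         infsum_add[OF conv_gw_summable[OF assms] conv_gw_summable[OF assms]])
  show "conv_gw h k (r *\<^sub>R x) = r *\<^sub>R conv_gw h k x" for r x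
    by (rule bcontfun_eqI)
       (simp only: scaleR_bcontfun.rep_eq conv_gw_apply[OF assms] real_scaleR_def mult.left_commute[of _ r]
         infsum_cmult_right')
qed (rule norm_conv_gw[OF assms])

text \<open>The weight is squared because both arguments stand for coefficient sequences
  \<open>expw k n * x n\<close>: this is their ordinary l2 product, the one for which the
  correlation is symmetric.\<close>

definition weighted_inner :: "real \<Rightarrow> (int \<Rightarrow>\<^sub>C real) \<Rightarrow> (int \<Rightarrow>\<^sub>C real) \<Rightarrow> real" where
  "weighted_inner k x y = (\<Sum>\<^sub>\<infinity>n. (expw k n)\<^sup>2 * x n * y n)"

lemma summable_on_expw_sq: 
  assumes "0 < k" shows "(\<lambda>n. (expw k n)\<^sup>2) summable_on UNIV"
proof -
  have "(\<lambda>n. (expw k n)\<^sup>2) = expw (2 * k)"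
    by (auto simp: expw_def power2_eq_square exp_add[symmetric])
  then show ?thesis using summable_on_expw[of "2 * k"] assms by simp
qed

lemma weighted_inner_term_le:
  "\<bar>(expw k n)\<^sup>2 * (x :: int \<Rightarrow>\<^sub>C real) n * (y :: int \<Rightarrow>\<^sub>C real) n\<bar> \<le> (expw k n)\<^sup>2 * (norm x * norm y)"
  using norm_bounded[of x n] norm_bounded[of y n]
  by (auto simp: abs_mult mult.assoc intro!: mult_left_mono mult_mono)

lemma weighted_inner_summable:
  assumes "0 < k"
  shows "(\<lambda>n. (expw k n)\<^sup>2 * (x :: int \<Rightarrow>\<^sub>C real) n * (y :: int \<Rightarrow>\<^sub>C real) n) summable_on UNIV"
    (is "?f summable_on _")
proof -
  have "(\<lambda>n. (expw k n)\<^sup>2 * (norm x * norm y)) summable_on UNIV"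
    by (intro summable_on_cmult_left summable_on_expw_sq assms)
  then have "(\<lambda>n. norm (?f n)) summable_on UNIV"
    by (rule summable_on_comparison_test) (use weighted_inner_term_le in \<open>simp_all only: real_norm_def abs_ge_zero\<close>)
  then show ?thesis by (rule abs_summable_summable)
qed

lemma weighted_inner_le:
  assumes "0 < k"
  shows "\<bar>weighted_inner k x y\<bar> \<le> norm x * norm y * (\<Sum>\<^sub>\<infinity>n. (expw k n)\<^sup>2)"
proof -
  have "norm (\<Sum>\<^sub>\<infinity>n. (expw k n)\<^sup>2 * x n * y n) \<le> (\<Sum>\<^sub>\<infinity>n. (expw k n)\<^sup>2 * (norm x * norm y))"
    by (rule norm_infsum_le[OF has_sum_infsum has_sum_infsum],
        rule weighted_inner_summable[OF assms], rule summable_on_cmult_left[OF summable_on_expw_sq[OF assms]])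
       (use weighted_inner_term_le in \<open>simp only: real_norm_def\<close>)
  also have "\<dots> = norm x * norm y * (\<Sum>\<^sub>\<infinity>n. (expw k n)\<^sup>2)"
    by (subst infsum_cmult_left') (rule mult.commute)
  finally show ?thesis by (simp add: weighted_inner_def)
qed

lemma weighted_inner_commute: "weighted_inner k x y = weighted_inner k y x"
  by (simp add: weighted_inner_def mult_ac)

lemma bounded_bilinear_weighted_inner:
  assumes "0 < k"
  shows "bounded_bilinear (weighted_inner k)"
proof
  show add: "weighted_inner k (x + x') y = weighted_inner k x y + weighted_inner k x' y" for x x' y
    unfolding weighted_inner_def
    by (simp only: plus_bcontfun.rep_eq distrib_left distrib_right
        infsum_add[OF weighted_inner_summable[OF assms] weighted_inner_summable[OF assms]])
  show "weighted_inner k x (y + y') = weighted_inner k x y + weighted_inner k x y'" for x y y'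
    using add[of y y' x] by (simp add: weighted_inner_commute)
  show scale: "weighted_inner k (r *\<^sub>R x) y = r *\<^sub>R weighted_inner k x y" for r x y
    unfolding weighted_inner_def
    by (simp only: scaleR_bcontfun.rep_eq real_scaleR_def mult.left_commute[of _ r] mult.assoc
        infsum_cmult_right')
  show "weighted_inner k x (r *\<^sub>R y) = r *\<^sub>R weighted_inner k x y" for r x y
    using scale[of r y x] by (simp add: weighted_inner_commute)
  show "\<exists>K. \<forall>x y. norm (weighted_inner k x y) \<le> norm x * norm y * K"
    using weighted_inner_le[OF assms] by auto
qed

lemma weighted_inner_pos:
  assumes "0 < k" "x \<noteq> 0"
  shows "0 < weighted_inner k x x"
proof -
  obtain m where m: "x m \<noteq> 0" using assms(2) bcontfun_eqI[of x 0] by auto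
  have "(\<Sum>n\<in>{m}. (expw k n)\<^sup>2 * x n * x n) \<le> weighted_inner k x x"
    unfolding weighted_inner_def
    by (intro finite_sum_le_infsum weighted_inner_summable assms) (auto simp: mult.assoc)
  moreover have "0 < (expw k m)\<^sup>2 * x m * x m"
    using m by (simp add: mult.assoc zero_less_mult_iff) (metis linorder_neqE_linordered_idom)
  ultimately show ?thesis by simp
qed

text \<open>In the double series over \<open>(n, p)\<close> the substitution
  \<open>(n + p, - p)\<close> exchanges \<open>x\<close> and \<open>y\<close>, because
  \<open>gw h\<close> is even. Absolute summability allows passing between the iterated and the
  double sum.\<close>

lemma conv_gw_selfadjoint:
  assumes h: "0 < h" and k: "0 < k"
  shows "weighted_inner k (conv_gw h k x) y = weighted_inner k x (conv_gw h k y)"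
proof -
  have k': "0 \<le> k" using k by simp
  define F where "F x y = (\<lambda>(n, p). gw h p * expw k (n + p) * expw k n * x (n + p) * y n)"
    for x y :: "int \<Rightarrow>\<^sub>C real"
  have eq: "weighted_inner k (conv_gw h k x) y = (\<Sum>\<^sub>\<infinity>z. F x y z)"
    and summ: "F x y summable_on UNIV" for x y
  proof -
    \<comment> \<open>Of the two weights one is kept to sum over \<open>n\<close> and the other is
      bounded by 1; the sum over \<open>p\<close> rests on the Gaussian.\<close>
    have "(\<lambda>(n, p). expw k n * gw h p * (norm x * norm y)) summable_on Sigma UNIV (\<lambda>_. UNIV)"
    proof (rule summable_on_SigmaI)
      show "((\<lambda>p. case (n, p) of (n, p) \<Rightarrow> expw k n * gw h p * (norm x * norm y)) has_sum
          expw k n * (\<Sum>\<^sub>\<infinity>p. gw h p) * (norm x * norm y)) UNIV" for n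
        unfolding case_prod_conv
        by (intro has_sum_cmult_left has_sum_cmult_right has_sum_infsum summable_on_gw h)
      show "(\<lambda>n. expw k n * (\<Sum>\<^sub>\<infinity>p. gw h p) * (norm x * norm y)) summable_on UNIV"
        by (intro summable_on_cmult_left summable_on_expw k)
    qed simp
    then have "(\<lambda>z. norm (F x y z)) summable_on UNIV"
      unfolding UNIV_Times_UNIV
    proof (rule summable_on_comparison_test)
      fix z :: "int \<times> int"
      obtain n p where z: "z = (n, p)" by force
      have "norm (F x y z) = expw k n * gw h p * (expw k (n + p) * (\<bar>x (n + p)\<bar> * \<bar>y n\<bar>))"
        by (simp add: F_def z abs_mult mult_ac)
      also have "\<dots> \<le> expw k n * gw h p * (1 * (norm x * norm y))"
        using norm_bounded[of x "n + p"] norm_bounded[of y n] expw_le_1[OF k', of "n + p"]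
        by (intro mult_left_mono mult_mono) auto
      finally show "norm (F x y z) \<le> (case z of (n, p) \<Rightarrow> expw k n * gw h p * (norm x * norm y))"
        by (simp add: z)
    qed auto
    then show summ: "F x y summable_on UNIV" by (rule abs_summable_summable)
    have "(\<Sum>\<^sub>\<infinity>z. F x y z) = (\<Sum>\<^sub>\<infinity>n. \<Sum>\<^sub>\<infinity>p. F x y (n, p))"
      using infsum_Sigma_banach[of "F x y" UNIV "\<lambda>_. UNIV"] summ by simp
    also have "\<dots> = weighted_inner k (conv_gw h k x) y"
      unfolding weighted_inner_def conv_gw_apply[OF h k']
    proof (rule infsum_cong)
      fix n
      have "F x y (n, p) = (expw k n)\<^sup>2 * y n * (gw h p * (expw k (n + p) / expw k n) * x (n + p))" for p
        by (simp add: F_def field_simps power2_eq_square)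
      then have "(\<Sum>\<^sub>\<infinity>p. F x y (n, p)) = (\<Sum>\<^sub>\<infinity>p. (expw k n)\<^sup>2 * y n * (gw h p * (expw k (n + p) / expw k n) * x (n + p)))"
        by (simp only:)
      also have "\<dots> = (expw k n)\<^sup>2 * y n * (\<Sum>\<^sub>\<infinity>p. gw h p * (expw k (n + p) / expw k n) * x (n + p))"
        by (rule infsum_cmult_right')
      finally show "(\<Sum>\<^sub>\<infinity>p. F x y (n, p)) =
          (expw k n)\<^sup>2 * (\<Sum>\<^sub>\<infinity>p. gw h p * (expw k (n + p) / expw k n) * x (n + p)) * y n"
        by (simp only: mult_ac)
    qed
    finally show "weighted_inner k (conv_gw h k x) y = (\<Sum>\<^sub>\<infinity>z. F x y z)" by simp
  qed
  have "(\<Sum>\<^sub>\<infinity>z. F x y z) = (\<Sum>\<^sub>\<infinity>z. F y x z)"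
    by (rule infsum_reindex_bij_witness[of _ "\<lambda>(n, p). (n + p, - p)" "\<lambda>(n, p). (n + p, - p)"])
       (auto simp: F_def mult_ac)
  then show ?thesis
    using eq[of x y] eq[of y x] by (simp add: weighted_inner_commute)
qed


text \<open>The Fourier symbol of the correlation, real because the Gaussian is even; at
  \<open>\<xi> = 0\<close> it takes its maximum \<open>gw_mass h 0\<close>.\<close>

definition gw_hat :: "real \<Rightarrow> real \<Rightarrow> real" where
  "gw_hat h \<xi> = (\<Sum>\<^sub>\<infinity>p. gw h p * cos (of_int p * \<xi>))"

lemma summable_on_gw_bounded:
  fixes f :: "int \<Rightarrow> real"
  assumes "0 < h" "\<And>p. \<bar>f p\<bar> \<le> 1"
  shows "(\<lambda>p. gw h p * f p) summable_on UNIV"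
proof -
  have "(\<lambda>p. norm (gw h p * f p)) summable_on UNIV"
    by (rule summable_on_comparison_test[OF summable_on_gw[OF assms(1)]])
       (use assms(2) in \<open>auto simp: abs_mult intro!: mult_left_le\<close>)
  then show ?thesis by (rule abs_summable_summable)
qed

text \<open>The phase \<open>\<alpha>\<close> covers cosine (\<open>\<alpha> = 0\<close>) and sine
  (\<open>\<alpha> = pi/2\<close>) at once; their squares add up to 1, which replaces a lower bound
  for the norm of either wave.\<close>

definition plane_wave :: "real \<Rightarrow> real \<Rightarrow> (int \<Rightarrow>\<^sub>C real)" where
  "plane_wave \<xi> \<alpha> = Bcontfun (\<lambda>n. cos (of_int n * \<xi> - \<alpha>))"

lemma plane_wave_apply: "apply_bcontfun (plane_wave \<xi> \<alpha>) n = cos (of_int n * \<xi> - \<alpha>)"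
  unfolding plane_wave_def by (subst int_bcontfun_apply_inverse[of _ 1]) auto

lemma norm_plane_wave: "norm (plane_wave \<xi> \<alpha>) \<le> 1"
  by (rule norm_bound) (simp add: plane_wave_apply)

text \<open>By the addition theorem the sum splits into a cosine and a sine part, and the sine part
  vanishes by oddness. Without a weight, plane waves are thus exact eigenvectors.\<close>

lemma sum_gw_plane_wave:
  assumes "0 < h"
  shows "(\<Sum>\<^sub>\<infinity>p. gw h p * plane_wave \<xi> \<alpha> (n + p)) = gw_hat h \<xi> * plane_wave \<xi> \<alpha> n"
proof -
  define S where "S = (\<Sum>\<^sub>\<infinity>p. gw h p * sin (of_int p * \<xi>))"
  have "S = (\<Sum>\<^sub>\<infinity>p. gw h (- p) * sin (of_int (- p) * \<xi>))"
    unfolding S_def by (rule infsum_reindex_bij_witness[of _ uminus uminus]) auto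
  also have "\<dots> = (\<Sum>\<^sub>\<infinity>p. - (gw h p * sin (of_int p * \<xi>)))" by simp
  also have "\<dots> = - S" unfolding S_def by (rule infsum_uminus)
  finally have S0: "S = 0" by simp
  have "((\<lambda>p. gw h p * cos (of_int p * \<xi>)) has_sum gw_hat h \<xi>) UNIV"
    unfolding gw_hat_def by (intro has_sum_infsum summable_on_gw_bounded assms) simp
  moreover have "((\<lambda>p. gw h p * sin (of_int p * \<xi>)) has_sum 0) UNIV"
    unfolding S0[symmetric] S_def by (intro has_sum_infsum summable_on_gw_bounded assms) simp
  ultimately have "((\<lambda>p. (gw h p * cos (of_int p * \<xi>)) * cos (of_int n * \<xi> - \<alpha>)
      + (gw h p * sin (of_int p * \<xi>)) * (- sin (of_int n * \<xi> - \<alpha>)))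
      has_sum (gw_hat h \<xi> * cos (of_int n * \<xi> - \<alpha>) + 0 * (- sin (of_int n * \<xi> - \<alpha>)))) UNIV"
    by (intro has_sum_add has_sum_cmult_left)
  moreover have "(gw h p * cos (of_int p * \<xi>)) * cos (of_int n * \<xi> - \<alpha>)
      + (gw h p * sin (of_int p * \<xi>)) * (- sin (of_int n * \<xi> - \<alpha>))
      = gw h p * cos (of_int (n + p) * \<xi> - \<alpha>)" for p
  proof -
    have "of_int (n + p) * \<xi> - \<alpha> = of_int p * \<xi> + (of_int n * \<xi> - \<alpha>)"
      by (simp add: algebra_simps)
    then show ?thesis by (simp only: cos_add) (simp add: algebra_simps)
  qed
  ultimately have "((\<lambda>p. gw h p * cos (of_int (n + p) * \<xi> - \<alpha>)) has_sum
      gw_hat h \<xi> * cos (of_int n * \<xi> - \<alpha>)) UNIV"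
    by simp
  then show ?thesis by (simp only: plane_wave_apply infsumI)
qed

text \<open>Relative to the unweighted case the only change is the quotient of weights, which
  differs from 1 by at most \<open>k * exp (2 * |p|)\<close>. The eigenvalue equation is therefore
  off by order \<open>k\<close>, uniformly in \<open>\<xi>\<close> and
  \<open>\<alpha>\<close>.\<close>

lemma conv_gw_plane_wave:
  assumes h: "0 < h" and k: "0 \<le> k" "k \<le> 1"
  shows "norm (conv_gw h k (plane_wave \<xi> \<alpha>) - gw_hat h \<xi> *\<^sub>R plane_wave \<xi> \<alpha>) \<le> k * gw_mass h 2"
proof (rule norm_bound)
  fix n
  let ?x = "plane_wave \<xi> \<alpha>"
  have s: "(\<lambda>p. gw h p * ?x (n + p)) summable_on UNIV"
    by (rule summable_on_gw_bounded[OF h]) (simp add: plane_wave_apply)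
  have ratio: "\<bar>expw k (n + p) / expw k n - 1\<bar> \<le> k * exp (2 * \<bar>of_int p\<bar>)" for p
  proof -
    define u where "u = k * \<bar>of_int p\<bar>"
    have u: "0 \<le> u" "u \<le> \<bar>of_int p\<bar>" using k by (auto simp: u_def mult_left_le_one_le)
    have "1 - u \<le> exp (- u)" using exp_ge_add_one_self[of "- u"] by simp
    then have "(1 - u) * exp u \<le> exp (- u) * exp u" by (intro mult_right_mono) auto
    then have 1: "exp u - 1 \<le> u * exp u" by (simp add: exp_minus algebra_simps)
    \<comment> \<open>One factor \<open>exp |p|\<close> comes from \<open>|p| \<le> exp |p|\<close>,
      the other from \<open>u \<le> |p|\<close>, where \<open>k \<le> 1\<close> enters.\<close>
    have "u * exp u \<le> (k * exp \<bar>of_int p\<bar>) * exp \<bar>of_int p\<bar>"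
      using u k exp_ge_add_one_self[of "\<bar>of_int p\<bar>", THEN order_trans[rotated], of "\<bar>of_int p\<bar>"]
      unfolding u_def by (intro mult_mono mult_left_mono) auto
    also have "\<dots> = k * exp (2 * \<bar>of_int p\<bar>)"
      by (simp add: exp_add[symmetric] mult.assoc)
    finally have 2: "exp u - 1 \<le> k * exp (2 * \<bar>of_int p\<bar>)" using 1 by simp
    have "expw k (n + p) / expw k n \<le> exp u" "exp (- u) \<le> expw k (n + p) / expw k n"
      using expw_quotient(1)[of k n p] expw_quotient(2)[of k p n] k by (auto simp: u_def)
    moreover have "1 - u \<le> exp (- u)" "1 + u \<le> exp u"
      using exp_ge_add_one_self[of "- u"] exp_ge_add_one_self[of u] by auto
    ultimately have "\<bar>expw k (n + p) / expw k n - 1\<bar> \<le> exp u - 1" unfolding abs_le_iff by linarith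
    with 2 show ?thesis by linarith
  qed
  have "apply_bcontfun (conv_gw h k ?x - gw_hat h \<xi> *\<^sub>R ?x) n
      = (\<Sum>\<^sub>\<infinity>p. gw h p * (expw k (n + p) / expw k n) * ?x (n + p)) - (\<Sum>\<^sub>\<infinity>p. gw h p * ?x (n + p))"
    by (simp only: minus_bcontfun.rep_eq scaleR_bcontfun.rep_eq conv_gw_apply[OF h k(1)]
        real_scaleR_def sum_gw_plane_wave[OF h])
  also have "\<dots> = (\<Sum>\<^sub>\<infinity>p. gw h p * (expw k (n + p) / expw k n) * ?x (n + p) + - (gw h p * ?x (n + p)))"
    by (subst infsum_add[OF conv_gw_summable[OF h k(1)] summable_on_uminus[THEN iffD2, OF s]])
       (simp only: infsum_uminus diff_conv_add_uminus)
  finally have eq: "apply_bcontfun (conv_gw h k ?x - gw_hat h \<xi> *\<^sub>R ?x) n = \<dots>" .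
  have "norm (\<Sum>\<^sub>\<infinity>p. gw h p * (expw k (n + p) / expw k n) * ?x (n + p) + - (gw h p * ?x (n + p)))
      \<le> (\<Sum>\<^sub>\<infinity>p. k * (gw h p * exp (2 * \<bar>of_int p\<bar>)))"
  proof (rule norm_infsum_le[OF has_sum_infsum has_sum_infsum])
    show "(\<lambda>p. gw h p * (expw k (n + p) / expw k n) * ?x (n + p) + - (gw h p * ?x (n + p))) summable_on UNIV"
      by (rule summable_on_add[OF conv_gw_summable[OF h k(1)] summable_on_uminus[THEN iffD2, OF s]])
    show "(\<lambda>p::int. k * (gw h p * exp (2 * \<bar>of_int p\<bar>))) summable_on UNIV"
      by (intro summable_on_cmult_right summable_on_gw_exp h)
    fix p :: int
    have "norm (gw h p * (expw k (n + p) / expw k n) * ?x (n + p) + - (gw h p * ?x (n + p)))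
       = norm (gw h p * ((expw k (n + p) / expw k n - 1) * ?x (n + p)))"
      by (simp add: algebra_simps)
    also have "\<dots> = gw h p * (\<bar>expw k (n + p) / expw k n - 1\<bar> * \<bar>?x (n + p)\<bar>)"
      by (simp add: abs_mult)
    also have "\<dots> \<le> gw h p * (k * exp (2 * \<bar>of_int p\<bar>) * 1)"
      using ratio[of p] k by (intro mult_left_mono mult_mono) (auto simp: plane_wave_apply)
    finally show "norm (gw h p * (expw k (n + p) / expw k n) * ?x (n + p) + - (gw h p * ?x (n + p)))
       \<le> k * (gw h p * exp (2 * \<bar>of_int p\<bar>))" by (simp add: mult_ac)
  qed
  also have "\<dots> = k * gw_mass h 2" by (simp add: gw_mass_def infsum_cmult_right')
  finally show "norm (apply_bcontfun (conv_gw h k ?x - gw_hat h \<xi> *\<^sub>R ?x) n) \<le> k * gw_mass h 2"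
    unfolding eq .
qed

section \<open>Two commuting quadratic polynomials in the correlation\<close>

definition lin_L :: "real \<Rightarrow> real \<Rightarrow> (int \<Rightarrow>\<^sub>C real) \<Rightarrow> (int \<Rightarrow>\<^sub>C real)" where
  "lin_L h k x = conv_gw h k (conv_gw h k x) + (2 * gw_mass h 0) *\<^sub>R conv_gw h k x - (gw_mass h 0)\<^sup>2 *\<^sub>R x"

definition lin_N :: "real \<Rightarrow> real \<Rightarrow> (int \<Rightarrow>\<^sub>C real) \<Rightarrow> (int \<Rightarrow>\<^sub>C real)" where
  "lin_N h k x = conv_gw h k (conv_gw h k x) - (2 * gw_mass h 0) *\<^sub>R conv_gw h k x + (gw_mass h 0)\<^sup>2 *\<^sub>R x"

context
  fixes h k :: real
  assumes h: "0 < h" and k: "0 < k"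
begin

interpretation G: bounded_linear "conv_gw h k"
  using bounded_linear_conv_gw[OF h, of k] k by simp

interpretation B: bounded_bilinear "weighted_inner k"
  by (rule bounded_bilinear_weighted_inner[OF k])

lemma bounded_linear_lin_L: "bounded_linear (lin_L h k)"
  and bounded_linear_lin_N: "bounded_linear (lin_N h k)"
  unfolding lin_L_def[abs_def] lin_N_def[abs_def]
  by (intro bounded_linear_add bounded_linear_sub bounded_linear_const_scaleR
      bounded_linear_compose[OF G.bounded_linear_axioms] G.bounded_linear_axioms bounded_linear_ident)+

lemma lin_L_selfadjoint: "weighted_inner k (lin_L h k x) y = weighted_inner k x (lin_L h k y)"
  and lin_N_selfadjoint: "weighted_inner k (lin_N h k x) y = weighted_inner k x (lin_N h k y)"
  by (simp_all add: lin_L_def lin_N_def B.add_left B.add_right B.diff_left B.diff_right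
      B.scaleR_left B.scaleR_right conv_gw_selfadjoint[OF h k])

lemma lin_L_lin_N_commute: "lin_L h k (lin_N h k x) = lin_N h k (lin_L h k x)"
  by (simp add: lin_L_def lin_N_def G.add G.diff G.scaleR scaleR_add_right scaleR_diff_right algebra_simps)

end

text \<open>Strictly below the maximum, the symbol of \<open>N\<close> is positive; the symbol of
  \<open>L\<close> is positive above \<open>(sqrt 2 - 1) * \<theta>\<close>, for which
  \<open>3/4 * \<theta>\<close> is ample. Such a frequency exists because the symbol tends to its
  maximum as \<open>\<xi>\<close> tends to 0.\<close>

lemma gw_hat_near_mass:
  assumes h: "0 < h"
  shows "\<exists>\<xi>. gw_hat h \<xi> < gw_mass h 0 \<and> 3/4 * gw_mass h 0 \<le> gw_hat h \<xi>"
proof -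
  define \<theta> where "\<theta> = gw_mass h 0"
  define M where "M = gw_mass h 1"
  have pos: "0 < \<theta>" "0 < M" using gw_mass_pos[OF h] by (auto simp: \<theta>_def M_def)
  \<comment> \<open>The cap 1 keeps \<open>\<xi>\<close> below \<open>pi\<close>, where cosine
    decreases strictly; the second bound limits the loss to \<open>\<theta> / 4\<close> by way of
    \<open>1 - cos (p * \<xi>) \<le> \<xi> * |p|\<close>.\<close>
  define \<xi> where "\<xi> = min 1 (\<theta> / (4 * M))"
  have xi: "0 < \<xi>" "\<xi> \<le> 1" "\<xi> * M \<le> \<theta> / 4"
    using pos by (auto simp: \<xi>_def min_def field_simps)
  let ?f = "\<lambda>p::int. gw h p * (1 - cos (of_int p * \<xi>))"
  have s1: "(\<lambda>p. gw h p * cos (of_int p * \<xi>)) summable_on UNIV"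
    by (rule summable_on_gw_bounded[OF h]) simp
  have eqf: "?f = (\<lambda>p. gw h p + - (gw h p * cos (of_int p * \<xi>)))"
    by (simp add: algebra_simps)
  have sf: "?f summable_on UNIV" unfolding eqf
    by (rule summable_on_add[OF summable_on_gw[OF h] summable_on_uminus[THEN iffD2, OF s1]])
  have diff: "(\<Sum>\<^sub>\<infinity>p. ?f p) = \<theta> - gw_hat h \<xi>"
    unfolding eqf infsum_add[OF summable_on_gw[OF h] summable_on_uminus[THEN iffD2, OF s1]] infsum_uminus
    by (simp add: \<theta>_def gw_mass_0 gw_hat_def)
  have "cos \<xi> < cos 0" by (rule cos_monotone_0_pi) (use xi pi_gt3 in auto)
  then have "0 < (\<Sum>p\<in>{1::int}. ?f p)" by simp
  also have "\<dots> \<le> (\<Sum>\<^sub>\<infinity>p. ?f p)"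
    by (intro finite_sum_le_infsum sf) auto
  finally have 1: "gw_hat h \<xi> < \<theta>" using diff by simp
  have "(\<Sum>\<^sub>\<infinity>p. ?f p) \<le> (\<Sum>\<^sub>\<infinity>p::int. \<xi> * (gw h p * exp (1 * \<bar>of_int p\<bar>)))"
  proof (rule infsum_mono[OF sf summable_on_cmult_right[OF summable_on_gw_exp[OF h]]])
    fix p :: int
    have "1 - cos (of_int p * \<xi>) = 2 * (sin (of_int p * \<xi> / 2))\<^sup>2"
      using cos_double_sin[of "of_int p * \<xi> / 2"] by simp
    also have "\<dots> \<le> 2 * \<bar>sin (of_int p * \<xi> / 2)\<bar>"
    proof -
      have "\<bar>sin (of_int p * \<xi> / 2)\<bar> * \<bar>sin (of_int p * \<xi> / 2)\<bar> \<le> 1 * \<bar>sin (of_int p * \<xi> / 2)\<bar>"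
        by (intro mult_right_mono) auto
      then show ?thesis by (simp add: power2_eq_square)
    qed
    also have "\<dots> \<le> 2 * \<bar>of_int p * \<xi> / 2\<bar>" by (intro mult_left_mono abs_sin_x_le_abs_x) simp
    also have "\<dots> = \<xi> * \<bar>of_int p\<bar>" using xi by (simp add: abs_mult)
    also have "\<dots> \<le> \<xi> * exp (1 * \<bar>of_int p\<bar>)"
      using exp_ge_add_one_self[of "\<bar>of_int p\<bar>", THEN order_trans[rotated], of "\<bar>of_int p\<bar>"] xi by (intro mult_left_mono) auto
    finally show "?f p \<le> \<xi> * (gw h p * exp (1 * \<bar>of_int p\<bar>))"
      by (subst mult.left_commute) (intro mult_left_mono, auto)
  qed
  also have "\<dots> = \<xi> * M" by (simp add: M_def gw_mass_def infsum_cmult_right')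
  finally have "3/4 * \<theta> \<le> gw_hat h \<xi>" using diff xi(3) by simp
  with 1 show ?thesis by (auto simp: \<theta>_def)
qed

text \<open>For small \<open>k\<close> the weighted plane waves are approximate eigenvectors, and the symbol of \<open>L N\<close>
  is positive where the symbol of the Gaussian correlation lies slightly below its maximum.\<close>

lemma exists_unstable_direction:
  assumes h: "0 < h"
  shows "\<exists>k b. 0 < k \<and> 0 < weighted_inner k b (lin_L h k (lin_N h k b))"
proof -
  define \<theta> where "\<theta> = gw_mass h 0"
  obtain \<xi> where xi: "gw_hat h \<xi> < \<theta>" "3/4 * \<theta> \<le> gw_hat h \<xi>"
    using gw_hat_near_mass[OF h] by (auto simp: \<theta>_def)
  define g where "g = gw_hat h \<xi>"
  have th: "0 < \<theta>" using gw_mass_pos[OF h] by (simp add: \<theta>_def)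
  have g: "0 < g" "g < \<theta>" "3/4 * \<theta> \<le> g" using xi th by (auto simp: g_def)
  define l where "l = g * g + 2 * \<theta> * g - \<theta>\<^sup>2"
  define n where "n = g * g - 2 * \<theta> * g + \<theta>\<^sup>2"
  have "n = (\<theta> - g)\<^sup>2" by (simp add: n_def power2_eq_square algebra_simps)
  then have n0: "0 < n" using g by simp
  have l0: "0 < l"
  proof -
    have "\<theta> * (3/4 * \<theta>) \<le> \<theta> * g" using g th by (intro mult_left_mono) auto
    then have "\<theta> * \<theta> < 2 * (\<theta> * g)" using mult_pos_pos[OF th th] by linarith
    moreover have "0 < g * g" using g by simp
    ultimately show ?thesis by (simp add: l_def power2_eq_square)
  qed
  define R where "R = gw_mass h 1"
  define D where "D = gw_mass h 2"
  have R0: "0 < R" and D0: "0 < D" using gw_mass_pos[OF h] by (auto simp: R_def D_def)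
  \<comment> \<open>If \<open>r\<close> is the error of the eigenvalue equation for
    \<open>G\<close>, those for \<open>N\<close> and \<open>L\<close> are at most
    \<open>(R + g + 2 * \<theta>) * norm r\<close>. The first summand passes the error for
    \<open>N\<close> through \<open>L\<close>, the second scales the error for \<open>L\<close> by
    \<open>n\<close>.\<close>
  define C where "C = (R * R + 2 * \<theta> * R + \<theta>\<^sup>2) * (R + g + 2 * \<theta>) + n * (R + g + 2 * \<theta>)"
  have C0: "0 < C" unfolding C_def using R0 th g n0
    by (intro add_pos_pos mult_pos_pos) (auto simp: add_pos_pos)
  \<comment> \<open>Makes the total error at most a quarter of \<open>l * n\<close>, hence less than
    half. The half is what is available, as the error is charged once for each of the two
    phases.\<close>
  define k where "k = min 1 (l * n / (4 * C * D))"
  have k0: "0 < k" and k1: "k \<le> 1" using l0 n0 C0 D0 by (auto simp: k_def)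
  have kC: "C * (k * D) < l * n / 2"
  proof -
    have "k \<le> l * n / (4 * C * D)" by (simp add: k_def)
    then have "k * (C * D) \<le> l * n / (4 * C * D) * (C * D)" using C0 D0 by (intro mult_right_mono) auto
    also have "\<dots> = l * n / 4" using C0 D0 by simp
    also have "\<dots> < l * n / 2" using mult_pos_pos[OF l0 n0] by simp
    finally show ?thesis by (simp add: mult_ac)
  qed
  interpret G: bounded_linear "conv_gw h k"
    using bounded_linear_conv_gw[OF h, of k] k0 by simp
  interpret B: bounded_bilinear "weighted_inner k"
    by (rule bounded_bilinear_weighted_inner[OF k0])
  interpret L: bounded_linear "lin_L h k" by (rule bounded_linear_lin_L[OF h k0])
  have GR: "norm (conv_gw h k x) \<le> R * norm x" for x
  proof -
    have "norm (conv_gw h k x) \<le> norm x * gw_mass h k" using norm_conv_gw[OF h] k0 by simp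
    also have "\<dots> \<le> norm x * R" unfolding R_def by (intro mult_left_mono gw_mass_mono h k1) simp
    finally show ?thesis by (simp add: mult.commute)
  qed
  have LR: "norm (lin_L h k x) \<le> (R * R + 2 * \<theta> * R + \<theta>\<^sup>2) * norm x" for x
  proof -
    have "norm (conv_gw h k (conv_gw h k x)) \<le> R * (R * norm x)"
      by (rule order_trans[OF GR mult_left_mono[OF GR less_imp_le[OF R0]]])
    moreover have "norm ((2 * \<theta>) *\<^sub>R conv_gw h k x) \<le> 2 * \<theta> * (R * norm x)"
      using GR[of x] th by simp
    moreover have "norm (\<theta>\<^sup>2 *\<^sub>R x) \<le> \<theta>\<^sup>2 * norm x" by simp
    ultimately have "norm (lin_L h k x) \<le> R * (R * norm x) + 2 * \<theta> * (R * norm x) + \<theta>\<^sup>2 * norm x"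
      unfolding lin_L_def \<theta>_def[symmetric]
      by (intro order_trans[OF norm_triangle_ineq4] add_mono order_trans[OF norm_triangle_ineq])
    then show ?thesis by (simp add: algebra_simps)
  qed
  define W where "W = (\<Sum>\<^sub>\<infinity>n. (expw k n)\<^sup>2)"
  have W0: "0 < W"
  proof -
    have "(\<Sum>m\<in>{0}. (expw k m)\<^sup>2) \<le> W" unfolding W_def
      by (intro finite_sum_le_infsum summable_on_expw_sq k0) auto
    then show ?thesis by (simp add: expw_def)
  qed
  have main: "l * n * weighted_inner k (plane_wave \<xi> \<alpha>) (plane_wave \<xi> \<alpha>) - C * (k * D) * W
      \<le> weighted_inner k (plane_wave \<xi> \<alpha>) (lin_L h k (lin_N h k (plane_wave \<xi> \<alpha>)))" for \<alpha>
  proof -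
    define x where "x = plane_wave \<xi> \<alpha>"
    define r where "r = conv_gw h k x - g *\<^sub>R x"
    have r: "norm r \<le> k * D" unfolding r_def g_def D_def x_def
      using conv_gw_plane_wave[OF h] k0 k1 by simp
    have Gx: "conv_gw h k x = g *\<^sub>R x + r" by (simp add: r_def)
    have GGx: "conv_gw h k (conv_gw h k x) = (g * g) *\<^sub>R x + g *\<^sub>R r + conv_gw h k r"
      by (simp add: Gx G.add G.scaleR scaleR_add_right)
    have Nx: "lin_N h k x - n *\<^sub>R x = conv_gw h k r + g *\<^sub>R r - (2 * \<theta>) *\<^sub>R r"
      unfolding lin_N_def GGx \<theta>_def[symmetric] by (simp add: Gx n_def algebra_simps)
    have Lx: "lin_L h k x - l *\<^sub>R x = conv_gw h k r + g *\<^sub>R r + (2 * \<theta>) *\<^sub>R r"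
      unfolding lin_L_def GGx \<theta>_def[symmetric] by (simp add: Gx l_def algebra_simps)
    have Gr: "norm (conv_gw h k r) \<le> R * (k * D)"
      by (rule order_trans[OF GR mult_left_mono[OF r less_imp_le[OF R0]]])
    have gr: "norm (g *\<^sub>R r) \<le> g * (k * D)" "norm ((2 * \<theta>) *\<^sub>R r) \<le> 2 * \<theta> * (k * D)"
      using r g th by auto
    have N_le: "norm (lin_N h k x - n *\<^sub>R x) \<le> (R + g + 2 * \<theta>) * (k * D)"
      unfolding Nx distrib_right
      by (intro order_trans[OF norm_triangle_ineq4] add_mono order_trans[OF norm_triangle_ineq] Gr gr)
    have L_le: "norm (lin_L h k x - l *\<^sub>R x) \<le> (R + g + 2 * \<theta>) * (k * D)"
      unfolding Lx distrib_right
      by (intro order_trans[OF norm_triangle_ineq] add_mono Gr gr)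
    have "lin_L h k (lin_N h k x) - (l * n) *\<^sub>R x
        = lin_L h k (lin_N h k x - n *\<^sub>R x) + n *\<^sub>R (lin_L h k x - l *\<^sub>R x)"
      by (simp add: L.diff L.scaleR scaleR_diff_right mult.commute)
    then have "norm (lin_L h k (lin_N h k x) - (l * n) *\<^sub>R x)
        \<le> (R * R + 2 * \<theta> * R + \<theta>\<^sup>2) * ((R + g + 2 * \<theta>) * (k * D)) + n * ((R + g + 2 * \<theta>) * (k * D))"
    proof (simp only:, intro order_trans[OF norm_triangle_ineq] add_mono)
      show "norm (lin_L h k (lin_N h k x - n *\<^sub>R x)) \<le> (R * R + 2 * \<theta> * R + \<theta>\<^sup>2) * ((R + g + 2 * \<theta>) * (k * D))"
        using R0 th by (intro order_trans[OF LR] mult_left_mono N_le) auto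
      show "norm (n *\<^sub>R (lin_L h k x - l *\<^sub>R x)) \<le> n * ((R + g + 2 * \<theta>) * (k * D))"
        using n0 L_le by simp
    qed
    also have "\<dots> = C * (k * D)" by (simp add: C_def algebra_simps)
    finally have err: "norm (lin_L h k (lin_N h k x) - (l * n) *\<^sub>R x) \<le> C * (k * D)" .
    define e where "e = lin_L h k (lin_N h k x) - (l * n) *\<^sub>R x"
    have eq: "lin_L h k (lin_N h k x) = (l * n) *\<^sub>R x + e" by (simp add: e_def)
    have "\<bar>weighted_inner k x e\<bar> \<le> norm x * norm e * W"
      unfolding W_def by (rule weighted_inner_le[OF k0])
    also have "\<dots> \<le> 1 * (C * (k * D)) * W"
      using err norm_plane_wave[of \<xi> \<alpha>] W0
      by (intro mult_right_mono mult_mono) (auto simp: e_def x_def)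
    finally have "- (C * (k * D) * W) \<le> weighted_inner k x e" by simp
    then have "l * n * weighted_inner k x x - C * (k * D) * W \<le> weighted_inner k x (lin_L h k (lin_N h k x))"
      unfolding eq by (simp add: B.add_right B.scaleR_right)
    then show ?thesis by (simp only: x_def)
  qed
  \<comment> \<open>Neither phase has a known norm, but together they have the full mass
    \<open>W\<close>. So the two quadratic forms have a positive sum and at least one of them is
    positive.\<close>
  have trig: "weighted_inner k (plane_wave \<xi> 0) (plane_wave \<xi> 0)
      + weighted_inner k (plane_wave \<xi> (pi/2)) (plane_wave \<xi> (pi/2)) = W"
  proof -
    have "weighted_inner k (plane_wave \<xi> 0) (plane_wave \<xi> 0)
      + weighted_inner k (plane_wave \<xi> (pi/2)) (plane_wave \<xi> (pi/2))
      = (\<Sum>\<^sub>\<infinity>n. (expw k n)\<^sup>2 * plane_wave \<xi> 0 n * plane_wave \<xi> 0 n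
            + (expw k n)\<^sup>2 * plane_wave \<xi> (pi/2) n * plane_wave \<xi> (pi/2) n)"
      unfolding weighted_inner_def
      by (rule infsum_add[OF weighted_inner_summable[OF k0] weighted_inner_summable[OF k0], symmetric])
    also have "\<dots> = W" unfolding W_def
    proof (rule infsum_cong)
      fix m :: int
      have "cos (of_int m * \<xi>) * cos (of_int m * \<xi>) + sin (of_int m * \<xi>) * sin (of_int m * \<xi>) = 1"
        using sin_cos_squared_add3 by blast
      then have "(expw k m)\<^sup>2 * (cos (of_int m * \<xi>) * cos (of_int m * \<xi>) + sin (of_int m * \<xi>) * sin (of_int m * \<xi>)) = (expw k m)\<^sup>2"
        by simp
      then show "(expw k m)\<^sup>2 * plane_wave \<xi> 0 m * plane_wave \<xi> 0 m
            + (expw k m)\<^sup>2 * plane_wave \<xi> (pi/2) m * plane_wave \<xi> (pi/2) m = (expw k m)\<^sup>2"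
        by (simp only: plane_wave_apply cos_diff cos_pi_half sin_pi_half diff_zero distrib_left mult.assoc
            mult_zero_right mult_1_right add_0_left)
    qed
    finally show ?thesis .
  qed
  have "0 < (l * n - 2 * (C * (k * D))) * W" using kC W0 by (intro mult_pos_pos) auto
  also have "\<dots> = l * n * W - 2 * (C * (k * D) * W)" by (simp add: algebra_simps)
  also have "\<dots> = (l * n * weighted_inner k (plane_wave \<xi> 0) (plane_wave \<xi> 0) - C * (k * D) * W) +
      (l * n * weighted_inner k (plane_wave \<xi> (pi/2)) (plane_wave \<xi> (pi/2)) - C * (k * D) * W)"
    unfolding trig[symmetric] by (simp add: algebra_simps)
  also have "\<dots> \<le> weighted_inner k (plane_wave \<xi> 0) (lin_L h k (lin_N h k (plane_wave \<xi> 0)))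
      + weighted_inner k (plane_wave \<xi> (pi/2)) (lin_L h k (lin_N h k (plane_wave \<xi> (pi/2))))"
    by (intro add_mono main)
  finally have "0 < weighted_inner k (plane_wave \<xi> 0) (lin_L h k (lin_N h k (plane_wave \<xi> 0)))
      \<or> 0 < weighted_inner k (plane_wave \<xi> (pi/2)) (lin_L h k (lin_N h k (plane_wave \<xi> (pi/2))))"
    by linarith
  with k0 show ?thesis by blast
qed


section \<open>Gaussian integrals in the plane\<close>

lemma measurable_Complex_pair [measurable]:
  "(\<lambda>p. Complex (fst p) (snd p)) \<in> borel_measurable (lborel \<Otimes>\<^sub>M lborel)"
proof -
  have "(\<lambda>p. complex_of_real (fst p) + \<i> * complex_of_real (snd p)) \<in> borel_measurable (lborel \<Otimes>\<^sub>M lborel)"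
    by measurable
  then show ?thesis by (simp add: Complex_eq)
qed

text \<open>Gives Fubini in the coordinates \<open>Re\<close> and \<open>Im\<close>, in which the
  integrals of modes factor; agreement on open boxes identifies the measure.\<close>

lemma lborel_complex:
  "(lborel :: complex measure) = distr (lborel \<Otimes>\<^sub>M lborel) borel (\<lambda>p. Complex (fst p) (snd p))"
proof (rule lborel_eqI)
  fix l u :: complex
  assume le: "\<And>b. b \<in> Basis \<Longrightarrow> l \<bullet> b \<le> u \<bullet> b"
  have le': "Re l \<le> Re u" "Im l \<le> Im u"
    using le[of 1] le[of \<i>] by (auto simp: Basis_complex_def)
  have vim: "(\<lambda>p. Complex (fst p) (snd p)) -` box l u \<inter> space (lborel \<Otimes>\<^sub>M lborel)
      = {Re l<..<Re u} \<times> {Im l<..<Im u}"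
    by (auto simp: box_def Basis_complex_def space_pair_measure)
  have "emeasure (distr (lborel \<Otimes>\<^sub>M lborel) borel (\<lambda>p. Complex (fst p) (snd p))) (box l u)
      = emeasure (lborel \<Otimes>\<^sub>M lborel) ({Re l<..<Re u} \<times> {Im l<..<Im u})"
    by (subst emeasure_distr) (auto simp: vim)
  also have "\<dots> = emeasure lborel {Re l<..<Re u} * emeasure lborel {Im l<..<Im u}"
    by (rule lborel.emeasure_pair_measure_Times) auto
  also have "\<dots> = ennreal ((Re u - Re l) * (Im u - Im l))"
    using le' by (simp add: ennreal_mult)
  also have "\<dots> = (\<Prod>b\<in>Basis. (u - l) \<bullet> b)"
    by (simp add: Basis_complex_def)
  finally show "emeasure (distr (lborel \<Otimes>\<^sub>M lborel) borel (\<lambda>p. Complex (fst p) (snd p))) (box l u)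
      = (\<Prod>b\<in>Basis. (u - l) \<bullet> b)" .
qed simp

lemma nn_integral_complex:
  assumes [measurable]: "f \<in> borel_measurable (borel :: complex measure)"
  shows "(\<integral>\<^sup>+z. f z \<partial>lborel) = (\<integral>\<^sup>+y. (\<integral>\<^sup>+x. f (Complex x y) \<partial>lborel) \<partial>lborel)"
proof -
  have "(\<integral>\<^sup>+z. f z \<partial>lborel) = (\<integral>\<^sup>+p. f (Complex (fst p) (snd p)) \<partial>(lborel \<Otimes>\<^sub>M lborel))"
    by (subst lborel_complex) (rule nn_integral_distr; measurable)
  also have "\<dots> = (\<integral>\<^sup>+y. (\<integral>\<^sup>+x. f (Complex x y) \<partial>lborel) \<partial>lborel)"
    by (subst lborel_pair.nn_integral_snd[symmetric]) auto
  finally show ?thesis .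
qed

lemma integral_complex:
  fixes f :: "complex \<Rightarrow> 'b::{banach, second_countable_topology}"
  assumes f: "integrable lborel f"
  shows "(\<integral>z. f z \<partial>lborel) = (\<integral>y. (\<integral>x. f (Complex x y) \<partial>lborel) \<partial>lborel)"
proof -
  have [measurable]: "f \<in> borel_measurable borel" using f by auto
  have int: "integrable (lborel \<Otimes>\<^sub>M lborel) (\<lambda>p. f (Complex (fst p) (snd p)))"
    using f by (subst (asm) lborel_complex, subst (asm) integrable_distr_eq) auto
  have "(\<integral>z. f z \<partial>lborel) = (\<integral>p. f (Complex (fst p) (snd p)) \<partial>(lborel \<Otimes>\<^sub>M lborel))"
    by (subst lborel_complex) (rule integral_distr; measurable)
  also have "\<dots> = (\<integral>y. (\<integral>x. f (Complex x y) \<partial>lborel) \<partial>lborel)"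
    using lborel_pair.integral_snd[of "\<lambda>x y. f (Complex x y)"] int
    by (simp add: case_prod_unfold)
  finally show ?thesis .
qed

lemma has_bochner_integral_gaussian:
  assumes "0 < a"
  shows "has_bochner_integral lborel (\<lambda>x::real. exp (- (a * (x - m)\<^sup>2))) (sqrt (pi / a))"
proof -
  define \<sigma> where "\<sigma> = 1 / sqrt (2 * a)"
  have s: "0 < \<sigma>" "\<sigma>\<^sup>2 = 1 / (2 * a)" using assms by (auto simp: \<sigma>_def power_divide)
  have "has_bochner_integral lborel (\<lambda>x. sqrt (2 * pi * \<sigma>\<^sup>2) * normal_density m \<sigma> x) (sqrt (2 * pi * \<sigma>\<^sup>2) * 1)"
    using s by (intro has_bochner_integral_mult_right)
      (auto simp: has_bochner_integral_iff intro: integrable_normal_density integral_normal_density)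
  moreover have "sqrt (2 * pi * \<sigma>\<^sup>2) * normal_density m \<sigma> x = exp (- (a * (x - m)\<^sup>2))" for x
    using assms unfolding normal_density_def s(2) by simp
  ultimately show ?thesis using assms by (simp add: s(2))
qed

lemmas integrable_gaussian = has_bochner_integral_gaussian[THEN integrable.intros]
  and integral_gaussian = has_bochner_integral_gaussian[THEN has_bochner_integral_integral_eq]

lemma nn_integral_gaussian:
  assumes "0 < a"
  shows "(\<integral>\<^sup>+x. ennreal (exp (- (a * (x - m)\<^sup>2))) \<partial>lborel) = ennreal (sqrt (pi / a))"
  by (subst nn_integral_eq_integral) (use assms in \<open>auto simp: integrable_gaussian integral_gaussian\<close>)

text \<open>Translating by \<open>Re \<zeta>\<close> leaves a purely imaginary linear term, and the
  integral becomes the characteristic function of the standard normal law.\<close>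

lemma integral_gaussian_complex_linear:
  fixes \<zeta> :: complex
  shows "(\<integral>x. exp (- (of_real x)\<^sup>2 / 2 + of_real x * \<zeta>) \<partial>lborel) = sqrt (2 * pi) * exp (\<zeta>\<^sup>2 / 2)"
proof -
  define s t where "s = Re \<zeta>" and "t = Im \<zeta>"
  have z: "\<zeta> = of_real s + \<i> * of_real t" by (simp add: s_def t_def complex_eq)
  have "(\<integral>x. exp (- (of_real x)\<^sup>2 / 2 + of_real x * \<zeta>) \<partial>lborel)
      = (\<integral>x. exp (- (of_real (s + 1 * x))\<^sup>2 / 2 + of_real (s + 1 * x) * \<zeta>) \<partial>lborel)"
    by (subst lborel_integral_real_affine[of 1 _ s]) auto
  also have "\<dots> = (\<integral>x. (sqrt (2 * pi) * exp (of_real s * \<zeta> - (of_real s)\<^sup>2 / 2)) *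
      (std_normal_density x *\<^sub>R iexp (t * x)) \<partial>lborel)"
  proof (rule Bochner_Integration.integral_cong)
    fix x :: real
    have "of_real (sqrt (2 * pi)) * complex_of_real (std_normal_density x) = exp (- (of_real x)\<^sup>2 / 2)"
      by (simp add: std_normal_density_def exp_of_real[symmetric])
    then have "(sqrt (2 * pi) * exp (of_real s * \<zeta> - (of_real s)\<^sup>2 / 2)) * (std_normal_density x *\<^sub>R iexp (t * x))
       = exp (of_real s * \<zeta> - (of_real s)\<^sup>2 / 2) * exp (- (of_real x)\<^sup>2 / 2) * iexp (t * x)"
      by (simp add: scaleR_conv_of_real mult_ac)
    also have "\<dots> = exp ((of_real s * \<zeta> - (of_real s)\<^sup>2 / 2) + (- (of_real x)\<^sup>2 / 2) + \<i> * of_real (t * x))"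
      by (simp only: exp_add)
    also have "(of_real s * \<zeta> - (of_real s)\<^sup>2 / 2) + (- (of_real x)\<^sup>2 / 2) + \<i> * of_real (t * x)
        = - (of_real (s + 1 * x))\<^sup>2 / 2 + of_real (s + 1 * x) * \<zeta>"
      by (simp add: z field_simps power2_eq_square)
    finally show "exp (- (of_real (s + 1 * x))\<^sup>2 / 2 + of_real (s + 1 * x) * \<zeta>) =
      (sqrt (2 * pi) * exp (of_real s * \<zeta> - (of_real s)\<^sup>2 / 2)) * (std_normal_density x *\<^sub>R iexp (t * x))" by simp
  qed simp
  also have "\<dots> = (sqrt (2 * pi) * exp (of_real s * \<zeta> - (of_real s)\<^sup>2 / 2)) * char std_normal_distribution t"
    unfolding char_def integral_mult_right_zero
    by (subst integral_density) (auto simp: normal_density_nonneg)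
  also have "\<dots> = sqrt (2 * pi) * (exp (of_real s * \<zeta> - (of_real s)\<^sup>2 / 2) * exp (- (of_real t)\<^sup>2 / 2))"
    by (simp add: char_std_normal_distribution exp_of_real[symmetric])
  also have "exp (of_real s * \<zeta> - (of_real s)\<^sup>2 / 2) * exp (- (of_real t)\<^sup>2 / 2) = exp (\<zeta>\<^sup>2 / 2)"
    unfolding exp_add[symmetric]
    by (rule arg_cong[where f=exp]) (simp add: z field_simps power2_eq_square)
  finally show ?thesis by simp
qed

lemma nn_integral_gaussian_complex:
  assumes "0 < a"
  shows "(\<integral>\<^sup>+w. ennreal (exp (- (a * (cmod (w - z))\<^sup>2))) \<partial>lborel) = ennreal (pi / a)"
proof -
  have "(\<integral>\<^sup>+w. ennreal (exp (- (a * (cmod (w - z))\<^sup>2))) \<partial>lborel)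
      = (\<integral>\<^sup>+y. (\<integral>\<^sup>+x. ennreal (exp (- (a * (y - Im z)\<^sup>2))) * ennreal (exp (- (a * (x - Re z)\<^sup>2))) \<partial>lborel) \<partial>lborel)"
    by (subst nn_integral_complex)
       (auto simp: cmod_power2 ennreal_mult'[symmetric] exp_add[symmetric] algebra_simps)
  also have "\<dots> = ennreal (sqrt (pi / a)) * ennreal (sqrt (pi / a))"
    by (simp add: nn_integral_cmult nn_integral_multc nn_integral_gaussian assms)
  also have "\<dots> = ennreal (pi / a)" using assms by (simp add: ennreal_mult[symmetric])
  finally show ?thesis .
qed

lemma integrable_gaussian_complex:
  assumes "0 < a"
  shows "integrable lborel (\<lambda>w::complex. exp (- (a * (cmod (w - z))\<^sup>2)))"
  by (rule integrableI_nonneg) (use assms in \<open>auto simp: nn_integral_gaussian_complex\<close>)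

text \<open>Termwise integration for unconditional sums over a countable index type. The index is
  encoded into the naturals, where the theorem on series applies; a bound on all finite partial sums
  makes the order of summation immaterial.\<close>

lemma has_sum_integral_dominated:
  fixes f :: "'i::countable \<Rightarrow> 'a \<Rightarrow> 'b::{banach, second_countable_topology}"
  assumes f: "\<And>i. f i \<in> borel_measurable M" and D: "integrable M D"
    and bound: "\<And>F x. finite F \<Longrightarrow> (\<Sum>i\<in>F. norm (f i x)) \<le> D x"
  shows "integrable M (\<lambda>x. \<Sum>\<^sub>\<infinity>i. f i x)"
    and "((\<lambda>i. \<integral>x. f i x \<partial>M) has_sum (\<integral>x. (\<Sum>\<^sub>\<infinity>i. f i x) \<partial>M)) UNIV"
    and "\<And>x. (\<lambda>i. norm (f i x)) summable_on UNIV"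
    and "\<And>i. integrable M (f i)"
proof -
  define R where "R = range (to_nat :: 'i \<Rightarrow> nat)"
  \<comment> \<open>Off the range of \<open>to_nat\<close> the decoded index would be arbitrary, so
    these terms are set to 0; they then leave every sum unchanged.\<close>
  define g where "g n x = (if n \<in> R then f (from_nat n) x else 0)" for n x
  have g_to_nat: "g (to_nat i) x = f i x" for i x
    by (auto simp: g_def R_def)
  have [measurable]: "g n \<in> borel_measurable M" for n
    unfolding g_def by (cases "n \<in> R") (auto intro: f)
  show summ: "(\<lambda>i. norm (f i x)) summable_on UNIV" for x
  proof (rule nonneg_bdd_above_summable_on)
    show "bdd_above (sum (\<lambda>i. norm (f i x)) ` {F. F \<subseteq> UNIV \<and> finite F})"
      by (rule bdd_aboveI2[of _ _ "D x"]) (simp add: bound)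
  qed simp
  have hs: "((\<lambda>n. g n x) has_sum (\<Sum>\<^sub>\<infinity>i. f i x)) UNIV" for x
  proof -
    have "((\<lambda>i. f i x) has_sum (\<Sum>\<^sub>\<infinity>i. f i x)) UNIV"
      by (rule has_sum_infsum[OF abs_summable_summable[OF summ]])
    then have "((\<lambda>i::'i. g (to_nat i) x) has_sum (\<Sum>\<^sub>\<infinity>i. f i x)) UNIV"
      by (simp only: g_to_nat)
    then have "((\<lambda>n. g n x) has_sum (\<Sum>\<^sub>\<infinity>i. f i x)) R"
      unfolding R_def by (subst has_sum_reindex) (auto simp: o_def)
    moreover have "((\<lambda>n. g n x) has_sum s) R \<longleftrightarrow> ((\<lambda>n. g n x) has_sum s) UNIV" for s
      by (rule has_sum_cong_neutral) (auto simp: g_def)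
    ultimately show ?thesis by simp
  qed
  have sumg: "(\<Sum>n\<in>F. norm (g n x)) \<le> D x" if "finite F" for F x
  proof -
    have "(\<Sum>n\<in>F. norm (g n x)) = (\<Sum>n\<in>F \<inter> R. norm (g n x))"
      using that by (intro sum.mono_neutral_right) (auto simp: g_def)
    also have "\<dots> = (\<Sum>i\<in>to_nat -` F. norm (f i x))"
      by (rule sum.reindex_bij_witness[of _ to_nat from_nat]) (auto simp: g_def R_def)
    also have "\<dots> \<le> D x" using that by (intro bound finite_vimageI) auto
    finally show ?thesis .
  qed
  have gD: "norm (g n x) \<le> D x" for n x using sumg[of "{n}"] by simp
  have ig: "integrable M (g n)" for n
    by (rule Bochner_Integration.integrable_bound[OF D]) (auto intro!: AE_I2 order_trans[OF gD])
  show "integrable M (f i)" for i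
  proof -
    have "g (to_nat i) = f i" by (rule ext) (rule g_to_nat)
    with ig[of "to_nat i"] show ?thesis by simp
  qed
  have AE: "AE x in M. summable (\<lambda>n. norm (g n x))"
  proof (intro AE_I2 summableI_nonneg_bounded)
    show "(\<Sum>i<n. norm (g i x)) \<le> D x" for n x by (rule sumg) simp
  qed simp
  have S: "summable (\<lambda>n. \<integral>x. norm (g n x) \<partial>M)"
  proof (rule summableI_nonneg_bounded)
    show "(\<Sum>i<n. \<integral>x. norm (g i x) \<partial>M) \<le> (\<integral>x. D x \<partial>M)" for n
      by (subst Bochner_Integration.integral_sum[symmetric])
         (auto intro!: integral_mono integrable_norm ig D sumg)
  qed simp
  have eq: "(\<Sum>n. g n x) = (\<Sum>\<^sub>\<infinity>i. f i x)" for x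
    using has_sum_imp_sums[OF hs[of x]] by (simp add: sums_iff)
  show "integrable M (\<lambda>x. \<Sum>\<^sub>\<infinity>i. f i x)"
    using integrable_suminf[OF ig AE S] by (simp add: eq)
  have "(\<lambda>n. \<integral>x. g n x \<partial>M) sums (\<integral>x. (\<Sum>\<^sub>\<infinity>i. f i x) \<partial>M)"
    using sums_integral[OF ig AE S] by (simp add: eq)
  moreover have "summable (\<lambda>n. norm (\<integral>x. g n x \<partial>M))"
    by (rule summable_comparison_test'[OF S]) (auto intro: integral_norm_bound)
  ultimately have "((\<lambda>n. \<integral>x. g n x \<partial>M) has_sum (\<integral>x. (\<Sum>\<^sub>\<infinity>i. f i x) \<partial>M)) UNIV"
    by (intro norm_summable_imp_has_sum)
  moreover have "((\<lambda>n. \<integral>x. g n x \<partial>M) has_sum s) R \<longleftrightarrow> ((\<lambda>n. \<integral>x. g n x \<partial>M) has_sum s) UNIV" for s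
    by (rule has_sum_cong_neutral) (auto simp: g_def)
  ultimately have "((\<lambda>n. \<integral>x. g n x \<partial>M) has_sum (\<integral>x. (\<Sum>\<^sub>\<infinity>i. f i x) \<partial>M)) R" by simp
  then have "((\<lambda>i::'i. \<integral>x. g (to_nat i) x \<partial>M) has_sum (\<integral>x. (\<Sum>\<^sub>\<infinity>i. f i x) \<partial>M)) UNIV"
    unfolding R_def by (subst (asm) has_sum_reindex) (auto simp: o_def)
  then show "((\<lambda>i. \<integral>x. f i x \<partial>M) has_sum (\<integral>x. (\<Sum>\<^sub>\<infinity>i. f i x) \<partial>M)) UNIV"
    by (simp only: g_to_nat)
qed


section \<open>Projection of products of modes\<close>

text \<open>The summand \<open>- (h * n)^2\<close> normalises the modulus to
  \<open>exp (- (Im z + h * n)^2)\<close>: all modes have the same height and are centred at equally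
  spaced values of \<open>Im z\<close>.\<close>

definition psi :: "real \<Rightarrow> int \<Rightarrow> complex \<Rightarrow> complex" where
  "psi h n z = exp (z\<^sup>2 / 2 - of_real ((cmod z)\<^sup>2 / 2) + 2 * \<i> * of_real (h * of_int n) * z
     - of_real (h\<^sup>2 * (of_int n)\<^sup>2))"

lemma psi_Complex:
  "psi h n (Complex x y) = exp (\<i> * of_real (x * y + 2 * (h * of_int n) * x)) *
     of_real (exp (- (y + h * of_int n)\<^sup>2))"
proof -
  have "(Complex x y)\<^sup>2 / 2 - of_real ((cmod (Complex x y))\<^sup>2 / 2) + 2 * \<i> * of_real (h * of_int n) * Complex x y
     - of_real (h\<^sup>2 * (of_int n)\<^sup>2) = \<i> * of_real (x * y + 2 * (h * of_int n) * x) + of_real (- (y + h * of_int n)\<^sup>2)"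
    unfolding cmod_power2 by (simp add: complex_eq_iff power2_eq_square field_simps)
  then show ?thesis unfolding psi_def by (simp only: exp_add exp_of_real)
qed

lemma cmod_psi: "cmod (psi h n z) = exp (- (Im z + h * of_int n)\<^sup>2)"
  using psi_Complex[of h n "Re z" "Im z"] by (simp add: norm_mult)

lemma continuous_on_psi [continuous_intros]: "continuous_on S (psi h n)"
  unfolding psi_def[abs_def] by (intro continuous_intros) auto

lemma borel_measurable_psi [measurable]: "psi h n \<in> borel_measurable borel"
  by (intro borel_measurable_continuous_onI continuous_on_psi)

text \<open>Polarisation of \<open>Re (cnj w * z)\<close>. Up to a factor that cancels the weight in
  front of the projection, the kernel is a Gaussian in \<open>w - z\<close>, so the projection is
  dominated by a convolution.\<close>

lemma norm_bargmann_kernel: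
  "cmod (exp (cnj w * z - of_real ((cmod w)\<^sup>2 / 2))) = exp ((cmod z)\<^sup>2 / 2) * exp (- (1/2 * (cmod (w - z))\<^sup>2))"
proof -
  have "Re (cnj w * z - of_real ((cmod w)\<^sup>2 / 2)) = (cmod z)\<^sup>2 / 2 + - (1/2 * (cmod (w - z))\<^sup>2)"
    unfolding cmod_power2 by (simp add: power2_eq_square field_simps)
  then show ?thesis by (simp only: norm_exp_eq_Re exp_add)
qed

text \<open>The product has frequency \<open>a + c - b\<close> in \<open>Re w\<close> and is Gaussian in \<open>Im w\<close>; both one-dimensional
  integrals are explicit.\<close>

lemma bargmann_integral_psi3:
  defines "K \<equiv> (\<lambda>z w. exp (cnj w * z - of_real ((cmod w)\<^sup>2 / 2)))"
  shows "1 / of_real pi * of_real (exp (- (cmod z)\<^sup>2 / 2)) *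
      (LINT w|lborel. K z w * (psi h a w * cnj (psi h b w) * psi h c w))
    = of_real (1 / sqrt 2 * gw h (b - c) * gw h (b - a)) * psi h (a + c - b) z"
proof -
  define m where "m = a + c - b"
  let ?u = "\<lambda>w. psi h a w * cnj (psi h b w) * psi h c w"
  define Q where "Q y = (y + h * of_int a)\<^sup>2 + (y + h * of_int b)\<^sup>2 + (y + h * of_int c)\<^sup>2" for y :: real
  define hm where "hm = h * of_int m"
  have u: "?u (Complex x y) = exp (\<i> * of_real (x * y + 2 * hm * x)) * of_real (exp (- Q y))" for x y
  proof -
    have "?u (Complex x y) = (exp (\<i> * of_real (x * y + 2 * (h * of_int a) * x)) *
        exp (- (\<i> * of_real (x * y + 2 * (h * of_int b) * x))) *
        exp (\<i> * of_real (x * y + 2 * (h * of_int c) * x))) *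
        (of_real (exp (- (y + h * of_int a)\<^sup>2)) * of_real (exp (- (y + h * of_int b)\<^sup>2)) *
        of_real (exp (- (y + h * of_int c)\<^sup>2)))"
      by (simp add: psi_Complex exp_cnj mult_ac)
    also have "\<dots> = exp (\<i> * of_real (x * y + 2 * hm * x)) * of_real (exp (- Q y))"
    proof (rule arg_cong2[where f="(*)"])
      show "exp (\<i> * of_real (x * y + 2 * (h * of_int a) * x)) *
          exp (- (\<i> * of_real (x * y + 2 * (h * of_int b) * x))) *
          exp (\<i> * of_real (x * y + 2 * (h * of_int c) * x)) = exp (\<i> * of_real (x * y + 2 * hm * x))"
        unfolding exp_add[symmetric]
        by (rule arg_cong[where f=exp]) (simp add: hm_def m_def algebra_simps)
      show "of_real (exp (- (y + h * of_int a)\<^sup>2)) * of_real (exp (- (y + h * of_int b)\<^sup>2)) *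
          of_real (exp (- (y + h * of_int c)\<^sup>2)) = complex_of_real (exp (- Q y))"
        unfolding of_real_mult[symmetric] exp_add[symmetric]
        by (rule arg_cong[where f="\<lambda>x. of_real (exp x)"]) (simp add: Q_def)
    qed
    finally show ?thesis .
  qed
  have int: "integrable lborel (\<lambda>w. K z w * ?u w)"
  proof (rule Bochner_Integration.integrable_bound)
    show "integrable lborel (\<lambda>w. exp ((cmod z)\<^sup>2 / 2) * exp (- (1/2 * (cmod (w - z))\<^sup>2)))"
      by (intro integrable_mult_right integrable_gaussian_complex) simp
    show "AE w in lborel. cmod (K z w * ?u w) \<le> norm (exp ((cmod z)\<^sup>2 / 2) * exp (- (1/2 * (cmod (w - z))\<^sup>2)))"
    proof (rule AE_I2)
      fix w
      have "cmod (?u w) \<le> 1 * 1 * 1"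
        unfolding norm_mult complex_mod_cnj cmod_psi by (intro mult_mono) auto
      then have "cmod (K z w) * cmod (?u w) \<le> cmod (K z w) * 1" by (intro mult_left_mono) auto
      then show "cmod (K z w * ?u w) \<le> norm (exp ((cmod z)\<^sup>2 / 2) * exp (- (1/2 * (cmod (w - z))\<^sup>2)))"
        unfolding norm_mult[of "K z w"] by (simp only: K_def norm_bargmann_kernel) simp
    qed
  next
    have "continuous_on UNIV (\<lambda>w. K z w * ?u w)"
      unfolding K_def by (intro continuous_intros) auto
    then show "(\<lambda>w. K z w * ?u w) \<in> borel_measurable lborel"
      by (simp add: borel_measurable_continuous_onI)
  qed
  have inner: "(\<integral>x. K z (Complex x y) * ?u (Complex x y) \<partial>lborel)
      = (sqrt (2 * pi) * exp (z\<^sup>2 / 2 + 2 * \<i> * of_real hm * z - of_real (hm\<^sup>2))) * of_real (exp (- ((y + hm)\<^sup>2 + Q y)))" for y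
  proof -
    \<comment> \<open>Everything that multiplies \<open>x\<close> in the exponent; the integral over
      \<open>x\<close> turns it into \<open>\<zeta>^2 / 2\<close>.\<close>
    define \<zeta> where "\<zeta> = z + \<i> * of_real y + 2 * \<i> * of_real hm"
    have "K z (Complex x y) * ?u (Complex x y)
        = exp (- (\<i> * of_real y * z) - of_real (y\<^sup>2 / 2 + Q y)) * exp (- (of_real x)\<^sup>2 / 2 + of_real x * \<zeta>)" for x
    proof -
      have "cnj (Complex x y) * z - of_real ((cmod (Complex x y))\<^sup>2 / 2) + \<i> * of_real (x * y + 2 * hm * x) + of_real (- Q y)
        = (- (\<i> * of_real y * z) - of_real (y\<^sup>2 / 2 + Q y)) + (- (of_real x)\<^sup>2 / 2 + of_real x * \<zeta>)"
        unfolding cmod_power2 by (simp add: \<zeta>_def complex_eq_iff power2_eq_square field_simps)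
      then show ?thesis
        unfolding u K_def exp_of_real[symmetric] mult.assoc[symmetric] exp_add[symmetric]
        by (simp only: add.assoc)
    qed
    then have "(\<integral>x. K z (Complex x y) * ?u (Complex x y) \<partial>lborel)
        = exp (- (\<i> * of_real y * z) - of_real (y\<^sup>2 / 2 + Q y)) * (sqrt (2 * pi) * exp (\<zeta>\<^sup>2 / 2))"
      by (simp only: integral_mult_right_zero integral_gaussian_complex_linear)
    also have "\<dots> = sqrt (2 * pi) * (exp (- (\<i> * of_real y * z) - of_real (y\<^sup>2 / 2 + Q y)) * exp (\<zeta>\<^sup>2 / 2))"
      by simp
    also have "exp (- (\<i> * of_real y * z) - of_real (y\<^sup>2 / 2 + Q y)) * exp (\<zeta>\<^sup>2 / 2)
       = exp (z\<^sup>2 / 2 + 2 * \<i> * of_real hm * z - of_real (hm\<^sup>2)) * exp (of_real (- ((y + hm)\<^sup>2 + Q y)))"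
      unfolding exp_add[symmetric]
      by (rule arg_cong[where f=exp]) (simp add: \<zeta>_def power2_eq_square field_simps)
    finally show ?thesis unfolding exp_of_real by (simp only: mult.assoc)
  qed
  \<comment> \<open>Four squares, with centres given by \<open>m\<close>, \<open>a\<close>,
    \<open>b\<close>, \<open>c\<close> times \<open>- h\<close>. Since \<open>m + b = a + c\<close>,
    their mean is \<open>- h * (a + c) / 2\<close>, and the remainder is exactly the sum of the two
    squares that make up the Gaussian weights.\<close>
  have sq: "(y + hm)\<^sup>2 + Q y = 4 * (y - (- (h * (of_int a + of_int c) / 2)))\<^sup>2
      + (h\<^sup>2 * (of_int (b - c))\<^sup>2 + h\<^sup>2 * (of_int (b - a))\<^sup>2)" for y
    by (simp add: Q_def hm_def m_def power2_eq_square field_simps)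
  have outer: "(\<integral>y. exp (- ((y + hm)\<^sup>2 + Q y)) \<partial>lborel) = gw h (b - c) * gw h (b - a) * (sqrt pi / 2)"
  proof -
    have "exp (- ((y + hm)\<^sup>2 + Q y)) = (gw h (b - c) * gw h (b - a)) * exp (- (4 * (y - (- (h * (of_int a + of_int c) / 2)))\<^sup>2))" for y
      unfolding sq gw_def by (simp add: exp_add[symmetric] algebra_simps)
    moreover have "(\<integral>y. exp (- (4 * (y - (- (h * (of_int a + of_int c) / 2)))\<^sup>2)) \<partial>lborel) = sqrt (pi / 4)"
      by (rule integral_gaussian) simp
    ultimately show ?thesis by (simp only: integral_mult_right_zero) (simp add: real_sqrt_divide)
  qed
  have "(LINT w|lborel. K z w * ?u w)
      = (sqrt (2 * pi) * exp (z\<^sup>2 / 2 + 2 * \<i> * of_real hm * z - of_real (hm\<^sup>2))) *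
         of_real (gw h (b - c) * gw h (b - a) * (sqrt pi / 2))"
    by (simp only: integral_complex[OF int] inner integral_mult_right_zero integral_complex_of_real outer)
  also have "1 / of_real pi * of_real (exp (- (cmod z)\<^sup>2 / 2)) * \<dots> = of_real (1 / pi * (sqrt (2 * pi) * (sqrt pi / 2)) * gw h (b - c) * gw h (b - a))
      * (of_real (exp (- (cmod z)\<^sup>2 / 2)) * exp (z\<^sup>2 / 2 + 2 * \<i> * of_real hm * z - of_real (hm\<^sup>2)))"
    by simp
  also have "of_real (exp (- (cmod z)\<^sup>2 / 2)) * exp (z\<^sup>2 / 2 + 2 * \<i> * of_real hm * z - of_real (hm\<^sup>2)) = psi h m z"
    unfolding psi_def exp_of_real[symmetric] exp_add[symmetric]
    by (rule arg_cong[where f=exp]) (simp add: hm_def power_mult_distrib)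
  also have "1 / pi * (sqrt (2 * pi) * (sqrt pi / 2)) = 1 / sqrt 2"
    by (simp add: real_sqrt_mult field_simps)
  finally show ?thesis by (simp only: m_def)
qed


definition psi_bound :: "real \<Rightarrow> real" where
  "psi_bound h = exp (1/4 + h / 2) * (\<Sum>\<^sub>\<infinity>n::int. exp (- (h * \<bar>of_int n\<bar>)))"

text \<open>Uniform in \<open>z\<close>: counting modes from the one centred nearest to
  \<open>Im z\<close> makes the moduli decay geometrically. In \<open>psi_bound\<close>,
  \<open>h / 2\<close> is the largest distance to the nearest centre and \<open>1/4\<close> comes
  from \<open>t \<le> t^2 + 1/4\<close>.\<close>

lemma psi_summable_bound:
  assumes h: "0 < h"
  shows "(\<lambda>n. cmod (psi h n z)) summable_on UNIV" and "(\<Sum>\<^sub>\<infinity>n. cmod (psi h n z)) \<le> psi_bound h"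
proof -
  define y where "y = Im z"
  define n0 where "n0 = round (- y / h)"
  let ?g = "\<lambda>n::int. exp (- (h * \<bar>of_int n\<bar>))"
  have s: "(\<lambda>n. exp (1/4 + h / 2) * ?g (n + - n0)) summable_on UNIV"
    by (intro summable_on_cmult_right summable_on_add_shift_int[of ?g "- n0"] summable_on_exp_abs_int h)
  have le: "cmod (psi h n z) \<le> exp (1/4 + h / 2) * ?g (n + - n0)" for n
  proof -
    have "\<bar>- y / h - of_int n0\<bar> \<le> 1/2" unfolding n0_def
      by (subst abs_minus_commute) (rule of_int_round_abs_le)
    then have "h * \<bar>- y / h - of_int n0\<bar> \<le> h * (1/2)" using h by (intro mult_left_mono) auto
    also have "h * \<bar>- y / h - of_int n0\<bar> = \<bar>h * (- y / h - of_int n0)\<bar>" using h by (simp add: abs_mult)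
    also have "h * (- y / h - of_int n0) = - (y + h * of_int n0)" using h by (simp add: field_simps)
    finally have 1: "\<bar>y + h * of_int n0\<bar> \<le> h / 2" unfolding abs_minus_cancel by simp
    have "h * \<bar>of_int (n + - n0)\<bar> = \<bar>(y + h * of_int n) - (y + h * of_int n0)\<bar>"
      using h by (simp add: abs_mult[of h, symmetric, unfolded abs_of_pos[OF h]] right_diff_distrib)
    also have "\<dots> \<le> \<bar>y + h * of_int n\<bar> + h / 2" using 1 by linarith
    finally have 2: "h * \<bar>of_int (n + - n0)\<bar> \<le> \<bar>y + h * of_int n\<bar> + h / 2" .
    have "0 \<le> (\<bar>y + h * of_int n\<bar> - 1/2)\<^sup>2" by simp
    then have "\<bar>y + h * of_int n\<bar> \<le> (y + h * of_int n)\<^sup>2 + 1/4"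
      by (simp add: power2_diff power2_abs) (simp add: power2_eq_square)
    with 2 have "- (y + h * of_int n)\<^sup>2 \<le> 1/4 + h / 2 + - (h * \<bar>of_int (n + - n0)\<bar>)" by linarith
    then show ?thesis unfolding cmod_psi y_def[symmetric] exp_add[symmetric] by (simp only: exp_le_cancel_iff)
  qed
  show 1: "(\<lambda>n. cmod (psi h n z)) summable_on UNIV"
    by (rule summable_on_comparison_test[OF s]) (use le in auto)
  have "(\<Sum>\<^sub>\<infinity>n. cmod (psi h n z)) \<le> (\<Sum>\<^sub>\<infinity>n. exp (1/4 + h / 2) * ?g (n + - n0))"
    by (rule infsum_mono[OF 1 s le])
  also have "\<dots> = psi_bound h"
    unfolding psi_bound_def by (simp only: infsum_cmult_right' infsum_add_shift_int[of ?g])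
  finally show "(\<Sum>\<^sub>\<infinity>n. cmod (psi h n z)) \<le> psi_bound h" .
qed

lemma has_sum_times_product:
  fixes f :: "'i \<Rightarrow> 'c::{real_normed_field, banach}" and g :: "'j \<Rightarrow> 'c"
  assumes f: "(\<lambda>x. norm (f x)) summable_on UNIV" and g: "(\<lambda>x. norm (g x)) summable_on UNIV"
  shows "(\<lambda>(x, y). norm (f x * g y)) summable_on UNIV"
    and "((\<lambda>(x, y). f x * g y) has_sum (infsum f UNIV * infsum g UNIV)) UNIV"
proof -
  have "(\<lambda>(x, y). norm (f x) * norm (g y)) summable_on Sigma UNIV (\<lambda>_. UNIV)"
  proof (rule summable_on_SigmaI)
    show "((\<lambda>y. case (x, y) of (x, y) \<Rightarrow> norm (f x) * norm (g y)) has_sum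
          norm (f x) * (\<Sum>\<^sub>\<infinity>y. norm (g y))) UNIV" for x
      unfolding case_prod_conv by (intro has_sum_cmult_right has_sum_infsum g)
    show "(\<lambda>x. norm (f x) * (\<Sum>\<^sub>\<infinity>y. norm (g y))) summable_on UNIV"
      by (intro summable_on_cmult_left f)
  qed simp
  then show s: "(\<lambda>(x, y). norm (f x * g y)) summable_on UNIV"
    by (simp add: norm_mult)
  have s': "(\<lambda>(x, y). f x * g y) summable_on UNIV"
    by (rule abs_summable_summable) (use s in \<open>simp add: case_prod_unfold\<close>)
  have "(\<Sum>\<^sub>\<infinity>(x, y). f x * g y) = (\<Sum>\<^sub>\<infinity>x. \<Sum>\<^sub>\<infinity>y. f x * g y)"
    using infsum_Sigma_banach[of "\<lambda>(x, y). f x * g y" UNIV "\<lambda>_. UNIV"] s' by simp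
  also have "\<dots> = infsum f UNIV * infsum g UNIV"
    by (simp only: infsum_cmult_right' infsum_cmult_left')
  finally show "((\<lambda>(x, y). f x * g y) has_sum (infsum f UNIV * infsum g UNIV)) UNIV"
    using has_sum_infsum[OF s'] by simp
qed

lemma has_sum_times_product3:
  fixes f :: "'i \<Rightarrow> 'c::{real_normed_field, banach}" and g :: "'j \<Rightarrow> 'c" and k :: "'k \<Rightarrow> 'c"
  assumes f: "(\<lambda>x. norm (f x)) summable_on UNIV" and g: "(\<lambda>x. norm (g x)) summable_on UNIV"
    and k: "(\<lambda>x. norm (k x)) summable_on UNIV"
  shows "((\<lambda>(x, y, z). f x * (g y * k z)) has_sum (infsum f UNIV * (infsum g UNIV * infsum k UNIV))) UNIV"
proof -
  have "(\<lambda>p. norm ((\<lambda>(y, z). g y * k z) p)) summable_on UNIV"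
    using has_sum_times_product(1)[OF g k] by (simp add: case_prod_unfold)
  from has_sum_times_product(2)[OF f this] infsumI[OF has_sum_times_product(2)[OF g k]]
  show ?thesis by (simp add: case_prod_unfold)
qed

section \<open>Superpositions of modes with bounded coefficients\<close>

definition synth :: "real \<Rightarrow> (int \<Rightarrow> complex) \<Rightarrow> complex \<Rightarrow> complex" where
  "synth h c z = (\<Sum>\<^sub>\<infinity>n. c n * psi h n z)"

lemma synth_norm_summable:
  assumes h: "0 < h" and c: "\<And>n. cmod (c n) \<le> C"
  shows "(\<lambda>n. norm (c n * psi h n z)) summable_on UNIV"
    and "(\<Sum>\<^sub>\<infinity>n. norm (c n * psi h n z)) \<le> C * psi_bound h"
proof -
  have s: "(\<lambda>n. C * cmod (psi h n z)) summable_on UNIV"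
    by (intro summable_on_cmult_right psi_summable_bound h)
  have le: "norm (c n * psi h n z) \<le> C * cmod (psi h n z)" for n
    using c[of n] by (simp add: norm_mult mult_right_mono)
  show 1: "(\<lambda>n. norm (c n * psi h n z)) summable_on UNIV"
    by (rule summable_on_comparison_test[OF s le]) auto
  have "(\<Sum>\<^sub>\<infinity>n. norm (c n * psi h n z)) \<le> (\<Sum>\<^sub>\<infinity>n. C * cmod (psi h n z))"
    by (rule infsum_mono[OF 1 s le])
  also have "\<dots> = C * (\<Sum>\<^sub>\<infinity>n. cmod (psi h n z))" by (rule infsum_cmult_right')
  also have "\<dots> \<le> C * psi_bound h"
    using order_trans[OF norm_ge_zero c[of 0]] by (intro mult_left_mono psi_summable_bound(2) h)
  finally show "(\<Sum>\<^sub>\<infinity>n. norm (c n * psi h n z)) \<le> C * psi_bound h" .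
qed

lemma synth_has_sum:
  assumes "0 < h" "\<And>n. cmod (c n) \<le> C"
  shows "((\<lambda>n. c n * psi h n z) has_sum synth h c z) UNIV"
  unfolding synth_def
  by (rule has_sum_infsum[OF abs_summable_summable[OF synth_norm_summable(1)[OF assms]]])

lemma cmod_synth_le:
  assumes "0 < h" "\<And>n. cmod (c n) \<le> C"
  shows "cmod (synth h c z) \<le> C * psi_bound h"
  using norm_infsum_bound[OF synth_norm_summable(1)[of h c C z, OF assms]]
    synth_norm_summable(2)[of h c C z, OF assms]
  unfolding synth_def by linarith

text \<open>The complex, unweighted counterpart of \<open>conv_gw\<close>;
  \<open>corr_wcoeffs\<close> matches the two.\<close>

definition corr :: "real \<Rightarrow> (int \<Rightarrow> complex) \<Rightarrow> int \<Rightarrow> complex" where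
  "corr h c m = (\<Sum>\<^sub>\<infinity>p. of_real (gw h p) * c (m + p))"

lemma corr_norm_summable:
  assumes h: "0 < h" and c: "\<And>n. cmod (c n) \<le> C"
  shows "(\<lambda>p. norm (of_real (gw h p) * c (m + p))) summable_on UNIV"
proof (rule summable_on_comparison_test)
  show "(\<lambda>p. gw h p * C) summable_on UNIV" by (intro summable_on_cmult_left summable_on_gw h)
  show "norm (of_real (gw h p) * c (m + p)) \<le> gw h p * C" for p
    using c by (simp add: norm_mult mult_left_mono)
qed simp

lemma corr_has_sum:
  assumes "0 < h" "\<And>n. cmod (c n) \<le> C"
  shows "((\<lambda>p. of_real (gw h p) * c (m + p)) has_sum corr h c m) UNIV"
  unfolding corr_def
  by (rule has_sum_infsum[OF abs_summable_summable[OF corr_norm_summable[OF assms]]])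

lemma cmod_corr_le:
  assumes h: "0 < h" and c: "\<And>n. cmod (c n) \<le> C"
  shows "cmod (corr h c m) \<le> gw_mass h 0 * C"
proof -
  have "norm (corr h c m) \<le> (\<Sum>\<^sub>\<infinity>p. gw h p * C)"
    by (rule norm_infsum_le[OF corr_has_sum[OF h c] has_sum_infsum])
       (use c in \<open>auto intro!: summable_on_cmult_left summable_on_gw h mult_left_mono simp: norm_mult\<close>)
  then show ?thesis by (simp add: infsum_cmult_left' gw_mass_0)
qed

lemma gw_has_sum: "0 < h \<Longrightarrow> (gw h has_sum gw_mass h 0) UNIV"
  unfolding gw_mass_0 by (intro has_sum_infsum summable_on_gw)

text \<open>The first coefficient is free of \<open>p\<close>, so summing over \<open>p\<close>
  yields only the total mass; the conjugated one sees the shift \<open>p + q\<close> and is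
  correlated twice. This is where \<open>2 \<theta> G\<close> and \<open>G^2\<close> in the two
  operators come from.\<close>

lemma inner_double_sum:
  assumes h: "0 < h" and c: "\<And>n. cmod (c n) \<le> C"
  shows "(\<Sum>\<^sub>\<infinity>(p, q). of_real (gw h p * gw h q) * (2 * c (m + q) + cnj (c (m + p + q))))
    = 2 * of_real (gw_mass h 0) * corr h c m + corr h (corr h (\<lambda>n. cnj (c n))) m"
proof -
  let ?f = "\<lambda>(p, q). of_real (gw h p * gw h q) * (2 * c (m + q) + cnj (c (m + p + q)))"
  have c': "cmod (cnj (c n)) \<le> C" for n using c by simp
  have gs: "(\<lambda>p. norm (gw h p)) summable_on UNIV" using summable_on_gw[OF h] by simp
  have "(\<lambda>z. norm (?f z)) summable_on UNIV"
  proof (rule summable_on_comparison_test)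
    have "(\<lambda>z. (case z of (x, y) \<Rightarrow> norm (gw h x * gw h y)) * (3 * C)) summable_on UNIV"
      by (intro summable_on_cmult_left has_sum_times_product(1) gs)
    then show "(\<lambda>(p, q). gw h p * gw h q * (3 * C)) summable_on UNIV"
      by (simp add: case_prod_unfold)
    fix z :: "int \<times> int"
    obtain p q where z: "z = (p, q)" by force
    have "cmod (2 * c (m + q) + cnj (c (m + p + q))) \<le> 2 * C + C"
      by (intro order_trans[OF norm_triangle_ineq] add_mono) (use c in \<open>auto simp: norm_mult\<close>)
    then show "norm (?f z) \<le> (case z of (p, q) \<Rightarrow> gw h p * gw h q * (3 * C))"
      by (simp add: z norm_mult mult_left_mono)
  qed auto
  then have s: "?f summable_on UNIV" by (rule abs_summable_summable)
  have "(\<Sum>\<^sub>\<infinity>z. ?f z) = (\<Sum>\<^sub>\<infinity>p. \<Sum>\<^sub>\<infinity>q. ?f (p, q))"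
    using infsum_Sigma_banach[of ?f UNIV "\<lambda>_. UNIV"] s by simp
  also have "\<dots> = (\<Sum>\<^sub>\<infinity>p. of_real (gw h p) * (2 * corr h c m + corr h (\<lambda>n. cnj (c n)) (m + p)))"
  proof (rule infsum_cong)
    fix p
    have "((\<lambda>q. of_real (gw h p) * (2 * (of_real (gw h q) * c (m + q)) + of_real (gw h q) * cnj (c (m + p + q))))
      has_sum of_real (gw h p) * (2 * corr h c m + corr h (\<lambda>n. cnj (c n)) (m + p))) UNIV"
      by (intro has_sum_cmult_right has_sum_add corr_has_sum[OF h c] corr_has_sum[OF h c'])
    moreover have "of_real (gw h p) * (2 * (of_real (gw h q) * c (m + q)) + of_real (gw h q) * cnj (c (m + p + q)))
      = ?f (p, q)" for q by (simp add: algebra_simps)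
    ultimately show "(\<Sum>\<^sub>\<infinity>q. ?f (p, q)) = of_real (gw h p) * (2 * corr h c m + corr h (\<lambda>n. cnj (c n)) (m + p))"
      by (simp only: infsumI)
  qed
  also have "\<dots> = (\<Sum>\<^sub>\<infinity>p. of_real (gw h p) * (2 * corr h c m) + of_real (gw h p) * corr h (\<lambda>n. cnj (c n)) (m + p))"
    by (simp only: distrib_left)
  also have "\<dots> = of_real (gw_mass h 0) * (2 * corr h c m) + corr h (corr h (\<lambda>n. cnj (c n))) m"
    by (intro infsumI has_sum_add has_sum_cmult_left has_sum_of_real gw_has_sum h
        corr_has_sum[OF h cmod_corr_le[OF h c']])
  finally show ?thesis by simp
qed

text \<open>The cubic expression is expanded into triples of modes, projected term by term under a
  Gaussian majorant, and regrouped by the frequency of the result.\<close>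

lemma bargmann_proj_synth:
  fixes s :: real
  assumes h: "0 < h" and c: "\<And>n. cmod (c n) \<le> C"
  defines "\<Phi> \<equiv> (\<lambda>w. of_real s * synth h (\<lambda>_. 1) w)"
  shows "bargmann_proj (\<lambda>w. 2 * of_real ((cmod (\<Phi> w))\<^sup>2) * synth h c w + (\<Phi> w)\<^sup>2 * cnj (synth h c w)) z
    = synth h (\<lambda>m. of_real (s\<^sup>2 / sqrt 2) *
        (2 * of_real (gw_mass h 0) * corr h c m + corr h (corr h (\<lambda>n. cnj (c n))) m)) z"
proof -
  define K where "K w = exp (cnj w * z - of_real ((cmod w)\<^sup>2 / 2))" for w
  define pre where "pre = 1 / of_real pi * (of_real (exp (- (cmod z)\<^sup>2 / 2)) :: complex)"
  define u where "u w = 2 * of_real ((cmod (\<Phi> w))\<^sup>2) * synth h c w + (\<Phi> w)\<^sup>2 * cnj (synth h c w)" for w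
  \<comment> \<open>Both terms of the linearization contain the same triple product: in
    \<open>|\<Phi>|^2 v\<close> the coefficient of \<open>v\<close> sits at \<open>d\<close>, in
    \<open>\<Phi>^2 cnj v\<close> at the conjugated index \<open>b\<close>.\<close>
  define f where "f i w = (case i of (a, b, d) \<Rightarrow>
      (of_real (s\<^sup>2) * (2 * c d + cnj (c b))) * (K w * (psi h a w * cnj (psi h b w) * psi h d w)))"
    for i :: "int \<times> int \<times> int" and w
  define S where "S = psi_bound h"
  have C0: "0 \<le> C" using order_trans[OF norm_ge_zero c[of 0]] .
  have Kc: "continuous_on UNIV K" unfolding K_def[abs_def] by (intro continuous_intros) auto
  have ps: "(\<lambda>n. norm (psi h n w)) summable_on UNIV" for w by (rule psi_summable_bound(1)[OF h])
  have pcs: "(\<lambda>n. norm (cnj (psi h n w))) summable_on UNIV" for w using ps by simp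
  have cs: "(\<lambda>n. norm (c n * psi h n w)) summable_on UNIV" for w by (rule synth_norm_summable(1)[OF h c])
  have ccs: "(\<lambda>n. norm (cnj (c n * psi h n w))) summable_on UNIV" for w using cs by (simp only: complex_mod_cnj)
  have one: "synth h (\<lambda>_. 1) w = (\<Sum>\<^sub>\<infinity>n. psi h n w)" for w by (simp add: synth_def)
  have f_sum: "((\<lambda>i. f i w) has_sum K w * u w) UNIV" for w
  proof -
    let ?A = "\<Sum>\<^sub>\<infinity>n. psi h n w" and ?V = "synth h c w"
    have 1: "((\<lambda>(a, b, d). psi h a w * (cnj (psi h b w) * (c d * psi h d w))) has_sum ?A * (cnj ?A * ?V)) UNIV"
      using has_sum_times_product3[OF ps pcs cs, of w w w] by (simp only: infsum_cnj synth_def)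
    have 2: "((\<lambda>(a, b, d). psi h a w * (cnj (c b * psi h b w) * psi h d w)) has_sum ?A * (cnj ?V * ?A)) UNIV"
      using has_sum_times_product3[OF ps ccs ps, of w w w] by (simp only: infsum_cnj synth_def)
    have "((\<lambda>i. (of_real (s\<^sup>2) * K w) * (2 * (case i of (a, b, d) \<Rightarrow> psi h a w * (cnj (psi h b w) * (c d * psi h d w)))
        + (case i of (a, b, d) \<Rightarrow> psi h a w * (cnj (c b * psi h b w) * psi h d w))))
        has_sum (of_real (s\<^sup>2) * K w) * (2 * (?A * (cnj ?A * ?V)) + ?A * (cnj ?V * ?A))) UNIV"
      by (intro has_sum_cmult_right has_sum_add 1 2)
    moreover have "(of_real (s\<^sup>2) * K w) * (2 * (case i of (a, b, d) \<Rightarrow> psi h a w * (cnj (psi h b w) * (c d * psi h d w)))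
        + (case i of (a, b, d) \<Rightarrow> psi h a w * (cnj (c b * psi h b w) * psi h d w))) = f i w" for i
      by (cases i) (simp add: f_def algebra_simps)
    moreover have "(of_real (s\<^sup>2) * K w) * (2 * (?A * (cnj ?A * ?V)) + ?A * (cnj ?V * ?A)) = K w * u w"
    proof -
      have "of_real ((cmod (\<Phi> w))\<^sup>2) = \<Phi> w * cnj (\<Phi> w)" by (rule complex_norm_square)
      then show ?thesis
        by (simp add: u_def \<Phi>_def one power2_eq_square algebra_simps)
    qed
    ultimately show ?thesis by (simp only:)
  qed
  define D where "D w = s\<^sup>2 * (3 * C) * (exp ((cmod z)\<^sup>2 / 2) * exp (- (1/2 * (cmod (w - z))\<^sup>2))) * (S * (S * S))" for w
  have bound: "(\<Sum>i\<in>F. norm (f i w)) \<le> D w" if "finite F" for F w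
  proof -
    let ?n = "\<lambda>n. norm (norm (psi h n w))"
    let ?p = "\<lambda>(a, b, d). cmod (psi h a w) * (cmod (psi h b w) * cmod (psi h d w))"
    let ?P = "\<Sum>\<^sub>\<infinity>n. cmod (psi h n w)"
    have psr: "(\<lambda>n. norm (cmod (psi h n w))) summable_on UNIV" using ps by simp
    have hs: "(?p has_sum (?P * (?P * ?P))) UNIV"
      by (rule has_sum_times_product3[OF psr psr psr])
    have P: "0 \<le> ?P" "?P \<le> S"
      unfolding S_def by (auto intro: infsum_nonneg psi_summable_bound(2)[OF h])
    have "sum ?p F \<le> ?P * (?P * ?P)"
      using hs that by (intro finite_sum_le_has_sum[OF hs]) auto
    also have "\<dots> \<le> S * (S * S)" using P by (intro mult_mono) auto
    finally have pF: "sum ?p F \<le> S * (S * S)" .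
    have fi: "norm (f i w) \<le> (s\<^sup>2 * (3 * C) * cmod (K w)) * ?p i" for i
    proof -
      obtain a b d where i: "i = (a, b, d)" by (cases i) auto
      have "cmod (2 * c d + cnj (c b)) \<le> 2 * C + C"
        by (intro order_trans[OF norm_triangle_ineq] add_mono) (use c in \<open>auto simp: norm_mult\<close>)
      then have "s\<^sup>2 * cmod (2 * c d + cnj (c b)) * (cmod (K w) * ?p i) \<le> s\<^sup>2 * (3 * C) * (cmod (K w) * ?p i)"
        by (intro mult_right_mono mult_left_mono) (auto simp: i)
      then show ?thesis by (simp add: f_def i norm_mult norm_power mult_ac)
    qed
    have "(\<Sum>i\<in>F. norm (f i w)) \<le> (\<Sum>i\<in>F. (s\<^sup>2 * (3 * C) * cmod (K w)) * ?p i)"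
      by (rule sum_mono) (rule fi)
    also have "\<dots> = (s\<^sup>2 * (3 * C) * cmod (K w)) * sum ?p F" by (rule sum_distrib_left[symmetric])
    also have "\<dots> \<le> (s\<^sup>2 * (3 * C) * cmod (K w)) * (S * (S * S))"
      using C0 pF by (intro mult_left_mono) auto
    also have "\<dots> = D w" unfolding D_def K_def norm_bargmann_kernel by simp
    finally show ?thesis .
  qed
  have Dint: "integrable lborel D" unfolding D_def[abs_def]
    by (intro integrable_mult_left integrable_mult_right integrable_gaussian_complex) simp
  have fm: "f i \<in> borel_measurable lborel" for i
  proof -
    obtain a b d where i: "i = (a, b, d)" by (cases i) auto
    have "continuous_on UNIV (f i)" unfolding f_def[abs_def] i prod.case
      by (intro continuous_intros Kc)
    then show ?thesis by (simp add: borel_measurable_continuous_onI)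
  qed
  note dom = has_sum_integral_dominated[OF fm Dint bound]
  have inf_eq: "(\<Sum>\<^sub>\<infinity>i. f i w) = K w * u w" for w using f_sum by (rule infsumI)
  have meas: "(\<lambda>w. K w * u w) \<in> borel_measurable lborel"
    using dom(1) unfolding inf_eq by (rule borel_measurable_integrable)
  have proj: "bargmann_proj u z = pre * (LINT w|lborel. K w * u w)"
    unfolding bargmann_proj_def pre_def K_def[symmetric]
    by (subst integral_completion[OF meas]) simp
  have term_eq: "pre * (LINT w|lborel. f (a, b, d) w) = of_real (s\<^sup>2 / sqrt 2) * (of_real (gw h (b - d) * gw h (b - a)) *
      (2 * c d + cnj (c b))) * psi h (a + d - b) z" for a b d
  proof -
    have "pre * (LINT w|lborel. f (a, b, d) w) = (of_real (s\<^sup>2) * (2 * c d + cnj (c b))) *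
       (pre * (LINT w|lborel. K w * (psi h a w * cnj (psi h b w) * psi h d w)))"
      unfolding f_def prod.case integral_mult_right_zero by simp
    also have "pre * (LINT w|lborel. K w * (psi h a w * cnj (psi h b w) * psi h d w)) =
        of_real (1 / sqrt 2 * gw h (b - d) * gw h (b - a)) * psi h (a + d - b) z"
      using bargmann_integral_psi3[of z h a b d] by (simp only: pre_def K_def)
    finally show ?thesis by simp
  qed
  \<comment> \<open>New indices: \<open>m = a + d - b\<close> is the frequency of the projected
    product, while \<open>p = b - d\<close> and \<open>q = b - a\<close> are the arguments of its
    two Gaussian weights.\<close>
  define G where "G = (\<lambda>(m, p, q). (of_real (s\<^sup>2 / sqrt 2) * (of_real (gw h p * gw h q) * (2 * c (m + q) + cnj (c (m + p + q))))) * psi h m z)"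
  have "((\<lambda>i. pre * (LINT w|lborel. f i w)) has_sum bargmann_proj u z) UNIV"
    unfolding proj using has_sum_cmult_right[OF dom(2), of pre] by (simp only: inf_eq)
  moreover have "((\<lambda>i. pre * (LINT w|lborel. f i w)) has_sum bargmann_proj u z) UNIV
      \<longleftrightarrow> (G has_sum bargmann_proj u z) UNIV"
    by (rule has_sum_reindex_bij_witness[of _ "\<lambda>(m, p, q). (m + p, m + p + q, m + q)" "\<lambda>(a, b, d). (a + d - b, b - d, b - a)"])
       (auto simp: G_def term_eq algebra_simps)
  ultimately have hG: "(G has_sum bargmann_proj u z) UNIV" by simp
  then have sG: "G summable_on UNIV" by (rule has_sum_imp_summable)
  have "bargmann_proj u z = infsum G UNIV" using hG by (simp add: infsumI)
  also have "\<dots> = (\<Sum>\<^sub>\<infinity>m. \<Sum>\<^sub>\<infinity>pq. G (m, pq))"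
    using infsum_Sigma_banach[of G UNIV "\<lambda>_. UNIV"] sG by simp
  also have "\<dots> = (\<Sum>\<^sub>\<infinity>m. (of_real (s\<^sup>2 / sqrt 2) *
        (2 * of_real (gw_mass h 0) * corr h c m + corr h (corr h (\<lambda>n. cnj (c n))) m)) * psi h m z)"
  proof (rule infsum_cong)
    fix m
    define F where "F = (\<lambda>(p, q). of_real (gw h p * gw h q) * (2 * c (m + q) + cnj (c (m + p + q))))"
    have F: "infsum F UNIV = 2 * of_real (gw_mass h 0) * corr h c m + corr h (corr h (\<lambda>n. cnj (c n))) m"
      unfolding F_def by (rule inner_double_sum[OF h c])
    have "G (m, pq) = (of_real (s\<^sup>2 / sqrt 2) * F pq) * psi h m z" for pq
      by (cases pq) (simp add: G_def F_def)
    then show "(\<Sum>\<^sub>\<infinity>pq. G (m, pq)) = (of_real (s\<^sup>2 / sqrt 2) *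
        (2 * of_real (gw_mass h 0) * corr h c m + corr h (corr h (\<lambda>n. cnj (c n))) m)) * psi h m z"
      by (simp only: infsum_cmult_left' infsum_cmult_right' F)
  qed
  finally show ?thesis unfolding u_def[abs_def] synth_def by simp
qed


section \<open>Mode expansions on the strip\<close>

text \<open>The magnetic factor cancels the change of the quadratic part, leaving the phase
  \<open>2 * n * h * \<gamma>\<close>, which is a multiple of \<open>2 * pi\<close> exactly because
  \<open>h = pi / \<gamma>\<close>.\<close>

lemma psi_add_period:
  assumes g: "0 < \<gamma>" and h: "h = pi / \<gamma>"
  shows "exp ((of_real \<gamma> * cnj z - cnj (of_real \<gamma>) * z) / 2) * psi h n (z + of_real \<gamma>) = psi h n z"
proof -
  have hg: "h * \<gamma> = pi" using g h by simp
  have hg': "of_real h * of_real \<gamma> = (of_real pi :: complex)" using hg by (metis of_real_mult)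
  have "(of_real \<gamma> * cnj z - cnj (of_real \<gamma>) * z) / 2 + ((z + of_real \<gamma>)\<^sup>2 / 2 - of_real ((cmod (z + of_real \<gamma>))\<^sup>2 / 2)
      + 2 * \<i> * of_real (h * of_int n) * (z + of_real \<gamma>) - of_real (h\<^sup>2 * (of_int n)\<^sup>2))
    = (z\<^sup>2 / 2 - of_real ((cmod z)\<^sup>2 / 2) + 2 * \<i> * of_real (h * of_int n) * z - of_real (h\<^sup>2 * (of_int n)\<^sup>2))
      + 2 * \<i> * (of_int n * (of_real h * of_real \<gamma>))"
    unfolding cmod_power2 by (simp add: complex_eq_iff power2_eq_square field_simps)
  also have "2 * \<i> * (of_int n * (of_real h * of_real \<gamma>)) = \<i> * (of_int n * (of_real pi * 2))"
    unfolding hg' by simp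
  finally show ?thesis unfolding psi_def exp_add[symmetric] by (simp only: exp_plus_2pin)
qed

lemma magnetic_translation_synth:
  assumes "0 < \<gamma>" "h = pi / \<gamma>"
  shows "magnetic_translation (of_real \<gamma>) (synth h c) = synth h c"
proof
  fix z
  have "magnetic_translation (of_real \<gamma>) (synth h c) z
     = (\<Sum>\<^sub>\<infinity>n. exp ((of_real \<gamma> * cnj z - cnj (of_real \<gamma>) * z) / 2) * (c n * psi h n (z + of_real \<gamma>)))"
    unfolding magnetic_translation_def synth_def by (rule infsum_cmult_right'[symmetric])
  also have "\<dots> = synth h c z" unfolding synth_def
    by (rule infsum_cong) (simp only: mult.left_commute[of _ "c _"] psi_add_period[OF assms])
  finally show "magnetic_translation (of_real \<gamma>) (synth h c) z = synth h c z" .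
qed

text \<open>On a ball of radius \<open>R\<close> the entire factor of mode \<open>n\<close> is at
  most a constant times \<open>gw h n * exp (2 * h * R * |n|)\<close>. The series therefore
  converges locally uniformly.\<close>

lemma synth_entire:
  assumes h: "0 < h" and c: "\<And>n. cmod (c n) \<le> C"
  shows "\<exists>f. f holomorphic_on UNIV \<and> (\<forall>z. synth h c z = of_real (exp (- (cmod z)\<^sup>2 / 2)) * f z)"
proof -
  define e where "e n z = exp (z\<^sup>2 / 2 + 2 * \<i> * of_real (h * of_int n) * z - of_real (h\<^sup>2 * (of_int n)\<^sup>2))" for n z
  define f where "f z = (\<Sum>\<^sub>\<infinity>n. c n * e n z)" for z
  have C0: "0 \<le> C" using order_trans[OF norm_ge_zero c[of 0]] .
  have "f holomorphic_on ball 0 R" if R: "0 < R" for R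
  proof -
    define M where "M n = C * exp (R\<^sup>2 / 2) * (gw h n * exp (2 * h * R * \<bar>of_int n\<bar>))" for n
    have M: "M summable_on UNIV" unfolding M_def[abs_def]
      by (intro summable_on_cmult_right summable_on_gw_exp h)
    have le: "norm (c n * e n z) \<le> M n" if z: "z \<in> cball 0 R" for n z
    proof -
      have zR: "cmod z \<le> R" using z by simp
      have "Re (z\<^sup>2) \<le> (cmod z)\<^sup>2" unfolding norm_power[symmetric] by (rule complex_Re_le_cmod)
      also have "\<dots> \<le> R\<^sup>2" using zR by (intro power_mono) auto
      finally have 1: "Re (z\<^sup>2) \<le> R\<^sup>2" .
      have "- (of_int n * Im z) \<le> \<bar>of_int n\<bar> * \<bar>Im z\<bar>"
        using abs_ge_minus_self[of "of_int n * Im z"] by (simp add: abs_mult)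
      also have "\<dots> \<le> \<bar>of_int n\<bar> * R" using abs_Im_le_cmod[of z] zR by (intro mult_left_mono) auto
      finally have "(2 * h) * (- (of_int n * Im z)) \<le> (2 * h) * (\<bar>of_int n\<bar> * R)"
        using h by (intro mult_left_mono) auto
      then have "Re (z\<^sup>2 / 2 + 2 * \<i> * of_real (h * of_int n) * z - of_real (h\<^sup>2 * (of_int n)\<^sup>2))
          \<le> R\<^sup>2 / 2 + (- (h\<^sup>2 * (of_int n)\<^sup>2) + 2 * h * R * \<bar>of_int n\<bar>)"
        using 1 by (simp add: algebra_simps)
      then have "cmod (e n z) \<le> exp (R\<^sup>2 / 2) * (gw h n * exp (2 * h * R * \<bar>of_int n\<bar>))"
        unfolding e_def norm_exp_eq_Re gw_def exp_add[symmetric] by (simp only: exp_le_cancel_iff)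
      then have "cmod (c n) * cmod (e n z) \<le> C * (exp (R\<^sup>2 / 2) * (gw h n * exp (2 * h * R * \<bar>of_int n\<bar>)))"
        using c[of n] C0 by (intro mult_mono) auto
      then show ?thesis by (simp add: norm_mult M_def mult.assoc)
    qed
    have ul: "uniform_limit (cball 0 R) (\<lambda>F z. \<Sum>n\<in>F. c n * e n z) f (finite_subsets_at_top UNIV)"
      unfolding f_def[abs_def] by (rule Weierstrass_m_test_general[OF le M])
    have hol: "\<forall>\<^sub>F F in finite_subsets_at_top UNIV. continuous_on (cball 0 R) (\<lambda>z. \<Sum>n\<in>F. c n * e n z)
        \<and> (\<lambda>z. \<Sum>n\<in>F. c n * e n z) holomorphic_on ball 0 R"
      unfolding e_def by (intro always_eventually allI conjI continuous_intros holomorphic_intros) auto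
    show ?thesis by (rule holomorphic_uniform_limit[OF hol ul]) auto
  qed
  then have "f field_differentiable (at z)" for z
    using holomorphic_on_imp_differentiable_at[of f "ball 0 (cmod z + 1)" z]
    by (simp add: add_nonneg_pos)
  then have "f holomorphic_on UNIV"
    by (simp add: holomorphic_on_def)
  moreover have "synth h c z = of_real (exp (- (cmod z)\<^sup>2 / 2)) * f z" for z
  proof -
    have "psi h n z = of_real (exp (- (cmod z)\<^sup>2 / 2)) * e n z" for n
      unfolding psi_def e_def exp_of_real[symmetric] exp_add[symmetric] by (rule arg_cong[where f=exp]) simp
    then have "synth h c z = (\<Sum>\<^sub>\<infinity>n. of_real (exp (- (cmod z)\<^sup>2 / 2)) * (c n * e n z))"
      unfolding synth_def by (simp add: mult_ac)
    also have "\<dots> = of_real (exp (- (cmod z)\<^sup>2 / 2)) * f z"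
      unfolding f_def by (rule infsum_cmult_right')
    finally show ?thesis .
  qed
  ultimately show ?thesis by blast
qed

lemma synth_in_F_space:
  assumes g: "0 < \<gamma>" "h = pi / \<gamma>" and c: "\<And>n. cmod (c n) \<le> C"
  shows "synth h c \<in> F_space \<gamma>"
proof -
  have h: "0 < h" using g by simp
  have "cmod (synth h c z) \<le> C * psi_bound h * japanese_bracket z powr 0" for z
  proof -
    \<comment> \<open>The function is bounded, so the exponent 0 will do; but
      \<open>x powr 0\<close> equals 1 only for \<open>x \<noteq> 0\<close>.\<close>
    have "0 < 1 + (cmod z)\<^sup>2" by (intro add_pos_nonneg) auto
    then have "japanese_bracket z \<noteq> 0" by (simp add: japanese_bracket_def)
    then show ?thesis using cmod_synth_le[of h c C z, OF h c] by simp
  qed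
  then have "\<exists>M C. \<forall>z. cmod (synth h c z) \<le> C * japanese_bracket z powr M"
    by (intro exI[of _ "0::real"] exI[of _ "C * psi_bound h"] allI)
  then show ?thesis
    unfolding F_space_def E_tilde_def mem_Collect_eq
    by (intro conjI synth_entire[of h c C, OF h c] magnetic_translation_synth[OF g])
qed

lemma continuous_on_F_space: 
  assumes "u \<in> F_space \<gamma>" shows "continuous_on UNIV u"
proof -
  obtain f where f: "f holomorphic_on UNIV" "\<And>z. u z = of_real (exp (- (cmod z)\<^sup>2 / 2)) * f z"
    using assms unfolding F_space_def E_tilde_def by blast
  have "continuous_on UNIV (\<lambda>z. of_real (exp (- (cmod z)\<^sup>2 / 2)) * f z)"
    by (intro continuous_intros holomorphic_on_imp_continuous_on f) auto
  then show ?thesis using f(2) by (simp add: continuous_on_cong[OF refl f(2)])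
qed

lemma borel_measurable_F_space: "u \<in> F_space \<gamma> \<Longrightarrow> u \<in> borel_measurable borel"
  by (rule borel_measurable_continuous_onI[OF continuous_on_F_space])

section \<open>Square integrability on the strip\<close>

lemma strip_borel [measurable]: "strip \<gamma> \<in> sets borel"
proof -
  have "strip \<gamma> = {z \<in> space borel. - \<gamma> / 2 < Re z \<and> Re z \<le> \<gamma> / 2}" by (simp add: strip_def)
  also have "\<dots> \<in> sets borel" by measurable
  finally show ?thesis .
qed

text \<open>The definitions integrate over the completed measure. For Borel functions this agrees
  with \<open>lborel\<close>, where Tonelli and Fubini are used.\<close>

lemma L2_on_borel_iff:
  assumes [measurable]: "u \<in> borel_measurable borel" "S \<in> sets borel"
  shows "u \<in> L2_on S \<longleftrightarrow> integrable lborel (\<lambda>z. indicator S z *\<^sub>R (cmod (u z))\<^sup>2)"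
proof -
  have 1: "(\<lambda>z. indicator S z *\<^sub>R u z) \<in> lborel \<rightarrow>\<^sub>M borel" by measurable
  have 2: "(\<lambda>z. indicator S z *\<^sub>R (cmod (u z))\<^sup>2) \<in> lborel \<rightarrow>\<^sub>M borel" by measurable
  show ?thesis
    unfolding L2_on_def set_borel_measurable_def set_integrable_def
    using measurable_completion[OF 1] integrable_completion[OF 2] by simp
qed

lemma L2_norm_on_borel:
  assumes [measurable]: "u \<in> borel_measurable borel" "S \<in> sets borel"
  shows "L2_norm_on S u = sqrt (LINT z|lborel. indicator S z *\<^sub>R (cmod (u z))\<^sup>2)"
  unfolding L2_norm_on_def set_lebesgue_integral_def by (subst integral_completion) auto

lemma nn_integral_exp_abs:
  assumes a: "0 < a"
  shows "(\<integral>\<^sup>+y. ennreal (exp (- (a * \<bar>y\<bar>))) \<partial>lborel) < \<infinity>"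
proof -
  let ?e = "exponential_density a"
  have 1: "(\<integral>\<^sup>+y. ennreal (?e y) \<partial>lborel) = 1"
    using prob_space.emeasure_space_1[OF prob_space_exponential_density[OF a]]
    by (simp add: emeasure_density)
  have 2: "(\<integral>\<^sup>+y. ennreal (?e (- y)) \<partial>lborel) = 1"
    using nn_integral_real_affine[of "\<lambda>y. ennreal (?e y)" "-1" 0] 1 by simp
  have "(\<integral>\<^sup>+y. ennreal (exp (- (a * \<bar>y\<bar>))) \<partial>lborel)
      \<le> (\<integral>\<^sup>+y. ennreal (1 / a) * (ennreal (?e y) + ennreal (?e (- y))) \<partial>lborel)"
  proof (rule nn_integral_mono)
    fix y :: real
    have "exp (- (a * \<bar>y\<bar>)) \<le> 1 / a * (?e y + ?e (- y))"
      using a by (simp add: exponential_density_def mult.commute)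
    also have "ennreal \<dots> = ennreal (1 / a) * (ennreal (?e y) + ennreal (?e (- y)))"
      using a by (subst ennreal_mult) (auto simp: exponential_density_nonneg ennreal_plus)
    finally show "ennreal (exp (- (a * \<bar>y\<bar>))) \<le> ennreal (1 / a) * (ennreal (?e y) + ennreal (?e (- y)))"
      by (simp add: ennreal_leI)
  qed
  also have "\<dots> = ennreal (1 / a) * (1 + 1)"
    by (simp add: nn_integral_cmult nn_integral_add 1 2)
  also have "\<dots> < \<infinity>" by (simp add: ennreal_mult_less_top)
  finally show ?thesis .
qed

lemma nn_integral_strip:
  assumes "0 < \<gamma>" and [measurable]: "g \<in> borel_measurable borel"
  shows "(\<integral>\<^sup>+z. indicator (strip \<gamma>) z * ennreal (g (Im z)) \<partial>lborel) = ennreal \<gamma> * (\<integral>\<^sup>+y. ennreal (g y) \<partial>lborel)"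
proof -
  have "(\<integral>\<^sup>+z. indicator (strip \<gamma>) z * ennreal (g (Im z)) \<partial>lborel)
      = (\<integral>\<^sup>+y. (\<integral>\<^sup>+x. indicator {- \<gamma> / 2<..\<gamma> / 2} x * ennreal (g y) \<partial>lborel) \<partial>lborel)"
    by (subst nn_integral_complex) (auto simp: strip_def indicator_def intro!: nn_integral_cong)
  also have "\<dots> = ennreal \<gamma> * (\<integral>\<^sup>+y. ennreal (g y) \<partial>lborel)"
    using assms(1) by (simp add: nn_integral_multc nn_integral_cmult)
  finally show ?thesis .
qed

lemma integrable_strip_exp:
  assumes "0 < \<gamma>" "0 < a"
  shows "integrable lborel (\<lambda>z. indicator (strip \<gamma>) z * exp (- (a * \<bar>Im z\<bar>)))"
proof (rule integrableI_nonneg)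
  have "(\<integral>\<^sup>+z. ennreal (indicator (strip \<gamma>) z * exp (- (a * \<bar>Im z\<bar>))) \<partial>lborel)
     = (\<integral>\<^sup>+z. indicator (strip \<gamma>) z * ennreal (exp (- (a * \<bar>Im z\<bar>))) \<partial>lborel)"
    by (intro nn_integral_cong) (simp add: indicator_def)
  also have "\<dots> < \<infinity>"
    using nn_integral_exp_abs[OF assms(2)]
    by (subst nn_integral_strip[OF assms(1)]) (auto simp: ennreal_mult_less_top)
  finally show "(\<integral>\<^sup>+z. ennreal (indicator (strip \<gamma>) z * exp (- (a * \<bar>Im z\<bar>))) \<partial>lborel) < \<infinity>" .
qed auto

text \<open>Mode \<open>n\<close> is concentrated near \<open>Im z = - h * n\<close>, so decay in
  \<open>n\<close> becomes decay in \<open>Im z\<close>. Half of \<open>k\<close> pays for the sum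
  over \<open>n\<close>, the other half for the rate \<open>\<delta>\<close>;
  \<open>\<delta> \<le> 1\<close> because the Gaussian is used only through
  \<open>exp (- |t|)\<close>.\<close>

lemma synth_decay:
  assumes h: "0 < h" and k: "0 < k"
  obtains M \<delta> where "0 \<le> M" "0 < \<delta>"
    "\<And>c B z. (\<And>n. cmod (c n) \<le> B * expw k n) \<Longrightarrow>
        (\<lambda>n. norm (c n * psi h n z)) summable_on UNIV \<and>
        (\<Sum>\<^sub>\<infinity>n. norm (c n * psi h n z)) \<le> B * (M * exp (- (\<delta> * \<bar>Im z\<bar>)))"
proof -
  define \<delta> where "\<delta> = min 1 (k / (2 * h))"
  define M where "M = exp (1/4) * (\<Sum>\<^sub>\<infinity>n. expw (k/2) n)"
  have d: "0 < \<delta>" "\<delta> \<le> 1" "\<delta> * h \<le> k / 2" using h k by (auto simp: \<delta>_def min_def field_simps)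
  have s: "expw (k/2) summable_on UNIV" using k by (intro summable_on_expw) simp
  have key: "expw k n * cmod (psi h n z) \<le> exp (1/4) * expw (k/2) n * exp (- (\<delta> * \<bar>Im z\<bar>))" for n z
  proof -
    define y where "y = Im z"
    have "0 \<le> (\<bar>y + h * of_int n\<bar> - 1/2)\<^sup>2" by simp
    then have 1: "\<bar>y + h * of_int n\<bar> \<le> (y + h * of_int n)\<^sup>2 + 1/4"
      by (simp add: power2_diff power2_abs) (simp add: power2_eq_square)
    have "\<bar>y\<bar> \<le> \<bar>y + h * of_int n\<bar> + \<bar>h * of_int n\<bar>" by linarith
    then have "\<delta> * \<bar>y\<bar> \<le> \<delta> * \<bar>y + h * of_int n\<bar> + \<delta> * \<bar>h * of_int n\<bar>"
      using d by (subst distrib_left[symmetric]) (intro mult_left_mono, auto)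
    moreover have "\<delta> * \<bar>y + h * of_int n\<bar> \<le> 1 * \<bar>y + h * of_int n\<bar>" using d by (intro mult_right_mono) auto
    moreover have "\<delta> * \<bar>h * of_int n\<bar> \<le> k / 2 * \<bar>of_int n\<bar>"
    proof -
      have "\<delta> * \<bar>h * of_int n\<bar> = \<delta> * h * \<bar>of_int n\<bar>" using h by (simp add: abs_mult)
      also have "\<dots> \<le> k / 2 * \<bar>of_int n\<bar>" using d by (intro mult_right_mono) auto
      finally show ?thesis .
    qed
    ultimately have "- (k * \<bar>of_int n\<bar>) + - (y + h * of_int n)\<^sup>2 \<le> 1/4 + - (k/2 * \<bar>of_int n\<bar>) + - (\<delta> * \<bar>y\<bar>)"
      using 1 by (simp add: field_simps)
    then show ?thesis
      unfolding expw_def cmod_psi y_def[symmetric] exp_add[symmetric] by (simp only: exp_le_cancel_iff)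
  qed
  show thesis
  proof (rule that[of M \<delta>])
    show "0 \<le> M" unfolding M_def by (intro mult_nonneg_nonneg infsum_nonneg) auto
    show "0 < \<delta>" by (rule d)
    fix c :: "int \<Rightarrow> complex" and B :: real and z
    assume c: "\<And>n. cmod (c n) \<le> B * expw k n"
    have B0: "0 \<le> B" using order_trans[OF norm_ge_zero c[of 0]] by (simp add: expw_def)
    let ?g = "\<lambda>n. B * (exp (1/4) * exp (- (\<delta> * \<bar>Im z\<bar>))) * expw (k/2) n"
    have le: "norm (c n * psi h n z) \<le> ?g n" for n
    proof -
      have "norm (c n * psi h n z) \<le> B * (expw k n * cmod (psi h n z))"
        using mult_right_mono[OF c[of n], of "cmod (psi h n z)"] by (simp add: norm_mult mult.assoc)
      also have "\<dots> \<le> B * (exp (1/4) * expw (k/2) n * exp (- (\<delta> * \<bar>Im z\<bar>)))"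
        by (intro mult_left_mono key B0)
      finally show ?thesis by (simp only: mult_ac)
    qed
    have sg: "?g summable_on UNIV" by (intro summable_on_cmult_right s)
    have sn: "(\<lambda>n. norm (c n * psi h n z)) summable_on UNIV"
      by (rule summable_on_comparison_test[OF sg le]) auto
    have "(\<Sum>\<^sub>\<infinity>n. norm (c n * psi h n z)) \<le> (\<Sum>\<^sub>\<infinity>n. ?g n)" by (rule infsum_mono[OF sn sg le])
    also have "\<dots> = B * (exp (1/4) * exp (- (\<delta> * \<bar>Im z\<bar>))) * (\<Sum>\<^sub>\<infinity>n. expw (k/2) n)"
      by (rule infsum_cmult_right')
    also have "\<dots> = B * (M * exp (- (\<delta> * \<bar>Im z\<bar>)))"
      by (simp only: M_def mult_ac)
    finally show "(\<lambda>n. norm (c n * psi h n z)) summable_on UNIV \<and>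
        (\<Sum>\<^sub>\<infinity>n. norm (c n * psi h n z)) \<le> B * (M * exp (- (\<delta> * \<bar>Im z\<bar>)))" using sn by blast
  qed
qed

text \<open>The constant \<open>K\<close> does not depend on the coefficients. This is what turns a
  derivative in the Banach space of coefficients into \<open>has_L2_time_derivative\<close>.\<close>

lemma synth_L2:
  assumes g: "0 < \<gamma>" "h = pi / \<gamma>" and k: "0 < k"
  obtains K where "0 \<le> K"
    "\<And>c B. (\<And>n. cmod (c n) \<le> B * expw k n) \<Longrightarrow> synth h c \<in> L2_on (strip \<gamma>) \<inter> F_space \<gamma>"
    "\<And>c B. (\<And>n. cmod (c n) \<le> B * expw k n) \<Longrightarrow> L2_norm_on (strip \<gamma>) (synth h c) \<le> K * B"
proof -
  have h: "0 < h" using g by simp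
  obtain M \<delta> where M: "0 \<le> M" "0 < \<delta>" and dec: "\<And>c B z. (\<And>n. cmod (c n) \<le> B * expw k n) \<Longrightarrow>
        (\<lambda>n. norm (c n * psi h n z)) summable_on UNIV \<and>
        (\<Sum>\<^sub>\<infinity>n. norm (c n * psi h n z)) \<le> B * (M * exp (- (\<delta> * \<bar>Im z\<bar>)))"
    by (rule synth_decay[OF h k]) blast
  define I where "I = (LINT z|lborel. indicator (strip \<gamma>) z * exp (- (2 * \<delta> * \<bar>Im z\<bar>)))"
  have I: "integrable lborel (\<lambda>z. indicator (strip \<gamma>) z * exp (- (2 * \<delta> * \<bar>Im z\<bar>)))"
    by (rule integrable_strip_exp) (use g M in auto)
  have I0: "0 \<le> I" unfolding I_def by (rule Bochner_Integration.integral_nonneg) auto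
  have F: "synth h c \<in> F_space \<gamma>" if c: "\<And>n. cmod (c n) \<le> B * expw k n" for c B
  proof (rule synth_in_F_space[OF g])
    have "0 \<le> B" using order_trans[OF norm_ge_zero c[of 0]] by (simp add: expw_def)
    then show "cmod (c n) \<le> B" for n
      using order_trans[OF c[of n] mult_left_le[OF expw_le_1]] k by simp
  qed
  have sq: "(cmod (synth h c z))\<^sup>2 \<le> (M * B)\<^sup>2 * exp (- (2 * \<delta> * \<bar>Im z\<bar>))"
    if c: "\<And>n. cmod (c n) \<le> B * expw k n" for c B z
  proof -
    have "cmod (synth h c z) \<le> B * (M * exp (- (\<delta> * \<bar>Im z\<bar>)))"
      unfolding synth_def using dec[OF c, of z] by (intro order_trans[OF norm_infsum_bound]) auto
    then have "(cmod (synth h c z))\<^sup>2 \<le> (B * (M * exp (- (\<delta> * \<bar>Im z\<bar>))))\<^sup>2" by (intro power_mono) auto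
    also have "\<dots> = (M * B)\<^sup>2 * (exp (- (\<delta> * \<bar>Im z\<bar>)))\<^sup>2" by (simp add: power_mult_distrib mult_ac)
    also have "(exp (- (\<delta> * \<bar>Im z\<bar>)))\<^sup>2 = exp (- (2 * \<delta> * \<bar>Im z\<bar>))"
      by (simp add: power2_eq_square exp_add[symmetric])
    finally show ?thesis .
  qed
  have le: "indicator (strip \<gamma>) z *\<^sub>R (cmod (synth h c z))\<^sup>2
        \<le> (M * B)\<^sup>2 * (indicator (strip \<gamma>) z * exp (- (2 * \<delta> * \<bar>Im z\<bar>)))"
    if c: "\<And>n. cmod (c n) \<le> B * expw k n" for c B z
    using sq[OF c, of z] by (auto simp: indicator_def)
  have int: "integrable lborel (\<lambda>z. indicator (strip \<gamma>) z *\<^sub>R (cmod (synth h c z))\<^sup>2)"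
    if c: "\<And>n. cmod (c n) \<le> B * expw k n" for c B
  proof (rule Bochner_Integration.integrable_bound[OF integrable_mult_right[OF I, of "(M * B)\<^sup>2"]])
    have [measurable]: "synth h c \<in> borel_measurable borel" by (rule borel_measurable_F_space[OF F[OF c]])
    show "(\<lambda>z. indicator (strip \<gamma>) z *\<^sub>R (cmod (synth h c z))\<^sup>2) \<in> borel_measurable lborel" by measurable
    show "AE z in lborel. norm (indicator (strip \<gamma>) z *\<^sub>R (cmod (synth h c z))\<^sup>2)
        \<le> norm ((M * B)\<^sup>2 * (indicator (strip \<gamma>) z * exp (- (2 * \<delta> * \<bar>Im z\<bar>))))"
      using le[OF c] by (intro AE_I2) (simp add: abs_mult)
  qed
  show thesis
  proof (rule that[of "M * sqrt I"])
    show "0 \<le> M * sqrt I" using M I0 by simp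
    fix c B assume c: "\<And>n. cmod (c n) \<le> B * expw k n"
    have mb: "synth h c \<in> borel_measurable borel" by (rule borel_measurable_F_space[OF F[OF c]])
    show "synth h c \<in> L2_on (strip \<gamma>) \<inter> F_space \<gamma>"
      using F[OF c] int[OF c] L2_on_borel_iff[OF mb strip_borel] by blast
    have B0: "0 \<le> B" using order_trans[OF norm_ge_zero c[of 0]] by (simp add: expw_def)
    have "(LINT z|lborel. indicator (strip \<gamma>) z *\<^sub>R (cmod (synth h c z))\<^sup>2)
        \<le> (LINT z|lborel. (M * B)\<^sup>2 * (indicator (strip \<gamma>) z * exp (- (2 * \<delta> * \<bar>Im z\<bar>))))"
      by (rule integral_mono[OF int[OF c] integrable_mult_right[OF I] le[OF c]])
    also have "\<dots> = (M * B)\<^sup>2 * I" unfolding I_def by (rule integral_mult_right_zero)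
    finally have "L2_norm_on (strip \<gamma>) (synth h c) \<le> sqrt ((M * B)\<^sup>2 * I)"
      unfolding L2_norm_on_borel[OF mb strip_borel] by (rule real_sqrt_le_mono)
    also have "\<dots> = M * sqrt I * B" using M B0 by (simp add: real_sqrt_mult mult_ac)
    finally show "L2_norm_on (strip \<gamma>) (synth h c) \<le> M * sqrt I * B" .
  qed
qed

lemma integral_period_exp:
  assumes g: "0 < \<gamma>" "h = pi / \<gamma>"
  shows "(LINT x|lborel. indicator {- \<gamma> / 2<..\<gamma> / 2} x *\<^sub>R exp (\<i> * of_real (2 * h * of_int m * x)))
    = (if m = 0 then of_real \<gamma> else 0)"
proof -
  let ?e = "\<lambda>x. exp (\<i> * of_real (2 * h * of_int m * x))"
  have "(LINT x|lborel. indicator {- \<gamma> / 2<..\<gamma> / 2} x *\<^sub>R ?e x) = (LINT x|lborel. indicator {- \<gamma> / 2..\<gamma> / 2} x *\<^sub>R ?e x)"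
  proof (rule integral_cong_AE)
    \<comment> \<open>Closing the half-open interval adds a null set and makes the fundamental
      theorem of calculus applicable.\<close>
    have "AE x in lborel. x \<noteq> - \<gamma> / 2" by (rule AE_lborel_singleton)
    then show "AE x in lborel. indicator {- \<gamma> / 2<..\<gamma> / 2} x *\<^sub>R ?e x = indicator {- \<gamma> / 2..\<gamma> / 2} x *\<^sub>R ?e x"
      by eventually_elim (auto simp: indicator_def)
    have [measurable]: "?e \<in> borel_measurable borel"
      by (intro borel_measurable_continuous_onI continuous_intros)
    show "(\<lambda>x. indicator {- \<gamma> / 2<..\<gamma> / 2} x *\<^sub>R ?e x) \<in> borel_measurable lborel"
      "(\<lambda>x. indicator {- \<gamma> / 2..\<gamma> / 2} x *\<^sub>R ?e x) \<in> borel_measurable lborel" by measurable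
  qed
  also have "\<dots> = (if m = 0 then of_real \<gamma> else 0)"
  proof (cases "m = 0")
    case True
    have "(LINT x|lborel. indicator {- \<gamma> / 2..\<gamma> / 2} x *\<^sub>R (1::complex)) = of_real \<gamma>"
      using g(1) by (subst integral_scaleR_left) (auto simp: scaleR_conv_of_real)
    then show ?thesis using True by simp
  next
    case False
    define \<omega> where "\<omega> = 2 * h * of_int m"
    have w: "\<omega> \<noteq> 0" using False g by (simp add: \<omega>_def)
    let ?F = "\<lambda>x. exp (\<i> * of_real (\<omega> * x)) / (\<i> * of_real \<omega>)"
    have "(LINT x|lborel. indicator {- \<gamma> / 2..\<gamma> / 2} x *\<^sub>R exp (\<i> * of_real (\<omega> * x))) = ?F (\<gamma> / 2) - ?F (- \<gamma> / 2)"
    proof (rule integral_FTC_Icc)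
      show "- \<gamma> / 2 \<le> \<gamma> / 2" using g by simp
      fix x :: real
      define G where "G w = exp (\<i> * (of_real \<omega> * w)) / (\<i> * of_real \<omega>)" for w
      have "(G has_field_derivative exp (\<i> * (of_real \<omega> * of_real x))) (at (of_real x))"
        unfolding G_def[abs_def] using w by (auto intro!: derivative_eq_intros simp: complex_eq_iff)
      from has_vector_derivative_real_field[OF this, of "{- \<gamma> / 2..\<gamma> / 2}"]
      show "(?F has_vector_derivative exp (\<i> * of_real (\<omega> * x))) (at x within {- \<gamma> / 2..\<gamma> / 2})"
        by (simp only: G_def of_real_mult)
    qed (intro continuous_intros)
    also have "exp (\<i> * of_real (\<omega> * (\<gamma> / 2))) = exp (\<i> * of_real (\<omega> * (- \<gamma> / 2)))"
    proof -
      have "\<omega> * (\<gamma> / 2) = \<omega> * (- \<gamma> / 2) + of_int m * (pi * 2)" using g by (simp add: \<omega>_def field_simps)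
      then have "\<i> * of_real (\<omega> * (\<gamma> / 2)) = \<i> * of_real (\<omega> * (- \<gamma> / 2)) + \<i> * (of_int m * (of_real pi * 2))"
        by (simp add: algebra_simps)
      then show ?thesis by (simp only: exp_plus_2pin)
    qed
    finally show ?thesis using False by (simp add: \<omega>_def)
  qed
  finally show ?thesis .
qed

text \<open>Over one period the frequencies \<open>2 * h * n\<close> are orthogonal. On the diagonal
  the factor \<open>\<gamma>\<close> is the width of the strip and \<open>sqrt (pi / 2)\<close> the
  integral of a translate of \<open>exp (- 2 * y^2)\<close>.\<close>

lemma psi_inner_strip:
  assumes g: "0 < \<gamma>" "h = pi / \<gamma>"
  shows "integrable lborel (\<lambda>z. indicator (strip \<gamma>) z *\<^sub>R (psi h n z * cnj (psi h m z)))"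
    and "(LINT z|lborel. indicator (strip \<gamma>) z *\<^sub>R (psi h n z * cnj (psi h m z)))
      = (if n = m then of_real (\<gamma> * sqrt (pi / 2)) else 0)"
proof -
  let ?f = "\<lambda>z. indicator (strip \<gamma>) z *\<^sub>R (psi h n z * cnj (psi h m z))"
  let ?E = "\<lambda>y. exp (- (y + h * of_int n)\<^sup>2) * exp (- (y + h * of_int m)\<^sup>2)"
  show int: "integrable lborel ?f"
  proof (rule integrableI_bounded)
    have [measurable]: "(\<lambda>z. cnj (psi h m z)) \<in> borel_measurable borel"
      by (intro borel_measurable_continuous_onI continuous_intros)
    show "?f \<in> borel_measurable lborel" by measurable
    have "(\<integral>\<^sup>+z. ennreal (norm (?f z)) \<partial>lborel)
        \<le> (\<integral>\<^sup>+z. indicator (strip \<gamma>) z * ennreal (exp (- (1 * (Im z - (- (h * of_int n)))\<^sup>2))) \<partial>lborel)"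
    proof (rule nn_integral_mono)
      fix z
      have "cmod (psi h n z * cnj (psi h m z)) \<le> exp (- (Im z + h * of_int n)\<^sup>2) * 1"
        unfolding norm_mult complex_mod_cnj cmod_psi by (intro mult_left_mono) auto
      then show "ennreal (norm (?f z)) \<le> indicator (strip \<gamma>) z * ennreal (exp (- (1 * (Im z - (- (h * of_int n)))\<^sup>2)))"
        by (auto simp: indicator_def intro!: ennreal_leI)
    qed
    also have "\<dots> < \<infinity>"
      by (subst nn_integral_strip[OF g(1)], measurable, subst nn_integral_gaussian)
         (simp_all add: ennreal_mult_less_top)
    finally show "(\<integral>\<^sup>+z. ennreal (norm (?f z)) \<partial>lborel) < \<infinity>" .
  qed
  have pt: "?f (Complex x y) = of_real (?E y) * (indicator {- \<gamma> / 2<..\<gamma> / 2} x *\<^sub>R exp (\<i> * of_real (2 * h * of_int (n - m) * x)))" for x y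
  proof -
    have "psi h n (Complex x y) * cnj (psi h m (Complex x y)) = of_real (?E y) *
       (exp (\<i> * of_real (x * y + 2 * (h * of_int n) * x)) * exp (- (\<i> * of_real (x * y + 2 * (h * of_int m) * x))))"
      by (simp add: psi_Complex exp_cnj mult_ac)
    also have "exp (\<i> * of_real (x * y + 2 * (h * of_int n) * x)) * exp (- (\<i> * of_real (x * y + 2 * (h * of_int m) * x)))
        = exp (\<i> * of_real (2 * h * of_int (n - m) * x))"
      unfolding exp_add[symmetric] by (rule arg_cong[where f=exp]) (simp add: algebra_simps)
    finally show ?thesis by (simp add: strip_def indicator_def)
  qed
  have "(LINT z|lborel. ?f z) = (LINT y|lborel. of_real (?E y) * (if n - m = 0 then of_real \<gamma> else 0))"
    by (simp only: integral_complex[OF int] pt integral_mult_right_zero integral_period_exp[OF g])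
  also have "\<dots> = (if n = m then of_real (\<gamma> * sqrt (pi / 2)) else 0)"
  proof (cases "n = m")
    case True
    have "?E y = exp (- (2 * (y - (- (h * of_int n)))\<^sup>2))" for y
      unfolding True exp_add[symmetric] by simp
    then have E: "(LINT y|lborel. ?E y) = sqrt (pi / 2)" by (simp only: integral_gaussian zero_less_numeral)
    have "(LINT y|lborel. of_real (?E y) * (if n - m = 0 then of_real \<gamma> else 0))
        = (LINT y|lborel. complex_of_real (?E y)) * of_real \<gamma>"
      using True by (simp only: integral_mult_left_zero diff_self if_True simp_thms)
    also have "(LINT y|lborel. complex_of_real (?E y)) = of_real (sqrt (pi / 2))"
      by (simp only: integral_complex_of_real E)
    finally show ?thesis using True by simp
  qed simp
  finally show "(LINT z|lborel. ?f z) = (if n = m then of_real (\<gamma> * sqrt (pi / 2)) else 0)" .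
qed

lemma synth_inner_psi:
  assumes g: "0 < \<gamma>" "h = pi / \<gamma>" and k: "0 < k" and c: "\<And>n. cmod (c n) \<le> B * expw k n"
  shows "integrable lborel (\<lambda>z. indicator (strip \<gamma>) z *\<^sub>R (synth h c z * cnj (psi h m z)))"
    and "(LINT z|lborel. indicator (strip \<gamma>) z *\<^sub>R (synth h c z * cnj (psi h m z))) = of_real (\<gamma> * sqrt (pi / 2)) * c m"
proof -
  have h: "0 < h" using g by simp
  obtain M \<delta> where M: "0 \<le> M" "0 < \<delta>" and dec: "\<And>c B z. (\<And>n. cmod (c n) \<le> B * expw k n) \<Longrightarrow>
        (\<lambda>n. norm (c n * psi h n z)) summable_on UNIV \<and>
        (\<Sum>\<^sub>\<infinity>n. norm (c n * psi h n z)) \<le> B * (M * exp (- (\<delta> * \<bar>Im z\<bar>)))"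
    by (rule synth_decay[OF h k]) blast
  define f where "f n z = c n * (indicator (strip \<gamma>) z *\<^sub>R (psi h n z * cnj (psi h m z)))" for n z
  define D where "D z = B * M * (indicator (strip \<gamma>) z * exp (- (\<delta> * \<bar>Im z\<bar>)))" for z
  have fm: "f n \<in> borel_measurable lborel" for n
    unfolding f_def[abs_def] by (intro borel_measurable_integrable integrable_mult_right psi_inner_strip(1)[OF g])
  have D: "integrable lborel D" unfolding D_def[abs_def]
    by (intro integrable_mult_right integrable_strip_exp g M)
  have bound: "(\<Sum>n\<in>F. norm (f n z)) \<le> D z" if "finite F" for F z
  proof (cases "z \<in> strip \<gamma>")
    case True
    have "(\<Sum>n\<in>F. norm (f n z)) \<le> (\<Sum>n\<in>F. norm (c n * psi h n z))"
      using True by (intro sum_mono) (auto simp: f_def norm_mult cmod_psi mult.assoc[symmetric] intro!: mult_left_le)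
    also have "\<dots> \<le> (\<Sum>\<^sub>\<infinity>n. norm (c n * psi h n z))"
      using dec[OF c, of z] that by (intro finite_sum_le_infsum) auto
    also have "\<dots> \<le> D z" using dec[OF c, of z] True by (simp add: D_def mult.assoc)
    finally show ?thesis .
  qed (simp add: f_def D_def)
  note dom = has_sum_integral_dominated[OF fm D bound]
  have eq: "(\<Sum>\<^sub>\<infinity>n. f n z) = indicator (strip \<gamma>) z *\<^sub>R (synth h c z * cnj (psi h m z))" for z
  proof -
    have "f n z = c n * psi h n z * (of_real (indicator (strip \<gamma>) z) * cnj (psi h m z))" for n
      by (simp add: f_def scaleR_conv_of_real)
    then have "(\<Sum>\<^sub>\<infinity>n. f n z) = synth h c z * (of_real (indicator (strip \<gamma>) z) * cnj (psi h m z))"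
      by (simp only: infsum_cmult_left' synth_def)
    then show ?thesis by (simp add: scaleR_conv_of_real)
  qed
  show "integrable lborel (\<lambda>z. indicator (strip \<gamma>) z *\<^sub>R (synth h c z * cnj (psi h m z)))"
    using dom(1) by (simp only: eq)
  have "((\<lambda>n. LINT z|lborel. f n z) has_sum (LINT z|lborel. indicator (strip \<gamma>) z *\<^sub>R (synth h c z * cnj (psi h m z)))) UNIV"
    using dom(2) by (simp only: eq)
  moreover have "(LINT z|lborel. f n z) = (if n = m then of_real (\<gamma> * sqrt (pi / 2)) * c m else 0)" for n
    unfolding f_def integral_mult_right_zero psi_inner_strip(2)[OF g] by simp
  moreover have "((\<lambda>n. if n = m then of_real (\<gamma> * sqrt (pi / 2)) * c m else 0) has_sum (of_real (\<gamma> * sqrt (pi / 2)) * c m)) UNIV"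
    by (rule has_sum_finite_neutralI[of "{m}"]) auto
  ultimately show "(LINT z|lborel. indicator (strip \<gamma>) z *\<^sub>R (synth h c z * cnj (psi h m z))) = of_real (\<gamma> * sqrt (pi / 2)) * c m"
    by (simp add: has_sum_unique)
qed

text \<open>Bessel's inequality for the orthogonal system \<open>psi h n\<close> on the strip.\<close>

lemma synth_L2_lower_bound:
  assumes g: "0 < \<gamma>" "h = pi / \<gamma>" and k: "0 < k" and c: "\<And>n. cmod (c n) \<le> B * expw k n"
  shows "(\<gamma> * sqrt (pi / 2)) * (\<Sum>\<^sub>\<infinity>n. (cmod (c n))\<^sup>2) \<le> (L2_norm_on (strip \<gamma>) (synth h c))\<^sup>2"
proof -
  define \<kappa> where "\<kappa> = \<gamma> * sqrt (pi / 2)"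
  define u where "u = synth h c"
  define J where "J = (LINT z|lborel. indicator (strip \<gamma>) z *\<^sub>R (cmod (u z))\<^sup>2)"
  have kap: "0 < \<kappa>" using g by (simp add: \<kappa>_def)
  have h: "0 < h" using g by simp
  obtain K where L2: "\<And>c B. (\<And>n. cmod (c n) \<le> B * expw k n) \<Longrightarrow> synth h c \<in> L2_on (strip \<gamma>) \<inter> F_space \<gamma>"
    by (rule synth_L2[OF g k]) blast
  have u: "u \<in> L2_on (strip \<gamma>)" "u \<in> F_space \<gamma>" using L2[OF c] by (auto simp: u_def)
  have mb: "u \<in> borel_measurable borel" by (rule borel_measurable_F_space[OF u(2)])
  have intu: "integrable lborel (\<lambda>z. indicator (strip \<gamma>) z *\<^sub>R (cmod (u z))\<^sup>2)"
    using u(1) L2_on_borel_iff[OF mb strip_borel] by blast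
  have J: "J = (L2_norm_on (strip \<gamma>) u)\<^sup>2"
    unfolding L2_norm_on_borel[OF mb strip_borel] J_def by (subst real_sqrt_pow2) (auto intro!: Bochner_Integration.integral_nonneg)
  have fin: "\<kappa> * (\<Sum>n\<in>F. (cmod (c n))\<^sup>2) \<le> J" if F: "finite F" for F
  proof -
    \<comment> \<open>Expanding the nonnegative integral of \<open>|u - p|^2\<close> gives
      \<open>J - 2 * S + S\<close>, where \<open>S\<close> is the common value found in
      \<open>e1\<close> and \<open>e2\<close>.\<close>
    define p where "p z = (\<Sum>n\<in>F. c n * psi h n z)" for z
    have i1: "integrable lborel (\<lambda>z. indicator (strip \<gamma>) z *\<^sub>R (u z * cnj (p z)))"
      and e1: "(LINT z|lborel. indicator (strip \<gamma>) z *\<^sub>R (u z * cnj (p z))) = of_real (\<kappa> * (\<Sum>n\<in>F. (cmod (c n))\<^sup>2))"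
    proof -
      have eq: "indicator (strip \<gamma>) z *\<^sub>R (u z * cnj (p z)) = (\<Sum>n\<in>F. cnj (c n) * (indicator (strip \<gamma>) z *\<^sub>R (u z * cnj (psi h n z))))" for z
        by (simp add: p_def cnj_sum sum_distrib_left scaleR_sum_right scaleR_conv_of_real mult_ac)
      show "integrable lborel (\<lambda>z. indicator (strip \<gamma>) z *\<^sub>R (u z * cnj (p z)))"
        unfolding eq unfolding u_def by (intro Bochner_Integration.integrable_sum integrable_mult_right synth_inner_psi(1)[OF g k c])
      have "(LINT z|lborel. indicator (strip \<gamma>) z *\<^sub>R (u z * cnj (p z)))
          = (\<Sum>n\<in>F. cnj (c n) * (of_real \<kappa> * c n))"
        unfolding eq unfolding u_def
        by (subst Bochner_Integration.integral_sum, intro integrable_mult_right synth_inner_psi(1)[OF g k c])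
           (simp only: integral_mult_right_zero synth_inner_psi(2)[OF g k c] \<kappa>_def)
      also have "\<dots> = of_real (\<kappa> * (\<Sum>n\<in>F. (cmod (c n))\<^sup>2))"
        by (simp add: complex_norm_square sum_distrib_left mult_ac del: of_real_power)
      finally show "(LINT z|lborel. indicator (strip \<gamma>) z *\<^sub>R (u z * cnj (p z))) = of_real (\<kappa> * (\<Sum>n\<in>F. (cmod (c n))\<^sup>2))" .
    qed
    have i2: "integrable lborel (\<lambda>z. indicator (strip \<gamma>) z *\<^sub>R (p z * cnj (p z)))"
      and e2: "(LINT z|lborel. indicator (strip \<gamma>) z *\<^sub>R (p z * cnj (p z))) = of_real (\<kappa> * (\<Sum>n\<in>F. (cmod (c n))\<^sup>2))"
    proof -
      have eq: "indicator (strip \<gamma>) z *\<^sub>R (p z * cnj (p z)) = (\<Sum>n\<in>F. \<Sum>m\<in>F. c n * cnj (c m) * (indicator (strip \<gamma>) z *\<^sub>R (psi h n z * cnj (psi h m z))))" for z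
        unfolding p_def cnj_sum sum_product scaleR_sum_right by (simp add: scaleR_conv_of_real mult_ac)
      show "integrable lborel (\<lambda>z. indicator (strip \<gamma>) z *\<^sub>R (p z * cnj (p z)))"
        unfolding eq by (intro Bochner_Integration.integrable_sum integrable_mult_right psi_inner_strip(1)[OF g])
      have "(LINT z|lborel. indicator (strip \<gamma>) z *\<^sub>R (p z * cnj (p z)))
          = (\<Sum>n\<in>F. \<Sum>m\<in>F. c n * cnj (c m) * (if n = m then of_real \<kappa> else 0))"
        unfolding eq
        by (subst Bochner_Integration.integral_sum, intro Bochner_Integration.integrable_sum integrable_mult_right psi_inner_strip(1)[OF g],
            subst Bochner_Integration.integral_sum, intro integrable_mult_right psi_inner_strip(1)[OF g])
           (simp only: integral_mult_right_zero psi_inner_strip(2)[OF g] \<kappa>_def)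
      also have "\<dots> = (\<Sum>n\<in>F. c n * cnj (c n) * of_real \<kappa>)"
        using F by (intro sum.cong refl) (simp add: if_distrib sum.delta cong: if_cong)
      also have "\<dots> = of_real (\<kappa> * (\<Sum>n\<in>F. (cmod (c n))\<^sup>2))"
        by (simp add: complex_norm_square sum_distrib_left mult_ac del: of_real_power)
      finally show "(LINT z|lborel. indicator (strip \<gamma>) z *\<^sub>R (p z * cnj (p z))) = of_real (\<kappa> * (\<Sum>n\<in>F. (cmod (c n))\<^sup>2))" .
    qed
    have "0 \<le> (LINT z|lborel. indicator (strip \<gamma>) z *\<^sub>R (cmod (u z - p z))\<^sup>2)"
      by (rule Bochner_Integration.integral_nonneg) auto
    also have "\<dots> = (LINT z|lborel. indicator (strip \<gamma>) z *\<^sub>R (cmod (u z))\<^sup>2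
        - 2 * Re (indicator (strip \<gamma>) z *\<^sub>R (u z * cnj (p z))) + Re (indicator (strip \<gamma>) z *\<^sub>R (p z * cnj (p z))))"
    proof (rule Bochner_Integration.integral_cong[OF refl])
      fix z
      have "(cmod (u z - p z))\<^sup>2 = (cmod (u z))\<^sup>2 - 2 * Re (u z * cnj (p z)) + Re (p z * cnj (p z))"
        unfolding cmod_power2 by (simp add: power2_eq_square algebra_simps)
      then show "indicator (strip \<gamma>) z *\<^sub>R (cmod (u z - p z))\<^sup>2 = indicator (strip \<gamma>) z *\<^sub>R (cmod (u z))\<^sup>2
        - 2 * Re (indicator (strip \<gamma>) z *\<^sub>R (u z * cnj (p z))) + Re (indicator (strip \<gamma>) z *\<^sub>R (p z * cnj (p z)))"
        by (auto simp: indicator_def)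
    qed
    also have "\<dots> = J - 2 * Re (LINT z|lborel. indicator (strip \<gamma>) z *\<^sub>R (u z * cnj (p z)))
        + Re (LINT z|lborel. indicator (strip \<gamma>) z *\<^sub>R (p z * cnj (p z)))"
      unfolding J_def integral_Re[OF i1, symmetric] integral_Re[OF i2, symmetric]
      by (subst Bochner_Integration.integral_add, intro Bochner_Integration.integrable_diff intu integrable_mult_right integrable_Re i1,
          intro integrable_Re i2, subst Bochner_Integration.integral_diff, rule intu, intro integrable_mult_right integrable_Re i1)
         (simp only: integral_mult_right_zero)
    finally show ?thesis unfolding e1 e2 by simp
  qed
  have "(\<Sum>\<^sub>\<infinity>n. (cmod (c n))\<^sup>2) \<le> J / \<kappa>"
  proof (rule infsum_le_finite_sums)
    show "(\<lambda>n. (cmod (c n))\<^sup>2) summable_on UNIV"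
    proof (rule nonneg_bdd_above_summable_on)
      show "bdd_above (sum (\<lambda>n. (cmod (c n))\<^sup>2) ` {F. F \<subseteq> UNIV \<and> finite F})"
        using fin kap by (intro bdd_aboveI2[of _ _ "J / \<kappa>"]) (auto simp: field_simps)
    qed simp
    show "(\<Sum>n\<in>F. (cmod (c n))\<^sup>2) \<le> J / \<kappa>" if "finite F" for F
      using fin[OF that] kap by (simp add: field_simps)
  qed
  then have "\<kappa> * (\<Sum>\<^sub>\<infinity>n. (cmod (c n))\<^sup>2) \<le> J" using kap by (simp add: field_simps)
  then show ?thesis by (simp only: J \<kappa>_def u_def)
qed


section \<open>Uniqueness of solutions\<close>

text \<open>The modulus of the projection kernel once its weight is cancelled. It depends on
  \<open>w - z\<close> only and has mass \<open>2 * pi\<close>.\<close>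

definition gk :: "complex \<Rightarrow> complex \<Rightarrow> real" where
  "gk z w = exp (- (1/2 * (cmod (w - z))\<^sup>2))"

lemma gk_nonneg [simp]: "0 \<le> gk z w"
  by (simp add: gk_def)

lemma borel_measurable_gk [measurable]: "gk z \<in> borel_measurable borel"
  unfolding gk_def[abs_def] by (intro borel_measurable_continuous_onI continuous_intros)

lemma has_integral_gk: "integrable lborel (gk z)" "(LINT w|lborel. gk z w) = 2 * pi"
proof -
  show "integrable lborel (gk z)"
    unfolding gk_def[abs_def] by (rule integrable_gaussian_complex) simp
  have "(LINT w|lborel. gk z w) = enn2real (\<integral>\<^sup>+w. ennreal (gk z w) \<partial>lborel)"
    by (rule integral_eq_nn_integral) auto
  also have "(\<integral>\<^sup>+w. ennreal (gk z w) \<partial>lborel) = ennreal (2 * pi)"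
    unfolding gk_def by (subst nn_integral_gaussian_complex) simp_all
  finally show "(LINT w|lborel. gk z w) = 2 * pi" by simp
qed

text \<open>A class containing \<open>F_space\<close> and stable under bounded multipliers. The rate
  \<open>1/16\<close> leaves room in the estimates: squared it is \<open>1/8\<close>, and after
  \<open>|w|^2 \<le> 2 |w - z|^2 + 2 |z|^2\<close> half of the Gaussian \<open>gk\<close>
  survives.\<close>

definition gauss_growth :: "(complex \<Rightarrow> complex) \<Rightarrow> bool" where
  "gauss_growth u \<longleftrightarrow> u \<in> borel_measurable borel \<and> (\<exists>D. \<forall>w. cmod (u w) \<le> D * exp ((cmod w)\<^sup>2 / 16))"

lemma gauss_growth_measurable [measurable_dest]: "gauss_growth u \<Longrightarrow> u \<in> borel_measurable borel"
  by (simp add: gauss_growth_def)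

lemma gauss_growth_comparison:
  assumes "gauss_growth u" "v \<in> borel_measurable borel" "\<And>w. cmod (v w) \<le> A * cmod (u w)"
  shows "gauss_growth v"
proof -
  obtain D where D: "\<And>w. cmod (u w) \<le> D * exp ((cmod w)\<^sup>2 / 16)"
    using assms(1) unfolding gauss_growth_def by blast
  have "cmod (v w) \<le> \<bar>A\<bar> * D * exp ((cmod w)\<^sup>2 / 16)" for w
  proof -
    have "cmod (v w) \<le> \<bar>A\<bar> * cmod (u w)"
      using assms(3)[of w] by (rule order_trans) (intro mult_right_mono, auto)
    also have "\<dots> \<le> \<bar>A\<bar> * (D * exp ((cmod w)\<^sup>2 / 16))" by (intro mult_left_mono D) auto
    finally show ?thesis by (simp add: mult.assoc)
  qed
  then show ?thesis using assms(2) unfolding gauss_growth_def by blast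
qed

lemma gauss_growth_diff:
  assumes u: "gauss_growth u" and v: "gauss_growth v"
  shows "gauss_growth (\<lambda>z. u z - v z)"
proof -
  obtain D E where D: "\<And>w. cmod (u w) \<le> D * exp ((cmod w)\<^sup>2 / 16)"
    and E: "\<And>w. cmod (v w) \<le> E * exp ((cmod w)\<^sup>2 / 16)"
    using u v unfolding gauss_growth_def by blast
  have "cmod (u w - v w) \<le> (D + E) * exp ((cmod w)\<^sup>2 / 16)" for w
    using norm_triangle_ineq4[of "u w" "v w"] D[of w] E[of w] by (simp add: distrib_right)
  moreover have "(\<lambda>z. u z - v z) \<in> borel_measurable borel"
    using u v by (intro borel_measurable_diff gauss_growth_measurable)
  ultimately show ?thesis unfolding gauss_growth_def by blast
qed

lemma gauss_growth_F_space:
  assumes "u \<in> F_space \<gamma>"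
  shows "gauss_growth u"
proof -
  obtain M C where MC: "\<And>z. cmod (u z) \<le> C * japanese_bracket z powr M"
    using assms unfolding F_space_def E_tilde_def by blast
  \<comment> \<open>An exponent of at least 1 is a legal divisor: \<open>ln s \<le> s - 1\<close> at
    \<open>s = x / (16 * m)\<close> trades the power of \<open>x\<close> for
    \<open>exp (x / 16)\<close>.\<close>
  define m where "m = max (M / 2) 1"
  have m: "1 \<le> m" "M / 2 \<le> m" by (auto simp: m_def)
  have "japanese_bracket z powr M \<le> exp (1/16 + m * ln (16 * m)) * exp ((cmod z)\<^sup>2 / 16)" for z
  proof -
    define x where "x = 1 + (cmod z)\<^sup>2"
    have x: "1 \<le> x" by (simp add: x_def)
    have "japanese_bracket z powr M = x powr (M / 2)"
      using x by (simp add: japanese_bracket_def x_def[symmetric] powr_half_sqrt[symmetric] powr_powr)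
    also have "\<dots> \<le> x powr m" using x m by (intro powr_mono)
    also have "\<dots> = exp (m * ln x)" using x by (simp add: powr_def)
    also have "\<dots> \<le> exp (x / 16 + m * ln (16 * m))"
    proof -
      have "ln (x / (16 * m)) \<le> x / (16 * m) - 1" using x m by (intro ln_le_minus_one) auto
      then have "ln x \<le> x / (16 * m) + ln (16 * m)" using x m by (simp add: ln_div)
      then have "m * ln x \<le> m * (x / (16 * m) + ln (16 * m))" using m by (intro mult_left_mono) auto
      also have "\<dots> = x / 16 + m * ln (16 * m)" using m by (simp add: field_simps)
      finally show ?thesis by simp
    qed
    also have "\<dots> = exp (1/16 + m * ln (16 * m)) * exp ((cmod z)\<^sup>2 / 16)"
      by (simp add: x_def exp_add[symmetric] add_divide_distrib)
    finally show ?thesis .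
  qed
  note jb = this
  have "cmod (u z) \<le> \<bar>C\<bar> * exp (1/16 + m * ln (16 * m)) * exp ((cmod z)\<^sup>2 / 16)" for z
  proof -
    have "cmod (u z) \<le> \<bar>C\<bar> * japanese_bracket z powr M"
      using MC[of z] by (rule order_trans) (intro mult_right_mono, auto)
    also have "\<dots> \<le> \<bar>C\<bar> * (exp (1/16 + m * ln (16 * m)) * exp ((cmod z)\<^sup>2 / 16))"
      by (intro mult_left_mono jb) auto
    finally show ?thesis by (simp add: mult.assoc)
  qed
  then show ?thesis
    unfolding gauss_growth_def using borel_measurable_F_space[OF assms] by blast
qed

lemma gauss_growth_integrable:
  assumes u: "gauss_growth u"
  shows "integrable lborel (\<lambda>w. gk z w * (cmod (u w))\<^sup>2)"
    and "integrable lborel (\<lambda>w. gk z w * cmod (u w))"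
    and "integrable lborel (\<lambda>w. exp (cnj w * z - of_real ((cmod w)\<^sup>2 / 2)) * u w)"
proof -
  have [measurable]: "u \<in> borel_measurable borel" using u by (simp add: gauss_growth_def)
  obtain D where D: "\<And>w. cmod (u w) \<le> D * exp ((cmod w)\<^sup>2 / 16)"
    using u unfolding gauss_growth_def by blast
  have sq: "(cmod (u w))\<^sup>2 \<le> D\<^sup>2 * exp ((cmod w)\<^sup>2 / 8)" for w
  proof -
    have "(cmod (u w))\<^sup>2 \<le> (D * exp ((cmod w)\<^sup>2 / 16))\<^sup>2" by (intro power_mono D) auto
    also have "\<dots> = D\<^sup>2 * exp ((cmod w)\<^sup>2 / 8)"
      by (simp add: power_mult_distrib power2_eq_square[of "exp _"] exp_add[symmetric])
    finally show ?thesis .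
  qed
  have gauss: "gk z w * exp ((cmod w)\<^sup>2 / 8) \<le> exp ((cmod z)\<^sup>2 / 4) * exp (- (1/4 * (cmod (w - z))\<^sup>2))" for w
  proof -
    have "cmod w \<le> cmod (w - z) + cmod z" using norm_triangle_sub by (metis add.commute)
    then have "(cmod w)\<^sup>2 \<le> (cmod (w - z) + cmod z)\<^sup>2" by (intro power_mono) auto
    also have "\<dots> \<le> 2 * (cmod (w - z))\<^sup>2 + 2 * (cmod z)\<^sup>2"
      using sum_squares_bound[of "cmod (w - z)" "cmod z"] by (simp add: power2_sum)
    finally show ?thesis unfolding gk_def exp_add[symmetric] by simp
  qed
  have dom: "integrable lborel (\<lambda>w. D\<^sup>2 * (exp ((cmod z)\<^sup>2 / 4) * exp (- (1/4 * (cmod (w - z))\<^sup>2))))"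
    by (intro integrable_mult_right integrable_gaussian_complex) simp
  show i2: "integrable lborel (\<lambda>w. gk z w * (cmod (u w))\<^sup>2)"
  proof (rule Bochner_Integration.integrable_bound[OF dom])
    show "AE w in lborel. norm (gk z w * (cmod (u w))\<^sup>2) \<le> norm (D\<^sup>2 * (exp ((cmod z)\<^sup>2 / 4) * exp (- (1/4 * (cmod (w - z))\<^sup>2))))"
    proof (rule AE_I2)
      fix w
      have "gk z w * (cmod (u w))\<^sup>2 \<le> gk z w * (D\<^sup>2 * exp ((cmod w)\<^sup>2 / 8))"
        by (intro mult_left_mono sq) auto
      also have "\<dots> = D\<^sup>2 * (gk z w * exp ((cmod w)\<^sup>2 / 8))" by simp
      also have "\<dots> \<le> D\<^sup>2 * (exp ((cmod z)\<^sup>2 / 4) * exp (- (1/4 * (cmod (w - z))\<^sup>2)))"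
        by (intro mult_left_mono gauss) auto
      finally show "norm (gk z w * (cmod (u w))\<^sup>2) \<le> norm (D\<^sup>2 * (exp ((cmod z)\<^sup>2 / 4) * exp (- (1/4 * (cmod (w - z))\<^sup>2))))"
        by (simp add: abs_mult)
    qed
  qed measurable
  show i1: "integrable lborel (\<lambda>w. gk z w * cmod (u w))"
  proof (rule Bochner_Integration.integrable_bound[OF Bochner_Integration.integrable_add[OF has_integral_gk(1)[of z] i2]])
    show "AE w in lborel. norm (gk z w * cmod (u w)) \<le> norm (gk z w + gk z w * (cmod (u w))\<^sup>2)"
    proof (rule AE_I2)
      fix w
      have "0 \<le> (cmod (u w) - 1)\<^sup>2" by simp
      then have "2 * cmod (u w) \<le> 1 + (cmod (u w))\<^sup>2" by (simp add: power2_diff)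
      then have "cmod (u w) \<le> 1 + (cmod (u w))\<^sup>2" using norm_ge_zero[of "u w"] by linarith
      then have "gk z w * cmod (u w) \<le> gk z w * (1 + (cmod (u w))\<^sup>2)" by (intro mult_left_mono) auto
      then show "norm (gk z w * cmod (u w)) \<le> norm (gk z w + gk z w * (cmod (u w))\<^sup>2)"
        by (simp add: abs_mult distrib_left)
    qed
  qed measurable
  show "integrable lborel (\<lambda>w. exp (cnj w * z - of_real ((cmod w)\<^sup>2 / 2)) * u w)"
  proof (rule Bochner_Integration.integrable_bound[OF integrable_mult_right[OF i1, of "exp ((cmod z)\<^sup>2 / 2)"]])
    have "(\<lambda>w. exp (cnj w * z - of_real ((cmod w)\<^sup>2 / 2))) \<in> borel_measurable borel"
      by (intro borel_measurable_continuous_onI continuous_intros) auto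
    then show "(\<lambda>w. exp (cnj w * z - of_real ((cmod w)\<^sup>2 / 2)) * u w) \<in> borel_measurable lborel" by measurable
    show "AE w in lborel. norm (exp (cnj w * z - of_real ((cmod w)\<^sup>2 / 2)) * u w) \<le> norm (exp ((cmod z)\<^sup>2 / 2) * (gk z w * cmod (u w)))"
      by (intro AE_I2) (simp only: norm_mult norm_bargmann_kernel, simp add: gk_def mult.assoc)
  qed
qed

lemma bargmann_proj_lborel:
  assumes "gauss_growth u"
  shows "bargmann_proj u z = of_real (1 / pi) * of_real (exp (- (cmod z)\<^sup>2 / 2)) *
     (LINT w|lborel. exp (cnj w * z - of_real ((cmod w)\<^sup>2 / 2)) * u w)"
  unfolding bargmann_proj_def
  by (subst integral_completion[OF borel_measurable_integrable[OF gauss_growth_integrable(3)[OF assms]]]) simp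

lemma bargmann_proj_diff:
  assumes "gauss_growth u" "gauss_growth v"
  shows "bargmann_proj (\<lambda>w. u w - v w) z = bargmann_proj u z - bargmann_proj v z"
  unfolding bargmann_proj_lborel[OF assms(1)] bargmann_proj_lborel[OF assms(2)]
    bargmann_proj_lborel[OF gauss_growth_diff[OF assms]]
  by (simp only: right_diff_distrib[of "exp _"]
      Bochner_Integration.integral_diff[OF gauss_growth_integrable(3)[OF assms(1)] gauss_growth_integrable(3)[OF assms(2)]]
      right_diff_distrib[of "_ * _"])

lemma cmod_bargmann_proj_le:
  assumes u: "gauss_growth u"
  shows "cmod (bargmann_proj u z) \<le> 1 / pi * (LINT w|lborel. gk z w * cmod (u w))"
proof -
  have "cmod (LINT w|lborel. exp (cnj w * z - of_real ((cmod w)\<^sup>2 / 2)) * u w)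
      \<le> (LINT w|lborel. norm (exp (cnj w * z - of_real ((cmod w)\<^sup>2 / 2)) * u w))"
    by (rule integral_norm_bound)
  also have "\<dots> = (LINT w|lborel. exp ((cmod z)\<^sup>2 / 2) * (gk z w * cmod (u w)))"
    by (simp only: norm_mult norm_bargmann_kernel gk_def mult.assoc)
  also have "\<dots> = exp ((cmod z)\<^sup>2 / 2) * (LINT w|lborel. gk z w * cmod (u w))"
    by (rule integral_mult_right_zero)
  finally have "cmod (bargmann_proj u z) \<le> (1 / pi * exp (- (cmod z)\<^sup>2 / 2)) *
      (exp ((cmod z)\<^sup>2 / 2) * (LINT w|lborel. gk z w * cmod (u w)))"
    unfolding bargmann_proj_lborel[OF u] norm_mult norm_of_real by (simp add: mult_left_mono divide_right_mono)
  also have "\<dots> = 1 / pi * (exp (- (cmod z)\<^sup>2 / 2) * exp ((cmod z)\<^sup>2 / 2)) * (LINT w|lborel. gk z w * cmod (u w))"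
    by simp
  also have "exp (- (cmod z)\<^sup>2 / 2) * exp ((cmod z)\<^sup>2 / 2) = 1"
    by (simp add: exp_add[symmetric])
  finally show ?thesis by simp
qed

text \<open>Cauchy-Schwarz for a measure of mass \<open>2 * pi\<close>, in the form that a variance
  is nonnegative; \<open>m\<close> is the mean of \<open>|u|\<close>.\<close>

lemma gk_cauchy_schwarz:
  assumes u: "gauss_growth u"
  shows "(LINT w|lborel. gk z w * cmod (u w))\<^sup>2 \<le> 2 * pi * (LINT w|lborel. gk z w * (cmod (u w))\<^sup>2)"
proof -
  define I where "I = (LINT w|lborel. gk z w * cmod (u w))"
  define J where "J = (LINT w|lborel. gk z w * (cmod (u w))\<^sup>2)"
  define m where "m = I / (2 * pi)"
  note i = gauss_growth_integrable(1,2)[OF u, of z] has_integral_gk(1)[of z]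
  have "0 \<le> (LINT w|lborel. gk z w * (cmod (u w) - m)\<^sup>2)"
    by (rule Bochner_Integration.integral_nonneg) auto
  also have "\<dots> = (LINT w|lborel. (gk z w * (cmod (u w))\<^sup>2 - (2 * m) * (gk z w * cmod (u w))) + m\<^sup>2 * gk z w)"
    by (rule Bochner_Integration.integral_cong) (auto simp: power2_diff algebra_simps)
  also have "\<dots> = J - 2 * m * I + m\<^sup>2 * (2 * pi)"
    unfolding I_def J_def has_integral_gk(2)[of z, symmetric]
    by (subst Bochner_Integration.integral_add, intro Bochner_Integration.integrable_diff integrable_mult_right i,
        intro integrable_mult_right i, subst Bochner_Integration.integral_diff, rule i, intro integrable_mult_right i)
       (simp only: integral_mult_right_zero)
  also have "\<dots> = J - I\<^sup>2 / (2 * pi)" by (simp add: m_def power2_eq_square field_simps)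
  finally show ?thesis unfolding I_def[symmetric] J_def[symmetric] by (simp add: field_simps)
qed

lemma nn_integral_lborel_translate:
  fixes a :: "'a::euclidean_space"
  assumes [measurable]: "f \<in> borel_measurable borel"
  shows "(\<integral>\<^sup>+z. f (z + a) \<partial>lborel) = (\<integral>\<^sup>+z. f z \<partial>lborel)"
proof -
  have "(\<integral>\<^sup>+z. f z \<partial>lborel) = (\<integral>\<^sup>+z. f z \<partial>(distr lborel borel ((+) a)))"
    by (simp add: lborel_distr_plus)
  also have "\<dots> = (\<integral>\<^sup>+z. f (a + z) \<partial>lborel)" by (rule nn_integral_distr) auto
  finally show ?thesis by (simp add: add.commute)
qed

text \<open>The translates of the half-open strip by multiples of \<open>\<gamma>\<close> tile the
  plane. They are enumerated by \<open>int_decode\<close> so that sums and integrals can be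
  exchanged for sequences.\<close>

lemma suminf_indicator_strip:
  assumes "0 < \<gamma>"
  shows "(\<Sum>n. indicator (strip \<gamma>) (z + of_real (\<gamma> * of_int (int_decode n))) :: ennreal) = 1"
proof -
  define k where "k = \<lfloor>1/2 - Re z / \<gamma>\<rfloor>"
  have iff: "z + of_real (\<gamma> * of_int j) \<in> strip \<gamma> \<longleftrightarrow> j = k" for j
  proof -
    have "z + of_real (\<gamma> * of_int j) \<in> strip \<gamma> \<longleftrightarrow> - \<gamma> / 2 < Re z + \<gamma> * of_int j \<and> Re z + \<gamma> * of_int j \<le> \<gamma> / 2"
      by (simp add: strip_def)
    also have "\<dots> \<longleftrightarrow> of_int j \<le> 1/2 - Re z / \<gamma> \<and> 1/2 - Re z / \<gamma> < of_int j + 1"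
      using assms by (auto simp: field_simps)
    also have "\<dots> \<longleftrightarrow> j = k" unfolding k_def using floor_eq_iff[of "1/2 - Re z / \<gamma>" j] by auto
    finally show ?thesis .
  qed
  have "(\<lambda>n. indicator (strip \<gamma>) (z + of_real (\<gamma> * of_int (int_decode n))) :: ennreal)
      = (\<lambda>n. if n = int_encode k then 1 else 0)"
    by (rule ext) (auto simp: indicator_def iff simp del: of_real_mult)
  moreover have "(\<lambda>n. if n = int_encode k then (1::ennreal) else 0) sums 1"
    using sums_single[of "int_encode k" "\<lambda>_. 1::ennreal"] by simp
  ultimately show ?thesis by (simp add: sums_iff)
qed

lemma periodic_int_multiple:
  fixes f :: "complex \<Rightarrow> 'b"
  assumes per: "\<And>z. f (z + of_real \<gamma>) = f z"
  shows "f (z + of_real (\<gamma> * of_int k)) = f z"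
proof -
  have nat: "f (z + of_real (\<gamma> * real n)) = f z" for n z
  proof (induction n)
    case (Suc n)
    have "z + of_real (\<gamma> * real (Suc n)) = (z + of_real (\<gamma> * real n)) + of_real \<gamma>"
      by (simp add: algebra_simps)
    then show ?case by (simp only: per Suc)
  qed simp
  show ?thesis
  proof (cases "0 \<le> k")
    case True
    then show ?thesis using nat[of z "nat k"] by simp
  next
    case False
    then show ?thesis using nat[of "z + of_real (\<gamma> * of_int k)" "nat (- k)"] by simp
  qed
qed

text \<open>Both sides integrate a periodic function over a fundamental domain. The translated strip
  is cut along the tiling, each piece is moved back by its own period, and the pieces are
  reassembled.\<close>

lemma nn_integral_strip_translate:
  fixes f :: "complex \<Rightarrow> ennreal"
  assumes g: "0 < \<gamma>" and [measurable]: "f \<in> borel_measurable borel" and per: "\<And>z. f (z + of_real \<gamma>) = f z"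
  shows "(\<integral>\<^sup>+z. indicator (strip \<gamma>) z * f (z + a) \<partial>lborel) = (\<integral>\<^sup>+z. indicator (strip \<gamma>) z * f z \<partial>lborel)"
proof -
  let ?S = "strip \<gamma>" and ?d = "\<lambda>n. complex_of_real (\<gamma> * of_int (int_decode n))"
  have "(\<integral>\<^sup>+z. indicator ?S z * f (z + a) \<partial>lborel)
      = (\<integral>\<^sup>+z. (\<Sum>n. indicator ?S z * indicator ?S (z + (a + ?d n)) * f (z + (a + ?d n))) \<partial>lborel)"
  proof (rule nn_integral_cong)
    fix z
    have "(\<Sum>n. indicator ?S z * indicator ?S (z + (a + ?d n)) * f (z + (a + ?d n)))
        = (\<Sum>n. (indicator ?S z * f (z + a)) * indicator ?S ((z + a) + ?d n))"
      unfolding add.assoc[symmetric] periodic_int_multiple[of f \<gamma> "z + a", OF per] by (simp only: mult_ac)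
    then show "indicator ?S z * f (z + a) = (\<Sum>n. indicator ?S z * indicator ?S (z + (a + ?d n)) * f (z + (a + ?d n)))"
      by (simp only: ennreal_suminf_cmult suminf_indicator_strip[OF g] mult_1_right)
  qed
  also have "\<dots> = (\<Sum>n. (\<integral>\<^sup>+z. indicator ?S z * indicator ?S (z + (a + ?d n)) * f (z + (a + ?d n)) \<partial>lborel))"
    by (rule nn_integral_suminf) measurable
  also have "\<dots> = (\<Sum>n. (\<integral>\<^sup>+z. indicator ?S (z - a - ?d n) * indicator ?S z * f z \<partial>lborel))"
  proof (rule suminf_cong)
    fix n
    show "(\<integral>\<^sup>+z. indicator ?S z * indicator ?S (z + (a + ?d n)) * f (z + (a + ?d n)) \<partial>lborel)
       = (\<integral>\<^sup>+z. indicator ?S (z - a - ?d n) * indicator ?S z * f z \<partial>lborel)"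
      by (subst nn_integral_lborel_translate[of "\<lambda>z. indicator ?S (z - a - ?d n) * indicator ?S z * f z" "a + ?d n", symmetric])
         (simp_all add: algebra_simps)
  qed
  also have "\<dots> = (\<integral>\<^sup>+z. (\<Sum>n. indicator ?S (z - a - ?d n) * indicator ?S z * f z) \<partial>lborel)"
    by (rule nn_integral_suminf[symmetric]) measurable
  also have "\<dots> = (\<integral>\<^sup>+z. indicator ?S z * f z \<partial>lborel)"
  proof (rule nn_integral_cong)
    fix z
    \<comment> \<open>Moving the pieces back reverses the sign of the period; \<open>m\<close> is
      the corresponding permutation of the enumeration.\<close>
    define m where "m = (\<lambda>n. int_encode (- int_decode n))"
    show "(\<Sum>n. indicator ?S (z - a - ?d n) * indicator ?S z * f z) = indicator ?S z * f z"
    proof -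
      have "(\<Sum>n. indicator ?S (z - a - ?d n) :: ennreal) = (\<Sum>n. indicator ?S ((z - a) + ?d (m n)))"
        by (simp add: m_def)
      also have "\<dots> = (\<Sum>n. indicator ?S ((z - a) + ?d n))"
      proof -
        have "bij m"
          by (rule bijI') (auto simp: m_def int_encode_eq inj_int_decode[THEN injD] intro: exI[of _ "int_encode (- int_decode _)"])
        then show ?thesis
          using nn_integral_bij_count_space[of m UNIV UNIV "\<lambda>n. indicator ?S ((z - a) + ?d n) :: ennreal"]
          by (simp add: nn_integral_count_space_nat)
      qed
      finally have "(\<Sum>n. indicator ?S (z - a - ?d n) :: ennreal) = 1"
        by (simp only: suminf_indicator_strip[OF g])
      then have "(\<Sum>n. (indicator ?S z * f z) * indicator ?S (z - a - ?d n)) = indicator ?S z * f z"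
        by (simp only: ennreal_suminf_cmult mult_1_right)
      then show ?thesis by (simp only: mult_ac)
    qed
  qed
  finally show ?thesis .
qed

text \<open>Schur's test: Cauchy-Schwarz against the kernel, Tonelli, and invariance of the strip
  integral under translation by the convolution variable. Cauchy-Schwarz contributes one factor
  \<open>2 * pi\<close>, the integral of the kernel the other.\<close>

lemma schur_strip:
  assumes g: "0 < \<gamma>" and u: "gauss_growth u" and per: "\<And>z. cmod (u (z + of_real \<gamma>)) = cmod (u z)"
    and A: "0 \<le> A" and P: "\<And>z. cmod (P z) \<le> A * (LINT w|lborel. gk z w * cmod (u w))"
  shows "(\<integral>\<^sup>+z. indicator (strip \<gamma>) z * ennreal ((cmod (P z))\<^sup>2) \<partial>lborel)
    \<le> ennreal ((2 * pi * A)\<^sup>2) * (\<integral>\<^sup>+z. indicator (strip \<gamma>) z * ennreal ((cmod (u z))\<^sup>2) \<partial>lborel)"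
proof -
  let ?S = "strip \<gamma>"
  have [measurable]: "u \<in> borel_measurable borel" using u by (simp add: gauss_growth_def)
  have pt: "ennreal ((cmod (P z))\<^sup>2) \<le> ennreal (A\<^sup>2 * (2 * pi)) * (\<integral>\<^sup>+w. ennreal (gk 0 w) * ennreal ((cmod (u (z + w)))\<^sup>2) \<partial>lborel)" for z
  proof -
    have "(cmod (P z))\<^sup>2 \<le> (A * (LINT w|lborel. gk z w * cmod (u w)))\<^sup>2" by (intro power_mono P) auto
    also have "\<dots> = A\<^sup>2 * (LINT w|lborel. gk z w * cmod (u w))\<^sup>2" by (rule power_mult_distrib)
    also have "\<dots> \<le> A\<^sup>2 * (2 * pi * (LINT w|lborel. gk z w * (cmod (u w))\<^sup>2))"
      by (intro mult_left_mono gk_cauchy_schwarz u) auto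
    finally have "ennreal ((cmod (P z))\<^sup>2) \<le> ennreal (A\<^sup>2 * (2 * pi) * (LINT w|lborel. gk z w * (cmod (u w))\<^sup>2))"
      by (intro ennreal_leI) (simp add: mult.assoc)
    also have "\<dots> = ennreal (A\<^sup>2 * (2 * pi)) * ennreal (LINT w|lborel. gk z w * (cmod (u w))\<^sup>2)"
      by (rule ennreal_mult) (auto intro: Bochner_Integration.integral_nonneg)
    also have "ennreal (LINT w|lborel. gk z w * (cmod (u w))\<^sup>2) = (\<integral>\<^sup>+w. ennreal (gk z w * (cmod (u w))\<^sup>2) \<partial>lborel)"
      by (rule nn_integral_eq_integral[symmetric]) (auto intro: gauss_growth_integrable(1)[OF u])
    also have "\<dots> = (\<integral>\<^sup>+w. ennreal (gk z (w + z) * (cmod (u (w + z)))\<^sup>2) \<partial>lborel)"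
      by (rule nn_integral_lborel_translate[symmetric]) measurable
    also have "\<dots> = (\<integral>\<^sup>+w. ennreal (gk 0 w) * ennreal ((cmod (u (z + w)))\<^sup>2) \<partial>lborel)"
      by (rule nn_integral_cong) (simp add: gk_def ennreal_mult add.commute)
    finally show ?thesis .
  qed
  have "(\<integral>\<^sup>+z. indicator ?S z * ennreal ((cmod (P z))\<^sup>2) \<partial>lborel)
     \<le> (\<integral>\<^sup>+z. ennreal (A\<^sup>2 * (2 * pi)) * (\<integral>\<^sup>+w. ennreal (gk 0 w) * (indicator ?S z * ennreal ((cmod (u (z + w)))\<^sup>2)) \<partial>lborel) \<partial>lborel)"
  proof (rule nn_integral_mono)
    fix z
    show "indicator ?S z * ennreal ((cmod (P z))\<^sup>2) \<le> ennreal (A\<^sup>2 * (2 * pi)) *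
       (\<integral>\<^sup>+w. ennreal (gk 0 w) * (indicator ?S z * ennreal ((cmod (u (z + w)))\<^sup>2)) \<partial>lborel)"
      using pt[of z] by (cases "z \<in> ?S") (simp_all add: indicator_def)
  qed
  also have "\<dots> = ennreal (A\<^sup>2 * (2 * pi)) * (\<integral>\<^sup>+z. (\<integral>\<^sup>+w. ennreal (gk 0 w) * (indicator ?S z * ennreal ((cmod (u (z + w)))\<^sup>2)) \<partial>lborel) \<partial>lborel)"
    by (rule nn_integral_cmult) measurable
  also have "(\<integral>\<^sup>+z. (\<integral>\<^sup>+w. ennreal (gk 0 w) * (indicator ?S z * ennreal ((cmod (u (z + w)))\<^sup>2)) \<partial>lborel) \<partial>lborel)
      = (\<integral>\<^sup>+w. (\<integral>\<^sup>+z. ennreal (gk 0 w) * (indicator ?S z * ennreal ((cmod (u (z + w)))\<^sup>2)) \<partial>lborel) \<partial>lborel)"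
    by (rule lborel_pair.Fubini') measurable
  also have "\<dots> = (\<integral>\<^sup>+w. ennreal (gk 0 w) * (\<integral>\<^sup>+z. indicator ?S z * ennreal ((cmod (u z))\<^sup>2) \<partial>lborel) \<partial>lborel)"
  proof (rule nn_integral_cong)
    fix w
    have "(\<integral>\<^sup>+z. ennreal (gk 0 w) * (indicator ?S z * ennreal ((cmod (u (z + w)))\<^sup>2)) \<partial>lborel)
       = ennreal (gk 0 w) * (\<integral>\<^sup>+z. indicator ?S z * ennreal ((cmod (u (z + w)))\<^sup>2) \<partial>lborel)"
      by (rule nn_integral_cmult) measurable
    also have "(\<integral>\<^sup>+z. indicator ?S z * ennreal ((cmod (u (z + w)))\<^sup>2) \<partial>lborel) = (\<integral>\<^sup>+z. indicator ?S z * ennreal ((cmod (u z))\<^sup>2) \<partial>lborel)"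
      by (rule nn_integral_strip_translate[OF g, of "\<lambda>z. ennreal ((cmod (u z))\<^sup>2)"]) (simp_all add: per)
    finally show "(\<integral>\<^sup>+z. ennreal (gk 0 w) * (indicator ?S z * ennreal ((cmod (u (z + w)))\<^sup>2)) \<partial>lborel)
       = ennreal (gk 0 w) * (\<integral>\<^sup>+z. indicator ?S z * ennreal ((cmod (u z))\<^sup>2) \<partial>lborel)" .
  qed
  also have "\<dots> = (\<integral>\<^sup>+w. ennreal (gk 0 w) \<partial>lborel) * (\<integral>\<^sup>+z. indicator ?S z * ennreal ((cmod (u z))\<^sup>2) \<partial>lborel)"
    by (rule nn_integral_multc) measurable
  also have "(\<integral>\<^sup>+w. ennreal (gk 0 w) \<partial>lborel) = ennreal (2 * pi)"
    unfolding gk_def by (subst nn_integral_gaussian_complex) simp_all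
  also have "ennreal (A\<^sup>2 * (2 * pi)) * (ennreal (2 * pi) * (\<integral>\<^sup>+z. indicator ?S z * ennreal ((cmod (u z))\<^sup>2) \<partial>lborel))
      = ennreal ((2 * pi * A)\<^sup>2) * (\<integral>\<^sup>+z. indicator ?S z * ennreal ((cmod (u z))\<^sup>2) \<partial>lborel)"
    unfolding mult.assoc[symmetric]
    by (subst ennreal_mult[symmetric]) (use A in \<open>simp_all add: power_mult_distrib power2_eq_square mult_ac\<close>)
  finally show ?thesis .
qed

text \<open>The hypothesis bounds the Dini derivatives of \<open>Q\<close> by \<open>(2 + 2 * C) * Q\<close>; compare \<open>Q\<close> with
  \<open>\<epsilon> * exp (L * t)\<close> for larger \<open>L\<close> at a first crossing.\<close>

lemma gronwall_zero:
  fixes Q :: "real \<Rightarrow> real"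
  assumes nonneg: "\<And>t. 0 \<le> t \<Longrightarrow> 0 \<le> Q t" and Q0: "Q 0 = 0" and C: "0 \<le> C"
    and step: "\<And>t. 0 \<le> t \<Longrightarrow> \<exists>\<rho>. (\<rho> \<longlongrightarrow> 0) (at t within {0..}) \<and>
      (\<forall>s\<ge>0. \<bar>Q s - Q t\<bar> \<le> \<bar>s - t\<bar> * (Q s + Q t + 2 * (1 + \<bar>s - t\<bar>) * (C * Q t + \<rho> s)))"
    and t: "0 \<le> t"
  shows "Q t = 0"
proof -
  have cont: "(Q \<longlongrightarrow> Q t) (at t within {0..})" if t: "0 \<le> t" for t
  proof -
    obtain \<rho> where r: "(\<rho> \<longlongrightarrow> 0) (at t within {0..})"
      "\<And>s. 0 \<le> s \<Longrightarrow> \<bar>Q s - Q t\<bar> \<le> \<bar>s - t\<bar> * (Q s + Q t + 2 * (1 + \<bar>s - t\<bar>) * (C * Q t + \<rho> s))"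
      using step[OF t] by blast
    let ?F = "at t within {0..}"
    \<comment> \<open>The hypothesis bounds the increment by an expression that itself contains
      \<open>Q s\<close>. For \<open>|s - t| < 1/2\<close> this occurrence can be absorbed, which
      yields continuity of \<open>Q\<close>.\<close>
    let ?b = "\<lambda>s. \<bar>s - t\<bar> * (4 * Q t + 4 * (1 + \<bar>s - t\<bar>) * (C * Q t + \<bar>\<rho> s\<bar>))"
    have lim: "((\<lambda>s. s) \<longlongrightarrow> t) ?F" by (rule tendsto_ident_at)
    have "(?b \<longlongrightarrow> \<bar>t - t\<bar> * (4 * Q t + 4 * (1 + \<bar>t - t\<bar>) * (C * Q t + \<bar>0\<bar>))) ?F"
      by (intro tendsto_intros lim r)
    then have b0: "(?b \<longlongrightarrow> 0) ?F" by simp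
    have "\<forall>\<^sub>F s in ?F. \<bar>s - t\<bar> < 1/2"
      using tendstoD[OF lim, of "1/2"] by (simp add: dist_real_def)
    moreover have "\<forall>\<^sub>F s in ?F. 0 \<le> s" by (simp add: eventually_at_filter)
    ultimately have "\<forall>\<^sub>F s in ?F. \<bar>Q s - Q t\<bar> \<le> ?b s"
    proof eventually_elim
      case (elim s)
      define X where "X = 2 * (1 + \<bar>s - t\<bar>) * (C * Q t + \<bar>\<rho> s\<bar>)"
      have X0: "0 \<le> X" unfolding X_def using C nonneg[OF t] by (intro mult_nonneg_nonneg add_nonneg_nonneg) auto
      have "2 * (1 + \<bar>s - t\<bar>) * (C * Q t + \<rho> s) \<le> X" unfolding X_def by (intro mult_left_mono) auto
      then have "\<bar>s - t\<bar> * (Q s + Q t + 2 * (1 + \<bar>s - t\<bar>) * (C * Q t + \<rho> s)) \<le> \<bar>s - t\<bar> * (Q s + Q t + X)"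
        by (intro mult_left_mono) auto
      with r(2)[OF elim(2)] have 1: "\<bar>Q s - Q t\<bar> \<le> \<bar>s - t\<bar> * (Q s + Q t + X)" by linarith
      have "\<bar>s - t\<bar> * (Q s + Q t + X) \<le> 1/2 * (Q s + Q t + X)"
        using elim nonneg[OF t] nonneg[OF elim(2)] X0 by (intro mult_right_mono) auto
      with 1 have "Q s \<le> 3 * Q t + X" by (simp add: abs_le_iff field_simps)
      then have "\<bar>s - t\<bar> * (Q s + Q t + X) \<le> \<bar>s - t\<bar> * (4 * Q t + 2 * X)"
        by (intro mult_left_mono) auto
      moreover have "4 * Q t + 2 * X = 4 * Q t + 4 * (1 + \<bar>s - t\<bar>) * (C * Q t + \<bar>\<rho> s\<bar>)"
        by (simp add: X_def)
      ultimately show ?case using 1 by (simp only:)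
    qed
    then have "((\<lambda>s. Q s - Q t) \<longlongrightarrow> 0) ?F"
      by (intro Lim_null_comparison[OF _ b0]) simp
    then show ?thesis by (simp add: Lim_null[symmetric])
  qed
  have contQ: "continuous_on {0..T} Q" for T
    unfolding continuous_on_def
    by (intro ballI tendsto_within_subset[OF cont]) auto
  \<comment> \<open>Strictly larger than \<open>2 + 2 * C\<close>, the largest slope
    \<open>Q\<close> can have relative to its value, so a touching point of \<open>Q\<close> and the
    barrier is contradictory.\<close>
  define L where "L = 2 * C + 3"
  have "Q t \<le> \<epsilon> * exp (L * t)" if eps: "0 < \<epsilon>" for \<epsilon>
  proof (rule ccontr)
    assume neg: "\<not> Q t \<le> \<epsilon> * exp (L * t)"
    define f where "f s = \<epsilon> * exp (L * s) - Q s" for s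
    have cf: "continuous_on {0..t} f" unfolding f_def by (intro continuous_intros contQ)
    define Z where "Z = {s \<in> {0..t}. f s \<in> {..0}}"
    have "closed Z" unfolding Z_def
      by (rule continuous_closed_preimage[OF cf, simplified vimage_def Int_def mem_Collect_eq]) auto
    moreover have "Z \<noteq> {}" using neg t by (auto simp: Z_def f_def)
    moreover have "bdd_below Z" by (auto simp: Z_def intro: bdd_belowI[of _ 0])
    ultimately have TZ: "Inf Z \<in> Z" by (intro closed_contains_Inf)
    \<comment> \<open>The first time at which \<open>Q\<close> reaches the barrier. It is positive
      as \<open>Q\<close> starts at 0, so slopes can be compared from the left.\<close>
    define T where "T = Inf Z"
    have T: "0 \<le> T" "T \<le> t" "f T \<le> 0" using TZ by (auto simp: T_def Z_def)
    have before: "0 < f s" if "0 \<le> s" "s < T" for s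
    proof (rule ccontr)
      assume "\<not> 0 < f s"
      then have "s \<in> Z" using that T by (auto simp: Z_def)
      then have "T \<le> s" unfolding T_def using \<open>bdd_below Z\<close> by (intro cInf_lower)
      with that show False by simp
    qed
    have T0: "0 < T"
    proof (rule ccontr)
      assume "\<not> 0 < T"
      then have "T = 0" using T by simp
      then show False using T(3) Q0 eps by (simp add: f_def)
    qed
    have QT: "\<epsilon> * exp (L * T) \<le> Q T" using T(3) by (simp add: f_def)
    have QTpos: "0 < Q T" using QT eps by (meson exp_gt_zero less_le_trans mult_pos_pos)
    obtain \<rho> where r: "(\<rho> \<longlongrightarrow> 0) (at T within {0..})"
      "\<And>s. 0 \<le> s \<Longrightarrow> \<bar>Q s - Q T\<bar> \<le> \<bar>s - T\<bar> * (Q s + Q T + 2 * (1 + \<bar>s - T\<bar>) * (C * Q T + \<rho> s))"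
      using step[OF T(1)] by blast
    let ?F = "at T within {0..<T}"
    have ntF: "?F \<noteq> bot" using T0 by (simp add: at_within_eq_bot_iff)
    have lim: "((\<lambda>s. s) \<longlongrightarrow> T) ?F" by (rule tendsto_ident_at)
    have rF: "(\<rho> \<longlongrightarrow> 0) ?F" by (rule tendsto_within_subset[OF r(1)]) auto
    have QF: "(Q \<longlongrightarrow> Q T) ?F" by (rule tendsto_within_subset[OF cont[OF T(1)]]) auto
    have EqT: "Q T \<le> \<epsilon> * exp (L * T)"
    proof (rule tendsto_le[OF ntF _ QF])
      show "((\<lambda>s. \<epsilon> * exp (L * s)) \<longlongrightarrow> \<epsilon> * exp (L * T)) ?F" by (intro tendsto_intros lim)
      show "\<forall>\<^sub>F s in ?F. Q s \<le> \<epsilon> * exp (L * s)"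
        unfolding eventually_at_filter using before by (auto simp: f_def intro!: always_eventually less_imp_le)
    qed
    have der: "((\<lambda>s. \<epsilon> * exp (L * s)) has_real_derivative (L * (\<epsilon> * exp (L * T)))) (at T within {0..<T})"
      by (auto intro!: derivative_eq_intros)
    have slope: "((\<lambda>s. (\<epsilon> * exp (L * s) - \<epsilon> * exp (L * T)) / (s - T)) \<longlongrightarrow> L * (\<epsilon> * exp (L * T))) ?F"
      using der unfolding has_field_derivative_iff .
    have up: "((\<lambda>s. Q s + Q T + 2 * (1 + \<bar>s - T\<bar>) * (C * Q T + \<rho> s)) \<longlongrightarrow> Q T + Q T + 2 * (1 + \<bar>T - T\<bar>) * (C * Q T + 0)) ?F"
      by (intro tendsto_intros lim rF QF)
    have "L * (\<epsilon> * exp (L * T)) \<le> Q T + Q T + 2 * (1 + \<bar>T - T\<bar>) * (C * Q T + 0)"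
    proof (rule tendsto_le[OF ntF up slope])
      show "\<forall>\<^sub>F s in ?F. (\<epsilon> * exp (L * s) - \<epsilon> * exp (L * T)) / (s - T) \<le> Q s + Q T + 2 * (1 + \<bar>s - T\<bar>) * (C * Q T + \<rho> s)"
        unfolding eventually_at_filter
      proof (intro always_eventually allI impI)
        fix s assume "s \<noteq> T" and s: "s \<in> {0..<T}"
        have "\<epsilon> * exp (L * T) - \<epsilon> * exp (L * s) \<le> Q T - Q s"
          using before[of s] s QT by (simp add: f_def)
        also have "\<dots> \<le> (T - s) * (Q s + Q T + 2 * (1 + \<bar>s - T\<bar>) * (C * Q T + \<rho> s))"
          using r(2)[of s] s by (simp add: abs_le_iff)
        finally have "(\<epsilon> * exp (L * T) - \<epsilon> * exp (L * s)) / (T - s) \<le> Q s + Q T + 2 * (1 + \<bar>s - T\<bar>) * (C * Q T + \<rho> s)"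
          using s by (simp add: pos_divide_le_eq mult.commute)
        then show "(\<epsilon> * exp (L * s) - \<epsilon> * exp (L * T)) / (s - T) \<le> Q s + Q T + 2 * (1 + \<bar>s - T\<bar>) * (C * Q T + \<rho> s)"
          by (metis minus_diff_eq minus_divide_divide)
      qed
    qed
    moreover have "\<epsilon> * exp (L * T) = Q T" using QT EqT by simp
    ultimately have "L * Q T \<le> (2 + 2 * C) * Q T" by (simp add: algebra_simps)
    then have "L \<le> 2 + 2 * C" using QTpos by (simp add: mult_le_cancel_right)
    then show False by (simp add: L_def)
  qed
  note le = this
  have "Q t \<le> 0"
  proof (rule field_le_epsilon)
    fix e :: real assume "0 < e"
    then have "Q t \<le> e / exp (L * t) * exp (L * t)" by (intro le) simp
    then show "Q t \<le> 0 + e" by simp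
  qed
  with nonneg[OF t] show ?thesis by simp
qed


section \<open>Quadratic estimates for the strip integral\<close>

definition L2_strip :: "real \<Rightarrow> (complex \<Rightarrow> complex) \<Rightarrow> bool" where
  "L2_strip \<gamma> u \<longleftrightarrow> u \<in> borel_measurable borel \<and> integrable lborel (\<lambda>z. indicator (strip \<gamma>) z *\<^sub>R (cmod (u z))\<^sup>2)"

definition L2_sq :: "real \<Rightarrow> (complex \<Rightarrow> complex) \<Rightarrow> real" where
  "L2_sq \<gamma> u = (LINT z|lborel. indicator (strip \<gamma>) z *\<^sub>R (cmod (u z))\<^sup>2)"

lemma L2_sq_nonneg: "0 \<le> L2_sq \<gamma> u"
  unfolding L2_sq_def by (rule Bochner_Integration.integral_nonneg) auto

lemma L2_norm_on_sq: "u \<in> borel_measurable borel \<Longrightarrow> (L2_norm_on (strip \<gamma>) u)\<^sup>2 = L2_sq \<gamma> u"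
  using L2_sq_nonneg[of \<gamma> u] by (simp add: L2_norm_on_borel[OF _ strip_borel] L2_sq_def)

lemma L2_strip_F_space: "u \<in> L2_on (strip \<gamma>) \<inter> F_space \<gamma> \<Longrightarrow> L2_strip \<gamma> u"
  unfolding L2_strip_def using L2_on_borel_iff[OF borel_measurable_F_space strip_borel] borel_measurable_F_space by blast

lemma L2_sq_le:
  assumes f: "L2_strip \<gamma> f" and g: "L2_strip \<gamma> g" and k: "k \<in> borel_measurable borel"
    and le: "\<And>z. (cmod (k z))\<^sup>2 \<le> a * (cmod (f z))\<^sup>2 + b * (cmod (g z))\<^sup>2"
  shows "L2_strip \<gamma> k" and "L2_sq \<gamma> k \<le> a * L2_sq \<gamma> f + b * L2_sq \<gamma> g"
proof -
  let ?i = "\<lambda>z. indicator (strip \<gamma>) z :: real"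
  have fi: "integrable lborel (\<lambda>z. ?i z *\<^sub>R (cmod (f z))\<^sup>2)" and gi: "integrable lborel (\<lambda>z. ?i z *\<^sub>R (cmod (g z))\<^sup>2)"
    using f g by (auto simp: L2_strip_def)
  have dom: "integrable lborel (\<lambda>z. a * (?i z *\<^sub>R (cmod (f z))\<^sup>2) + b * (?i z *\<^sub>R (cmod (g z))\<^sup>2))"
    by (intro Bochner_Integration.integrable_add integrable_mult_right fi gi)
  have pt: "?i z *\<^sub>R (cmod (k z))\<^sup>2 \<le> a * (?i z *\<^sub>R (cmod (f z))\<^sup>2) + b * (?i z *\<^sub>R (cmod (g z))\<^sup>2)" for z
    using le[of z] by (auto simp: indicator_def)
  have ki: "integrable lborel (\<lambda>z. ?i z *\<^sub>R (cmod (k z))\<^sup>2)"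
  proof (rule Bochner_Integration.integrable_bound[OF dom])
    show "(\<lambda>z. ?i z *\<^sub>R (cmod (k z))\<^sup>2) \<in> borel_measurable lborel" using k by measurable
    show "AE z in lborel. norm (?i z *\<^sub>R (cmod (k z))\<^sup>2) \<le> norm (a * (?i z *\<^sub>R (cmod (f z))\<^sup>2) + b * (?i z *\<^sub>R (cmod (g z))\<^sup>2))"
    proof (rule AE_I2)
      fix z
      have "norm (?i z *\<^sub>R (cmod (k z))\<^sup>2) = ?i z *\<^sub>R (cmod (k z))\<^sup>2" by (simp add: abs_mult)
      then show "norm (?i z *\<^sub>R (cmod (k z))\<^sup>2) \<le> norm (a * (?i z *\<^sub>R (cmod (f z))\<^sup>2) + b * (?i z *\<^sub>R (cmod (g z))\<^sup>2))"
        using pt[of z] unfolding real_norm_def[of "a * _ + _"] by linarith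
    qed
  qed
  then show "L2_strip \<gamma> k" using k by (simp add: L2_strip_def)
  have "L2_sq \<gamma> k \<le> (LINT z|lborel. a * (?i z *\<^sub>R (cmod (f z))\<^sup>2) + b * (?i z *\<^sub>R (cmod (g z))\<^sup>2))"
    unfolding L2_sq_def by (rule integral_mono[OF ki dom pt])
  also have "\<dots> = a * L2_sq \<gamma> f + b * L2_sq \<gamma> g"
    unfolding L2_sq_def
    by (subst Bochner_Integration.integral_add, intro integrable_mult_right fi, intro integrable_mult_right gi)
       (simp only: integral_mult_right_zero)
  finally show "L2_sq \<gamma> k \<le> a * L2_sq \<gamma> f + b * L2_sq \<gamma> g" .
qed

text \<open>Young's inequality with a free parameter. In the uniqueness proof
  \<open>e = |s - t|\<close>, so an increment of size \<open>e\<close> changes the square by order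
  \<open>e\<close> only.\<close>

lemma cmod_add_sq_le:
  assumes "0 < (e::real)"
  shows "(cmod (x + y))\<^sup>2 \<le> (1 + e) * (cmod x)\<^sup>2 + (1 + 1 / e) * (cmod y)\<^sup>2"
proof -
  have "0 \<le> (e * cmod x - cmod y)\<^sup>2 / e" using assms by simp
  also have "\<dots> = e * (cmod x)\<^sup>2 + (cmod y)\<^sup>2 / e - 2 * cmod x * cmod y"
    using assms by (simp add: power2_diff power_mult_distrib power2_eq_square[of e] field_simps)
  finally have "2 * cmod x * cmod y \<le> e * (cmod x)\<^sup>2 + (cmod y)\<^sup>2 / e" by simp
  moreover have "(cmod (x + y))\<^sup>2 \<le> (cmod x + cmod y)\<^sup>2" by (intro power_mono norm_triangle_ineq) auto
  ultimately show ?thesis by (simp add: power2_sum algebra_simps)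
qed

lemma cmod_add_sq_le_2: "(cmod (x + y))\<^sup>2 \<le> 2 * (cmod x)\<^sup>2 + 2 * (cmod y)\<^sup>2"
  using cmod_add_sq_le[of 1 x y] by simp

lemma cmod_diff_sq_le_2: "(cmod (x - y))\<^sup>2 \<le> 2 * (cmod x)\<^sup>2 + 2 * (cmod y)\<^sup>2"
  using cmod_add_sq_le_2[of x "- y"] by simp

lemma L2_strip_add:
  assumes "L2_strip \<gamma> f" "L2_strip \<gamma> g"
  shows "L2_strip \<gamma> (\<lambda>z. f z + g z)" and "L2_sq \<gamma> (\<lambda>z. f z + g z) \<le> 2 * L2_sq \<gamma> f + 2 * L2_sq \<gamma> g"
proof -
  have "(\<lambda>z. f z + g z) \<in> borel_measurable borel"
    using assms by (intro borel_measurable_add) (auto simp: L2_strip_def)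
  from L2_sq_le[OF assms this cmod_add_sq_le_2]
  show "L2_strip \<gamma> (\<lambda>z. f z + g z)" "L2_sq \<gamma> (\<lambda>z. f z + g z) \<le> 2 * L2_sq \<gamma> f + 2 * L2_sq \<gamma> g" by blast+
qed

lemma L2_strip_diff:
  assumes "L2_strip \<gamma> f" "L2_strip \<gamma> g"
  shows "L2_strip \<gamma> (\<lambda>z. f z - g z)" and "L2_sq \<gamma> (\<lambda>z. f z - g z) \<le> 2 * L2_sq \<gamma> f + 2 * L2_sq \<gamma> g"
proof -
  have "(\<lambda>z. f z - g z) \<in> borel_measurable borel"
    using assms by (intro borel_measurable_diff) (auto simp: L2_strip_def)
  from L2_sq_le[OF assms this cmod_diff_sq_le_2]
  show "L2_strip \<gamma> (\<lambda>z. f z - g z)" "L2_sq \<gamma> (\<lambda>z. f z - g z) \<le> 2 * L2_sq \<gamma> f + 2 * L2_sq \<gamma> g" by blast+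
qed

lemma L2_strip_mult:
  assumes "L2_strip \<gamma> f"
  shows "L2_strip \<gamma> (\<lambda>z. a * f z)"
proof -
  have "(\<lambda>z. a * f z) \<in> borel_measurable borel"
    using assms by (intro borel_measurable_times) (auto simp: L2_strip_def)
  from L2_sq_le(1)[OF assms assms this, of "(cmod a)\<^sup>2" 0]
  show ?thesis by (simp add: norm_mult power_mult_distrib)
qed

lemma nn_integral_L2_strip:
  assumes "L2_strip \<gamma> u"
  shows "(\<integral>\<^sup>+z. indicator (strip \<gamma>) z * ennreal ((cmod (u z))\<^sup>2) \<partial>lborel) = ennreal (L2_sq \<gamma> u)"
proof -
  have "(\<integral>\<^sup>+z. indicator (strip \<gamma>) z * ennreal ((cmod (u z))\<^sup>2) \<partial>lborel)
     = (\<integral>\<^sup>+z. ennreal (indicator (strip \<gamma>) z *\<^sub>R (cmod (u z))\<^sup>2) \<partial>lborel)"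
    by (rule nn_integral_cong) (simp add: indicator_def)
  also have "\<dots> = ennreal (L2_sq \<gamma> u)"
    unfolding L2_sq_def using assms by (intro nn_integral_eq_integral) (auto simp: L2_strip_def)
  finally show ?thesis .
qed

text \<open>The magnetic phase is common to \<open>u\<close> and \<open>v\<close> and has modulus 1:
  the functions are only quasi-periodic, but the modulus of their difference is periodic.\<close>

lemma F_space_diff_periodic:
  assumes "u \<in> F_space \<gamma>" "v \<in> F_space \<gamma>"
  shows "cmod (u (z + of_real \<gamma>) - v (z + of_real \<gamma>)) = cmod (u z - v z)"
proof -
  let ?e = "exp ((of_real \<gamma> * cnj z - cnj (of_real \<gamma>) * z) / 2)"
  have per: "f z = ?e * f (z + of_real \<gamma>)" if "f \<in> F_space \<gamma>" for f
  proof -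
    have "magnetic_translation (of_real \<gamma>) f z = f z" using that by (simp add: F_space_def)
    then show ?thesis by (simp add: magnetic_translation_def)
  qed
  have "Re ((of_real \<gamma> * cnj z - cnj (of_real \<gamma>) * z) / 2) = 0" by simp
  then have 1: "cmod ?e = 1" by (simp only: norm_exp_eq_Re exp_zero)
  have "u z - v z = ?e * (u (z + of_real \<gamma>) - v (z + of_real \<gamma>))"
    by (simp only: right_diff_distrib per[OF assms(1), symmetric] per[OF assms(2), symmetric])
  then show ?thesis by (simp only: norm_mult 1 mult_1_left)
qed

text \<open>Translation invariance of the strip integral brings \<open>z0\<close> to the interior
  point 0, so the boundary of the strip raises no case. There continuity would give an open set of
  positive measure on which \<open>u\<close> does not vanish.\<close>

lemma L2_sq_zero_imp_zero:
  assumes g: "0 < \<gamma>" and u: "L2_strip \<gamma> u" and cont: "continuous_on UNIV u"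
    and per: "\<And>z. cmod (u (z + of_real \<gamma>)) = cmod (u z)" and 0: "L2_sq \<gamma> u = 0"
  shows "u z0 = 0"
proof (rule ccontr)
  assume nz: "u z0 \<noteq> 0"
  have [measurable]: "u \<in> borel_measurable borel" using u by (simp add: L2_strip_def)
  have "(\<integral>\<^sup>+z. indicator (strip \<gamma>) z * ennreal ((cmod (u (z + z0)))\<^sup>2) \<partial>lborel) = 0"
    using nn_integral_strip_translate[OF g, of "\<lambda>z. ennreal ((cmod (u z))\<^sup>2)" z0] nn_integral_L2_strip[OF u] 0 per
    by simp
  then have AE: "AE z in lborel. indicator (strip \<gamma>) z * ennreal ((cmod (u (z + z0)))\<^sup>2) = 0"
    by (subst (asm) nn_integral_0_iff_AE) auto
  define V where "V = {z. u (z + z0) \<noteq> 0} \<inter> {z. - \<gamma> / 2 < Re z} \<inter> {z. Re z < \<gamma> / 2}"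
  have "continuous_on UNIV (\<lambda>z. u (z + z0))"
    by (intro continuous_on_compose2[OF cont] continuous_intros) auto
  then have "open {z. u (z + z0) \<noteq> 0}" by (intro open_Collect_neq continuous_intros)
  then have "open V" unfolding V_def
    by (intro open_Int open_halfspace_Re_gt open_halfspace_Re_lt)
  moreover have "0 \<in> V" using nz g by (simp add: V_def)
  ultimately have notneg: "\<not> negligible V" using open_not_negligible by blast
  have "AE z in lborel. z \<notin> V"
    using AE by eventually_elim (auto simp: V_def strip_def)
  moreover have "V \<in> sets lborel" using \<open>open V\<close> by simp
  ultimately have "V \<in> null_sets lborel" by (simp add: AE_iff_null_sets)
  then have "V \<in> null_sets lebesgue" by (rule null_sets_completionI)
  then show False using notneg by (simp add: negligible_iff_null_sets)
qed

text \<open>Schur's test bounds the time derivative of the difference by the difference itself.\<close>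

lemma linearized_solution_unique:
  assumes g: "0 < \<gamma>" and Phm: "Phi0 \<gamma> \<tau> \<in> borel_measurable borel" and Ph: "\<And>z. cmod (Phi0 \<gamma> \<tau> z) \<le> A"
    and v: "linearized_solution \<gamma> \<tau> v" and w: "linearized_solution \<gamma> \<tau> w" and init: "w 0 = v 0" and t: "0 \<le> t"
  shows "w t = v t"
proof -
  define \<delta> where "\<delta> t z = w t z - v t z" for t z
  define Q where "Q t = L2_sq \<gamma> (\<delta> t)" for t
  \<comment> \<open>From \<open>\<i> * \<delta>' = P - lam * \<delta>\<close>: the first summand is
    twice the squared Schur constant for \<open>P\<close>, with 3 counting two copies of
    \<open>|Phi0|^2\<close> plus one of \<open>Phi0^2\<close>; the second comes from
    \<open>lam\<close>.\<close>
  define C where "C = 2 * (2 * pi * (1 / pi * (3 * A\<^sup>2)))\<^sup>2 + 2 * (lam \<gamma>)\<^sup>2"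
  have F: "v t \<in> F_space \<gamma>" "w t \<in> F_space \<gamma>" "L2_strip \<gamma> (v t)" "L2_strip \<gamma> (w t)" if "0 \<le> t" for t
    using v w that L2_strip_F_space unfolding linearized_solution_def by blast+
  have dL: "L2_strip \<gamma> (\<delta> t)" if "0 \<le> t" for t
    unfolding \<delta>_def[abs_def] by (rule L2_strip_diff(1)[OF F(4)[OF that] F(3)[OF that]])
  have dper: "cmod (\<delta> t (z + of_real \<gamma>)) = cmod (\<delta> t z)" if "0 \<le> t" for t z
    unfolding \<delta>_def by (rule F_space_diff_periodic[OF F(2)[OF that] F(1)[OF that]])
  have dgg: "gauss_growth (\<delta> t)" if "0 \<le> t" for t
    unfolding \<delta>_def[abs_def] by (intro gauss_growth_diff gauss_growth_F_space[OF F(1)[OF that]] gauss_growth_F_space[OF F(2)[OF that]])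
  define nl where "nl f = (\<lambda>x. 2 * of_real ((cmod (Phi0 \<gamma> \<tau> x))\<^sup>2) * f x + (Phi0 \<gamma> \<tau> x)\<^sup>2 * cnj (f x))" for f
  have nl_le: "cmod (nl f x) \<le> 3 * A\<^sup>2 * cmod (f x)" for f x
  proof -
    have "cmod (nl f x) \<le> 2 * (cmod (Phi0 \<gamma> \<tau> x))\<^sup>2 * cmod (f x) + (cmod (Phi0 \<gamma> \<tau> x))\<^sup>2 * cmod (f x)"
      unfolding nl_def by (rule order_trans[OF norm_triangle_ineq]) (simp add: norm_mult norm_power)
    also have "\<dots> = 3 * ((cmod (Phi0 \<gamma> \<tau> x))\<^sup>2 * cmod (f x))" by simp
    also have "\<dots> \<le> 3 * (A\<^sup>2 * cmod (f x))"
      using power_mono[OF Ph norm_ge_zero, of x 2] by (intro mult_left_mono mult_right_mono) auto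
    finally show ?thesis by simp
  qed
  have cnjm: "(\<lambda>x. cnj (f x)) \<in> borel_measurable borel" if "f \<in> borel_measurable borel" for f :: "complex \<Rightarrow> complex"
    by (rule measurable_compose[OF that borel_measurable_continuous_onI]) (intro continuous_intros)
  have nlm: "nl f \<in> borel_measurable borel" if [measurable]: "f \<in> borel_measurable borel" for f
  proof -
    note [measurable] = Phm cnjm[OF that]
    show ?thesis unfolding nl_def by measurable
  qed
  have nlgg: "gauss_growth (nl f)" if "gauss_growth f" for f
    by (rule gauss_growth_comparison[OF that nlm nl_le]) (use that in \<open>simp add: gauss_growth_def\<close>)
  have step: "\<exists>\<rho>. (\<rho> \<longlongrightarrow> 0) (at t within {0..}) \<and>
      (\<forall>s\<ge>0. \<bar>Q s - Q t\<bar> \<le> \<bar>s - t\<bar> * (Q s + Q t + 2 * (1 + \<bar>s - t\<bar>) * (C * Q t + \<rho> s)))"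
    if t: "0 \<le> t" for t
  proof -
    obtain v' where v': "v' \<in> L2_on (strip \<gamma>) \<inter> F_space \<gamma>" "has_L2_time_derivative (strip \<gamma>) v v' t"
      "\<And>z. \<i> * v' z + of_real (lam \<gamma>) * v t z = bargmann_proj (nl (v t)) z"
      using v t unfolding linearized_solution_def nl_def by blast
    obtain w' where w': "w' \<in> L2_on (strip \<gamma>) \<inter> F_space \<gamma>" "has_L2_time_derivative (strip \<gamma>) w w' t"
      "\<And>z. \<i> * w' z + of_real (lam \<gamma>) * w t z = bargmann_proj (nl (w t)) z"
      using w t unfolding linearized_solution_def nl_def by blast
    define \<delta>' where "\<delta>' z = w' z - v' z" for z
    have d'L: "L2_strip \<gamma> \<delta>'" unfolding \<delta>'_def[abs_def]
      by (intro L2_strip_diff(1) L2_strip_F_space v' w')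
    define P where "P z = \<i> * \<delta>' z + of_real (lam \<gamma>) * \<delta> t z" for z
    have PL: "L2_strip \<gamma> P" unfolding P_def[abs_def]
      by (intro L2_strip_add(1) L2_strip_mult d'L dL t)
    have Peq: "P z = bargmann_proj (nl (\<delta> t)) z" for z
    proof -
      have "P z = bargmann_proj (nl (w t)) z - bargmann_proj (nl (v t)) z"
        unfolding v'(3)[symmetric] w'(3)[symmetric] P_def \<delta>'_def \<delta>_def by (simp add: algebra_simps)
      also have "\<dots> = bargmann_proj (\<lambda>x. nl (w t) x - nl (v t) x) z"
        by (rule bargmann_proj_diff[symmetric];
            intro nlgg gauss_growth_F_space[OF F(1)[OF t]] gauss_growth_F_space[OF F(2)[OF t]])
      also have "(\<lambda>x. nl (w t) x - nl (v t) x) = nl (\<delta> t)"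
        by (rule ext) (simp add: nl_def \<delta>_def algebra_simps)
      finally show ?thesis .
    qed
    have Ple: "cmod (P z) \<le> (1 / pi * (3 * A\<^sup>2)) * (LINT x|lborel. gk z x * cmod (\<delta> t x))" for z
    proof -
      have "cmod (P z) \<le> 1 / pi * (LINT x|lborel. gk z x * cmod (nl (\<delta> t) x))"
        unfolding Peq by (rule cmod_bargmann_proj_le[OF nlgg[OF dgg[OF t]]])
      also have "\<dots> \<le> 1 / pi * (LINT x|lborel. (3 * A\<^sup>2) * (gk z x * cmod (\<delta> t x)))"
      proof (intro mult_left_mono integral_mono)
        show "gk z x * cmod (nl (\<delta> t) x) \<le> 3 * A\<^sup>2 * (gk z x * cmod (\<delta> t x))" for x
          using mult_left_mono[OF nl_le gk_nonneg, of z x "\<delta> t" x] by (simp add: mult_ac)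
      qed (intro integrable_mult_right gauss_growth_integrable(2) nlgg dgg t | simp)+
      also have "\<dots> = (1 / pi * (3 * A\<^sup>2)) * (LINT x|lborel. gk z x * cmod (\<delta> t x))"
        by (simp only: integral_mult_right_zero mult.assoc)
      finally show ?thesis .
    qed
    have "ennreal (L2_sq \<gamma> P) \<le> ennreal ((2 * pi * (1 / pi * (3 * A\<^sup>2)))\<^sup>2) * ennreal (Q t)"
      using schur_strip[OF g dgg[OF t] dper[OF t] _ Ple]
      unfolding nn_integral_L2_strip[OF PL] nn_integral_L2_strip[OF dL[OF t]] Q_def by simp
    also have "\<dots> = ennreal ((2 * pi * (1 / pi * (3 * A\<^sup>2)))\<^sup>2 * Q t)"
      by (rule ennreal_mult[symmetric]) (auto simp: Q_def L2_sq_nonneg)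
    finally have PQ: "L2_sq \<gamma> P \<le> (2 * pi * (1 / pi * (3 * A\<^sup>2)))\<^sup>2 * Q t"
      by (subst (asm) ennreal_le_iff) (auto simp: Q_def intro!: mult_nonneg_nonneg L2_sq_nonneg)
    have d'Q: "L2_sq \<gamma> \<delta>' \<le> C * Q t"
    proof -
      have "L2_sq \<gamma> \<delta>' \<le> 2 * L2_sq \<gamma> P + (2 * (lam \<gamma>)\<^sup>2) * Q t"
        unfolding Q_def
      proof (rule L2_sq_le(2)[OF PL dL[OF t]])
        show "\<delta>' \<in> borel_measurable borel" using d'L by (simp add: L2_strip_def)
        fix z
        have "cmod (\<delta>' z) = cmod (P z - of_real (lam \<gamma>) * \<delta> t z)" by (simp add: P_def norm_mult)
        then show "(cmod (\<delta>' z))\<^sup>2 \<le> 2 * (cmod (P z))\<^sup>2 + 2 * (lam \<gamma>)\<^sup>2 * (cmod (\<delta> t z))\<^sup>2"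
          using cmod_diff_sq_le_2[of "P z" "of_real (lam \<gamma>) * \<delta> t z"]
          by (simp add: norm_mult power_mult_distrib)
      qed
      then show ?thesis using PQ unfolding C_def by (simp add: algebra_simps)
    qed
    define rv where "rv s z = (v s z - v t z) / of_real (s - t) - v' z" for s z
    define rw where "rw s z = (w s z - w t z) / of_real (s - t) - w' z" for s z
    have quot: "L2_strip \<gamma> (\<lambda>z. (f z - k z) / c - l z)" if "L2_strip \<gamma> f" "L2_strip \<gamma> k" "L2_strip \<gamma> l" for f k l c
      using L2_strip_diff(1)[OF L2_strip_mult[OF L2_strip_diff(1)[OF that(1,2)], of "inverse c"] that(3)]
      by (simp add: divide_inverse mult.commute)
    have rL: "L2_strip \<gamma> (rv s)" "L2_strip \<gamma> (rw s)" if "0 \<le> s" for s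
      unfolding rv_def[abs_def] rw_def[abs_def]
      by (rule quot[OF F(3)[OF that] F(3)[OF t] L2_strip_F_space[OF v'(1)]]
          quot[OF F(4)[OF that] F(4)[OF t] L2_strip_F_space[OF w'(1)]])+
    have bor: "L2_strip \<gamma> f \<Longrightarrow> f \<in> borel_measurable borel" for f by (simp add: L2_strip_def)
    define \<rho> where "\<rho> s = 2 * (L2_norm_on (strip \<gamma>) (rw s))\<^sup>2 + 2 * (L2_norm_on (strip \<gamma>) (rv s))\<^sup>2" for s
    have "(\<rho> \<longlongrightarrow> 2 * 0\<^sup>2 + 2 * 0\<^sup>2) (at t within {0..})"
      unfolding \<rho>_def[abs_def] using v'(2) w'(2) unfolding has_L2_time_derivative_def rv_def rw_def
      by (intro tendsto_intros)
    then have rho0: "(\<rho> \<longlongrightarrow> 0) (at t within {0..})" by simp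
    have "\<bar>Q s - Q t\<bar> \<le> \<bar>s - t\<bar> * (Q s + Q t + 2 * (1 + \<bar>s - t\<bar>) * (C * Q t + \<rho> s))" if s: "0 \<le> s" for s
    proof (cases "s = t")
      case False
      define e where "e = \<bar>s - t\<bar>"
      have e: "0 < e" using False by (simp add: e_def)
      \<comment> \<open>The difference quotient of \<open>\<delta>\<close> itself, written as its
        limit plus the two remainders, whose squared norms are collected in
        \<open>\<rho>\<close>.\<close>
      define y where "y z = \<delta>' z + (rw s z - rv s z)" for z
      have yL: "L2_strip \<gamma> y" unfolding y_def[abs_def]
        by (intro L2_strip_add(1) L2_strip_diff(1) d'L rL s)
      have "L2_sq \<gamma> y \<le> 2 * L2_sq \<gamma> \<delta>' + 2 * L2_sq \<gamma> (\<lambda>z. rw s z - rv s z)"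
        unfolding y_def[abs_def] by (intro L2_strip_add(2) L2_strip_diff(1) d'L rL s)
      also have "L2_sq \<gamma> (\<lambda>z. rw s z - rv s z) \<le> 2 * L2_sq \<gamma> (rw s) + 2 * L2_sq \<gamma> (rv s)"
        by (intro L2_strip_diff(2) rL s)
      also have "2 * L2_sq \<gamma> (rw s) + 2 * L2_sq \<gamma> (rv s) = \<rho> s"
        unfolding \<rho>_def by (simp add: L2_norm_on_sq bor rL s)
      finally have yq: "L2_sq \<gamma> y \<le> 2 * (C * Q t + \<rho> s)" using d'Q by simp
      have rel: "\<delta> s z = \<delta> t z + of_real (s - t) * y z" for z
      proof -
        have nz: "complex_of_real (s - t) \<noteq> 0" using False by (simp flip: of_real_diff)
        have "of_real (s - t) * y z = (w s z - w t z) - (v s z - v t z)"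
          unfolding y_def rw_def rv_def \<delta>'_def using nz by (simp add: field_simps del: of_real_diff)
        then show ?thesis by (simp add: \<delta>_def)
      qed
      have coef: "(1 + 1 / e) * (cmod (of_real (s - t) * y z))\<^sup>2 = e * (1 + e) * (cmod (y z))\<^sup>2" for z
      proof -
        have "(cmod (of_real (s - t) * y z))\<^sup>2 = e\<^sup>2 * (cmod (y z))\<^sup>2"
          by (simp add: norm_mult power_mult_distrib e_def del: of_real_diff)
        then show ?thesis using e by (simp add: field_simps power2_eq_square)
      qed
      have "Q s \<le> (1 + e) * Q t + (e * (1 + e)) * L2_sq \<gamma> y" unfolding Q_def
      proof (rule L2_sq_le(2)[OF dL[OF t] yL bor[OF dL[OF s]]])
        show "(cmod (\<delta> s z))\<^sup>2 \<le> (1 + e) * (cmod (\<delta> t z))\<^sup>2 + e * (1 + e) * (cmod (y z))\<^sup>2" for z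
          using cmod_add_sq_le[OF e, of "\<delta> t z" "of_real (s - t) * y z"] unfolding coef rel[of z] .
      qed
      moreover have "Q t \<le> (1 + e) * Q s + (e * (1 + e)) * L2_sq \<gamma> y" unfolding Q_def
      proof (rule L2_sq_le(2)[OF dL[OF s] yL bor[OF dL[OF t]]])
        fix z
        have "\<delta> t z = \<delta> s z + - (of_real (s - t) * y z)" using rel[of z] by simp
        then have "(cmod (\<delta> t z))\<^sup>2 \<le> (1 + e) * (cmod (\<delta> s z))\<^sup>2 + (1 + 1 / e) * (cmod (- (of_real (s - t) * y z)))\<^sup>2"
          using cmod_add_sq_le[OF e] by metis
        then show "(cmod (\<delta> t z))\<^sup>2 \<le> (1 + e) * (cmod (\<delta> s z))\<^sup>2 + e * (1 + e) * (cmod (y z))\<^sup>2"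
          unfolding norm_minus_cancel coef .
      qed
      moreover have "(e * (1 + e)) * L2_sq \<gamma> y \<le> (e * (1 + e)) * (2 * (C * Q t + \<rho> s))"
        using e yq by (intro mult_left_mono) auto
      moreover have "0 \<le> e * Q s" "0 \<le> e * Q t" using e by (auto simp: Q_def L2_sq_nonneg)
      ultimately have "\<bar>Q s - Q t\<bar> \<le> e * Q s + e * Q t + (e * (1 + e)) * (2 * (C * Q t + \<rho> s))"
        unfolding abs_le_iff distrib_right mult_1_left by linarith
      then show ?thesis unfolding e_def[symmetric] by (simp add: algebra_simps)
    qed simp
    with rho0 show ?thesis by blast
  qed
  have "Q 0 = 0" by (simp add: Q_def \<delta>_def init L2_sq_def)
  moreover have "0 \<le> C" by (simp add: C_def)
  ultimately have "Q t = 0"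
    using gronwall_zero[of Q C t, OF _ _ _ step t] by (simp add: Q_def L2_sq_nonneg)
  moreover have "continuous_on UNIV (\<delta> t)" unfolding \<delta>_def[abs_def]
    by (intro continuous_intros continuous_on_F_space[OF F(1)[OF t]] continuous_on_F_space[OF F(2)[OF t]])
  ultimately have "\<delta> t z = 0" for z
    by (intro L2_sq_zero_imp_zero[OF g dL[OF t] _ dper[OF t]]) (auto simp: Q_def)
  then show ?thesis by (auto simp: \<delta>_def)
qed


section \<open>Exponential instability\<close>

lemma synth_diff:
  assumes h: "0 < h" and c: "\<And>n. cmod (c n) \<le> C" and d: "\<And>n. cmod (d n) \<le> D"
  shows "synth h (\<lambda>n. c n - d n) z = synth h c z - synth h d z"
proof -
  have "((\<lambda>n. c n * psi h n z + - (d n * psi h n z)) has_sum synth h c z + - synth h d z) UNIV"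
    using synth_has_sum[of h c C z, OF h c] synth_has_sum[of h d D z, OF h d]
    by (intro has_sum_add has_sum_uminusI)
  then show ?thesis unfolding synth_def by (simp add: infsumI left_diff_distrib)
qed

lemma synth_add:
  assumes h: "0 < h" and c: "\<And>n. cmod (c n) \<le> C" and d: "\<And>n. cmod (d n) \<le> D"
  shows "synth h (\<lambda>n. c n + d n) z = synth h c z + synth h d z"
proof -
  have "((\<lambda>n. c n * psi h n z + d n * psi h n z) has_sum synth h c z + synth h d z) UNIV"
    using synth_has_sum[of h c C z, OF h c] synth_has_sum[of h d D z, OF h d]
    by (intro has_sum_add)
  then show ?thesis unfolding synth_def by (simp add: infsumI distrib_right)
qed

lemma synth_mult: "synth h (\<lambda>n. a * c n) z = a * synth h c z"
  unfolding synth_def by (simp only: infsum_cmult_right' mult.assoc)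

text \<open>For this lattice \<open>\<i> * pi * \<tau> = - h^2\<close>. The half-integer shifts
  cancel up to the constant \<open>h^2 / 4\<close>, and the signs \<open>(-1)^n\<close> and
  \<open>- \<i>\<close> are undone by the half period in the argument of
  \<open>Theta\<close>.\<close>

lemma Theta_term:
  assumes g: "0 < \<gamma>" and tau: "\<tau> = \<i> * of_real pi / (of_real \<gamma>)\<^sup>2" and h: "h = pi / \<gamma>"
  shows "exp (z\<^sup>2 / 2 - \<i> * of_real pi * z / of_real \<gamma> - of_real ((cmod z)\<^sup>2 / 2)) *
     (- \<i> * ((-1) powi n * exp (\<i> * of_real pi * \<tau> * (of_int n + 1/2)\<^sup>2 + \<i> * of_int (2 * n + 1) * of_real pi *
       (z / of_real \<gamma> - (\<tau> - 1) / 2)))) = of_real (exp (h\<^sup>2 / 4)) * psi h n z"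
proof -
  define H where "H = complex_of_real h"
  have pg: "of_real pi / of_real \<gamma> = H" by (simp add: H_def h)
  have t: "\<i> * of_real pi * \<tau> = - H\<^sup>2"
    unfolding pg[symmetric] tau using g by (simp add: field_simps power2_eq_square)
  have e1: "\<i> * of_real pi * \<tau> * (of_int n + 1/2)\<^sup>2 + \<i> * of_int (2 * n + 1) * of_real pi * (z / of_real \<gamma> - (\<tau> - 1) / 2)
    = - H\<^sup>2 * (of_int n + 1/2)\<^sup>2 + \<i> * of_int (2 * n + 1) * H * z + of_int (2 * n + 1) / 2 * H\<^sup>2
      + (\<i> * of_real pi / 2 + of_int n * (of_real pi * \<i>))"
  proof -
    have "\<i> * of_int (2 * n + 1) * of_real pi * (z / of_real \<gamma> - (\<tau> - 1) / 2)
      = \<i> * of_int (2 * n + 1) * (of_real pi / of_real \<gamma>) * z - of_int (2 * n + 1) / 2 * (\<i> * of_real pi * \<tau>)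
        + of_int (2 * n + 1) / 2 * (\<i> * of_real pi)"
      using g by (simp add: field_simps)
    then show ?thesis unfolding t pg by (simp add: field_simps)
  qed
  have sgn: "- \<i> * ((-1) powi n * exp (\<i> * of_real pi / 2 + of_int n * (of_real pi * \<i>))) = 1"
  proof -
    have "exp (of_int n * (of_real pi * \<i>)) = (-1) powi n"
      using exp_power_int[of "of_real pi * \<i>" n] by (simp add: mult.commute)
    moreover have "exp (\<i> * of_real pi / 2) = \<i>"
      using exp_Euler[of "of_real pi / 2"] by (simp add: cos_of_real[symmetric] sin_of_real[symmetric] del: cos_of_real sin_of_real) 
    moreover have "(-1) powi n * (-1) powi n = (1::complex)"
      by (simp add: power_int_mult_distrib[symmetric])
    ultimately show ?thesis by (simp add: exp_add mult.left_commute[of _ \<i>])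
  qed
  let ?E = "- H\<^sup>2 * (of_int n + 1/2)\<^sup>2 + \<i> * of_int (2 * n + 1) * H * z + of_int (2 * n + 1) / 2 * H\<^sup>2"
  have "exp (z\<^sup>2 / 2 - \<i> * of_real pi * z / of_real \<gamma> - of_real ((cmod z)\<^sup>2 / 2)) *
     (- \<i> * ((-1) powi n * exp (?E + (\<i> * of_real pi / 2 + of_int n * (of_real pi * \<i>)))))
    = exp (z\<^sup>2 / 2 - \<i> * of_real pi * z / of_real \<gamma> - of_real ((cmod z)\<^sup>2 / 2)) * exp ?E *
     (- \<i> * ((-1) powi n * exp (\<i> * of_real pi / 2 + of_int n * (of_real pi * \<i>))))"
    unfolding exp_add[of ?E] by (simp only: mult_ac)
  also have "\<dots> = exp (z\<^sup>2 / 2 - \<i> * of_real pi * z / of_real \<gamma> - of_real ((cmod z)\<^sup>2 / 2) + ?E)"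
    unfolding sgn by (simp add: exp_add)
  also have "z\<^sup>2 / 2 - \<i> * of_real pi * z / of_real \<gamma> - of_real ((cmod z)\<^sup>2 / 2) + ?E
     = of_real (h\<^sup>2 / 4) + (z\<^sup>2 / 2 - of_real ((cmod z)\<^sup>2 / 2) + 2 * \<i> * of_real (h * of_int n) * z - of_real (h\<^sup>2 * (of_int n)\<^sup>2))"
  proof -
    have "\<i> * of_real pi * z / of_real \<gamma> = \<i> * H * z" unfolding pg[symmetric] by simp
    then show ?thesis by (simp add: H_def field_simps power2_eq_square)
  qed
  finally show ?thesis unfolding e1 psi_def exp_add exp_of_real .
qed

lemma Phi0_eq_synth:
  assumes g: "0 < \<gamma>" and tau: "\<tau> = \<i> * of_real pi / (of_real \<gamma>)\<^sup>2" and h: "h = pi / \<gamma>"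
  shows "Phi0 \<gamma> \<tau> = (\<lambda>z. of_real (exp (h\<^sup>2 / 4)) * synth h (\<lambda>_. 1) z)"
proof
  fix z
  have "Phi0 \<gamma> \<tau> z = (\<Sum>\<^sub>\<infinity>n. exp (z\<^sup>2 / 2 - \<i> * of_real pi * z / of_real \<gamma> - of_real ((cmod z)\<^sup>2 / 2)) *
     (- \<i> * ((-1) powi n * exp (\<i> * of_real pi * \<tau> * (of_int n + 1/2)\<^sup>2 + \<i> * of_int (2 * n + 1) * of_real pi *
       (z / of_real \<gamma> - (\<tau> - 1) / 2)))))"
    unfolding Phi0_def Theta_def by (simp only: infsum_cmult_right')
  also have "\<dots> = (\<Sum>\<^sub>\<infinity>n. of_real (exp (h\<^sup>2 / 4)) * psi h n z)"
    by (simp only: Theta_term[OF assms])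
  also have "\<dots> = of_real (exp (h\<^sup>2 / 4)) * synth h (\<lambda>_. 1) z"
    unfolding synth_def by (simp only: infsum_cmult_right' mult_1_left)
  finally show "Phi0 \<gamma> \<tau> z = of_real (exp (h\<^sup>2 / 4)) * synth h (\<lambda>_. 1) z" .
qed

text \<open>In the notation of the overview \<open>lam \<gamma> = \<mu> * \<theta>^2\<close>,
  precisely the constant that completes \<open>G^2 - 2 \<theta> G\<close> to a square in
  \<open>lin_N\<close>.\<close>

lemma lam_eq:
  assumes "0 < \<gamma>" "h = pi / \<gamma>"
  shows "lam \<gamma> = (exp (h\<^sup>2 / 4))\<^sup>2 / sqrt 2 * (gw_mass h 0)\<^sup>2"
proof -
  have 1: "(exp (h\<^sup>2 / 4))\<^sup>2 = exp (pi\<^sup>2 / (2 * \<gamma>\<^sup>2))"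
    by (simp add: power2_eq_square[of "exp _"] exp_add[symmetric] assms(2) power_divide)
  have 2: "gw h q = exp (- (pi\<^sup>2 * (of_int q)\<^sup>2) / \<gamma>\<^sup>2)" for q
    by (simp add: gw_def assms(2) power_divide)
  show ?thesis unfolding lam_def gw_mass_0 1 2 by simp
qed

text \<open>Real and imaginary parts are kept apart because the equation contains
  \<open>cnj v\<close> and is only real-linear.\<close>

definition wcoeffs :: "real \<Rightarrow> (int \<Rightarrow>\<^sub>C real) \<Rightarrow> (int \<Rightarrow>\<^sub>C real) \<Rightarrow> int \<Rightarrow> complex" where
  "wcoeffs k a b n = of_real (expw k n) * Complex (a n) (b n)"

lemma cmod_wcoeffs_le: "cmod (wcoeffs k a b n) \<le> (norm a + norm b) * expw k n"
proof -
  have "cmod (Complex (a n) (b n)) \<le> \<bar>a n\<bar> + \<bar>b n\<bar>"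
    using cmod_le[of "Complex (a n) (b n)"] by simp
  also have "\<dots> \<le> norm a + norm b" using norm_bounded[of a n] norm_bounded[of b n] by simp
  finally show ?thesis by (simp add: wcoeffs_def norm_mult mult.commute mult_left_mono)
qed

lemma cmod_wcoeffs_le':
  assumes "0 \<le> k" shows "cmod (wcoeffs k a b n) \<le> norm a + norm b"
  by (rule order_trans[OF cmod_wcoeffs_le mult_left_le]) (use expw_le_1[OF assms] in auto)

lemma corr_wcoeffs:
  assumes h: "0 < h" and k: "0 \<le> k"
  shows "corr h (wcoeffs k a b) = wcoeffs k (conv_gw h k a) (conv_gw h k b)"
proof
  fix m
  let ?t = "\<lambda>x p. gw h p * (expw k (m + p) / expw k m) * apply_bcontfun x (m + p)"
  have hs: "(?t x has_sum conv_gw h k x m) UNIV" for x :: "int \<Rightarrow>\<^sub>C real"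
    unfolding conv_gw_apply[OF h k] by (rule has_sum_infsum[OF conv_gw_summable[OF h k]])
  have "((\<lambda>p. of_real (expw k m) * (of_real (?t a p) + \<i> * of_real (?t b p))) has_sum
      of_real (expw k m) * (of_real (conv_gw h k a m) + \<i> * of_real (conv_gw h k b m))) UNIV"
    by (intro has_sum_cmult_right has_sum_add has_sum_of_real hs)
  moreover have "of_real (expw k m) * (of_real (?t a p) + \<i> * of_real (?t b p)) = of_real (gw h p) * wcoeffs k a b (m + p)" for p
    unfolding wcoeffs_def Complex_eq by (simp add: field_simps)
  ultimately have "((\<lambda>p. of_real (gw h p) * wcoeffs k a b (m + p)) has_sum
      of_real (expw k m) * (of_real (conv_gw h k a m) + \<i> * of_real (conv_gw h k b m))) UNIV"
    by (simp only:)
  then show "corr h (wcoeffs k a b) m = wcoeffs k (conv_gw h k a) (conv_gw h k b) m"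
    unfolding corr_def wcoeffs_def Complex_eq by (rule infsumI)
qed

lemma cnj_wcoeffs: "(\<lambda>n. cnj (wcoeffs k a b n)) = wcoeffs k a (- b)"
  by (rule ext) (simp add: wcoeffs_def complex_eq_iff)

text \<open>Conjugation fixes \<open>a\<close> and negates \<open>b\<close>, so the projection acts
  as \<open>2 \<theta> G + G^2\<close> on \<open>a\<close> and as \<open>2 \<theta> G - G^2\<close>
  on \<open>b\<close>. Subtracting \<open>lam\<close> gives \<open>L\<close> and \<open>- N\<close>,
  and the factor \<open>\<i>\<close> in front of the time derivative exchanges the two
  equations.\<close>

lemma linearized_wcoeffs_equation:
  assumes g: "0 < \<gamma>" and tau: "\<tau> = \<i> * of_real pi / (of_real \<gamma>)\<^sup>2" and h: "h = pi / \<gamma>" and k: "0 < k"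
  defines "\<mu> \<equiv> (exp (h\<^sup>2 / 4))\<^sup>2 / sqrt 2"
  shows "\<i> * synth h (wcoeffs k (- (\<mu> *\<^sub>R lin_N h k b)) (- (\<mu> *\<^sub>R lin_L h k a))) z + of_real (lam \<gamma>) * synth h (wcoeffs k a b) z =
     bargmann_proj (\<lambda>w. 2 * of_real ((cmod (Phi0 \<gamma> \<tau> w))\<^sup>2) * synth h (wcoeffs k a b) w
        + (Phi0 \<gamma> \<tau> w)\<^sup>2 * cnj (synth h (wcoeffs k a b) w)) z"
proof -
  have h0: "0 < h" using g h by simp
  have k0: "0 \<le> k" using k by simp
  interpret G: bounded_linear "conv_gw h k" by (rule bounded_linear_conv_gw[OF h0 k0])
  let ?c = "wcoeffs k a b" and ?d = "wcoeffs k (- (\<mu> *\<^sub>R lin_N h k b)) (- (\<mu> *\<^sub>R lin_L h k a))"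
  have lam: "lam \<gamma> = \<mu> * (gw_mass h 0)\<^sup>2" unfolding \<mu>_def by (rule lam_eq[OF g h])
  have bd: "cmod (\<i> * ?d n) \<le> norm (- (\<mu> *\<^sub>R lin_N h k b)) + norm (- (\<mu> *\<^sub>R lin_L h k a))"
    "cmod (of_real (lam \<gamma>) * ?c n) \<le> \<bar>lam \<gamma>\<bar> * (norm a + norm b)" for n
    using cmod_wcoeffs_le'[OF k0, of "- (\<mu> *\<^sub>R lin_N h k b)" "- (\<mu> *\<^sub>R lin_L h k a)" n] cmod_wcoeffs_le'[OF k0, of a b n]
    by (auto simp: norm_mult intro!: mult_left_mono)
  have "bargmann_proj (\<lambda>w. 2 * of_real ((cmod (Phi0 \<gamma> \<tau> w))\<^sup>2) * synth h ?c w + (Phi0 \<gamma> \<tau> w)\<^sup>2 * cnj (synth h ?c w)) z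
    = synth h (\<lambda>m. of_real \<mu> * (2 * of_real (gw_mass h 0) * corr h ?c m + corr h (corr h (\<lambda>n. cnj (?c n))) m)) z"
    unfolding Phi0_eq_synth[OF g tau h] \<mu>_def by (rule bargmann_proj_synth[OF h0 cmod_wcoeffs_le'[OF k0]])
  also have "(\<lambda>m. of_real \<mu> * (2 * of_real (gw_mass h 0) * corr h ?c m + corr h (corr h (\<lambda>n. cnj (?c n))) m))
     = (\<lambda>m. \<i> * ?d m + of_real (lam \<gamma>) * ?c m)"
  proof
    fix m
    show "of_real \<mu> * (2 * of_real (gw_mass h 0) * corr h ?c m + corr h (corr h (\<lambda>n. cnj (?c n))) m)
       = \<i> * ?d m + of_real (lam \<gamma>) * ?c m"
      unfolding cnj_wcoeffs corr_wcoeffs[OF h0 k0] G.neg lam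
      by (simp add: wcoeffs_def lin_N_def lin_L_def complex_eq_iff algebra_simps)
  qed
  also have "synth h (\<lambda>m. \<i> * ?d m + of_real (lam \<gamma>) * ?c m) z = \<i> * synth h ?d z + of_real (lam \<gamma>) * synth h ?c z"
    by (simp only: synth_add[OF h0 bd] synth_mult)
  finally show ?thesis by simp
qed

lemma L2_norm_on_nonneg: "0 \<le> L2_norm_on S u"
  unfolding L2_norm_on_def set_lebesgue_integral_def
  by (intro real_sqrt_ge_zero Bochner_Integration.integral_nonneg) auto

lemma has_vector_derivative_quotient:
  assumes "(f has_vector_derivative f') (at t)"
  shows "((\<lambda>s. norm ((f s - f t) /\<^sub>R (s - t) - f')) \<longlongrightarrow> 0) (at t within S)"
proof -
  have "((\<lambda>s. norm (f s - f t - (s - t) *\<^sub>R f') / norm (s - t)) \<longlongrightarrow> 0) (at t within S)"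
    using has_derivative_at_within[of f "\<lambda>h. h *\<^sub>R f'" t S] assms
    unfolding has_vector_derivative_def has_derivative_iff_norm by (auto intro: tendsto_within_subset)
  moreover have "\<forall>\<^sub>F s in at t within S. norm (f s - f t - (s - t) *\<^sub>R f') / norm (s - t) = norm ((f s - f t) /\<^sub>R (s - t) - f')"
    unfolding eventually_at_filter
  proof (intro always_eventually allI impI)
    fix s assume "s \<noteq> t"
    then have "(f s - f t) /\<^sub>R (s - t) - f' = (f s - f t - (s - t) *\<^sub>R f') /\<^sub>R (s - t)"
      by (simp add: scaleR_diff_right)
    then show "norm (f s - f t - (s - t) *\<^sub>R f') / norm (s - t) = norm ((f s - f t) /\<^sub>R (s - t) - f')"
      by (simp add: divide_inverse mult.commute)
  qed
  ultimately show ?thesis by (rule Lim_transform_eventually)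
qed

theorem theorem1p1:
  fixes \<gamma> :: real and \<tau> :: complex
  assumes "\<gamma> > 0" and "\<tau> = \<i> * of_real pi / (of_real \<gamma>)\<^sup>2"
  shows "exponentially_unstable (L2_on (strip \<gamma>) \<inter> F_space \<gamma>) (L2_norm_on (strip \<gamma>))
           (linearized_solution \<gamma> \<tau>)"
proof -
  note g = assms(1) and tau = assms(2)
  define h where "h = pi / \<gamma>"
  have h: "0 < h" using g by (simp add: h_def)
  define \<mu> where "\<mu> = (exp (h\<^sup>2 / 4))\<^sup>2 / sqrt 2"
  have mu: "0 < \<mu>" by (simp add: \<mu>_def)
  obtain k b0 where k: "0 < k" and b0: "0 < weighted_inner k b0 (lin_L h k (lin_N h k b0))"
    using exists_unstable_direction[OF h] by blast
  have k0: "0 \<le> k" using k by simp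
  obtain a b c \<sigma> where a: "\<And>t. (a has_vector_derivative - (\<mu> *\<^sub>R lin_N h k (b t))) (at t)"
    and b: "\<And>t. (b has_vector_derivative - (\<mu> *\<^sub>R lin_L h k (a t))) (at t)"
    and cs: "0 < c" "0 < \<sigma>" and grow: "\<And>t. 0 \<le> t \<Longrightarrow> c * exp (\<sigma> * t) \<le> weighted_inner k (b t) (b t)"
    using hamiltonian_instability[of "weighted_inner k" "lin_L h k" "lin_N h k" \<mu> b0, OF bounded_bilinear_weighted_inner[OF k] weighted_inner_commute[of k] weighted_inner_pos[OF k]
        bounded_linear_lin_L[OF h k] bounded_linear_lin_N[OF h k] lin_L_selfadjoint[OF h k] lin_N_selfadjoint[OF h k]
        lin_L_lin_N_commute[OF h k] mu b0] by blast
  obtain K where K: "0 \<le> K"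
    and mem: "\<And>c B. (\<And>n. cmod (c n) \<le> B * expw k n) \<Longrightarrow> synth h c \<in> L2_on (strip \<gamma>) \<inter> F_space \<gamma>"
    and norm_le: "\<And>c B. (\<And>n. cmod (c n) \<le> B * expw k n) \<Longrightarrow> L2_norm_on (strip \<gamma>) (synth h c) \<le> K * B"
    by (rule synth_L2[OF g h_def k]) blast
  define v where "v t = synth h (wcoeffs k (a t) (b t))" for t
  have memv: "synth h (wcoeffs k x y) \<in> L2_on (strip \<gamma>) \<inter> F_space \<gamma>" for x y
    by (rule mem[OF cmod_wcoeffs_le])
  have sol: "linearized_solution \<gamma> \<tau> v"
    unfolding linearized_solution_def
  proof (intro allI impI conjI bexI)
    fix t :: real
    show "v t \<in> L2_on (strip \<gamma>) \<inter> F_space \<gamma>" unfolding v_def by (rule memv)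
    let ?a' = "- (\<mu> *\<^sub>R lin_N h k (b t))" and ?b' = "- (\<mu> *\<^sub>R lin_L h k (a t))"
    let ?v' = "synth h (wcoeffs k ?a' ?b')"
    show "?v' \<in> L2_on (strip \<gamma>) \<inter> F_space \<gamma>" by (rule memv)
    show "\<i> * ?v' z + of_real (lam \<gamma>) * v t z = bargmann_proj
        (\<lambda>w. 2 * of_real ((cmod (Phi0 \<gamma> \<tau> w))\<^sup>2) * v t w + (Phi0 \<gamma> \<tau> w)\<^sup>2 * cnj (v t w)) z" for z
      using linearized_wcoeffs_equation[OF g tau h_def k] unfolding v_def \<mu>_def .
    \<comment> \<open>By linearity the remainder of the difference quotient of \<open>v\<close> is
      the superposition with these coefficient remainders, so \<open>norm_le\<close> transfers their
      convergence to 0.\<close>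
    define da where "da s = (a s - a t) /\<^sub>R (s - t) - ?a'" for s
    define db where "db s = (b s - b t) /\<^sub>R (s - t) - ?b'" for s
    have quot: "(\<lambda>z. (v s z - v t z) / of_real (s - t) - ?v' z) = synth h (wcoeffs k (da s) (db s))" for s
    proof
      fix z
      let ?q = "\<lambda>n. inverse (of_real (s - t)) * (wcoeffs k (a s) (b s) n - wcoeffs k (a t) (b t) n)"
      have bq: "cmod (?q n) \<le> cmod (inverse (of_real (s - t))) * ((norm (a s) + norm (b s)) + (norm (a t) + norm (b t)))" for n
        unfolding norm_mult
        by (intro mult_left_mono order_trans[OF norm_triangle_ineq4] add_mono cmod_wcoeffs_le'[OF k0]) auto
      have "wcoeffs k (da s) (db s) = (\<lambda>n. ?q n - wcoeffs k ?a' ?b' n)"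
        by (rule ext) (simp add: wcoeffs_def da_def db_def complex_eq_iff algebra_simps divide_inverse flip: of_real_diff of_real_inverse)
      then have "synth h (wcoeffs k (da s) (db s)) z = inverse (of_real (s - t)) * (v s z - v t z) - ?v' z"
        by (simp only: synth_diff[OF h bq cmod_wcoeffs_le'[OF k0]] synth_mult v_def
            synth_diff[OF h cmod_wcoeffs_le'[OF k0] cmod_wcoeffs_le'[OF k0]])
      then show "(v s z - v t z) / of_real (s - t) - ?v' z = synth h (wcoeffs k (da s) (db s)) z"
        by (simp only: divide_inverse mult.commute)
    qed
    have "((\<lambda>s. K * (norm (da s) + norm (db s))) \<longlongrightarrow> K * (0 + 0)) (at t within {0..})"
      unfolding da_def[abs_def] db_def[abs_def]
      by (intro tendsto_intros has_vector_derivative_quotient a b)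
    then have lim: "((\<lambda>s. K * (norm (da s) + norm (db s))) \<longlongrightarrow> 0) (at t within {0..})" by simp
    show "has_L2_time_derivative (strip \<gamma>) v ?v' t"
      unfolding has_L2_time_derivative_def quot
    proof (rule Lim_null_comparison[OF always_eventually lim], intro allI)
      fix s
      show "norm (L2_norm_on (strip \<gamma>) (synth h (wcoeffs k (da s) (db s)))) \<le> K * (norm (da s) + norm (db s))"
        using norm_le[OF cmod_wcoeffs_le, of "da s" "db s"]
          L2_norm_on_nonneg[of "strip \<gamma>"] by simp
    qed
  qed
  have phi: "Phi0 \<gamma> \<tau> = (\<lambda>z. of_real (exp (h\<^sup>2 / 4)) * synth h (\<lambda>_. 1) z)"
    by (rule Phi0_eq_synth[OF g tau h_def])
  have phim: "Phi0 \<gamma> \<tau> \<in> borel_measurable borel"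
    unfolding phi
    by (intro borel_measurable_times borel_measurable_const
        borel_measurable_F_space[OF synth_in_F_space[OF g h_def, of "\<lambda>_. 1" 1]]) simp
  have phib: "cmod (Phi0 \<gamma> \<tau> z) \<le> exp (h\<^sup>2 / 4) * (1 * psi_bound h)" for z
    unfolding phi norm_mult by (rule mult_mono[OF _ cmod_synth_le[OF h]]) auto
  \<comment> \<open>The growth at hand is that of the squared l2 norm of the coefficients. Bessel's
    inequality carries it to the squared norm on the strip, and the square root halves the
    rate.\<close>
  have lower: "sqrt (\<gamma> * sqrt (pi / 2) * c) * exp (\<sigma> / 2 * t) \<le> L2_norm_on (strip \<gamma>) (v t)" if t: "0 \<le> t" for t
  proof -
    have kap: "0 \<le> \<gamma> * sqrt (pi / 2)" using g by simp
    have sc: "(\<lambda>n. (cmod (wcoeffs k (a t) (b t) n))\<^sup>2) = (\<lambda>n. (expw k n)\<^sup>2 * a t n * a t n + (expw k n)\<^sup>2 * b t n * b t n)"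
      unfolding wcoeffs_def norm_mult power_mult_distrib cmod_power2
      by (rule ext) (simp add: power2_eq_square algebra_simps)
    have "c * exp (\<sigma> * t) \<le> weighted_inner k (b t) (b t)" by (rule grow[OF t])
    also have "\<dots> \<le> (\<Sum>\<^sub>\<infinity>n. (cmod (wcoeffs k (a t) (b t) n))\<^sup>2)"
      unfolding weighted_inner_def sc
      by (intro infsum_mono summable_on_add weighted_inner_summable k) (simp add: mult.assoc)
    finally have "(\<gamma> * sqrt (pi / 2)) * (c * exp (\<sigma> * t)) \<le> (\<gamma> * sqrt (pi / 2)) * (\<Sum>\<^sub>\<infinity>n. (cmod (wcoeffs k (a t) (b t) n))\<^sup>2)"
      by (intro mult_left_mono kap)
    also have "\<dots> \<le> (L2_norm_on (strip \<gamma>) (v t))\<^sup>2"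
      unfolding v_def by (rule synth_L2_lower_bound[OF g h_def k cmod_wcoeffs_le])
    finally have "sqrt ((\<gamma> * sqrt (pi / 2)) * (c * exp (\<sigma> * t))) \<le> \<bar>L2_norm_on (strip \<gamma>) (v t)\<bar>"
      by (metis real_sqrt_abs real_sqrt_le_mono)
    also have "\<bar>L2_norm_on (strip \<gamma>) (v t)\<bar> = L2_norm_on (strip \<gamma>) (v t)"
      by (simp add: L2_norm_on_nonneg)
    also have "sqrt ((\<gamma> * sqrt (pi / 2)) * (c * exp (\<sigma> * t))) = sqrt (\<gamma> * sqrt (pi / 2) * c) * exp (\<sigma> / 2 * t)"
    proof -
      have "exp (\<sigma> * t) = (exp (\<sigma> / 2 * t))\<^sup>2" by (simp add: power2_eq_square exp_add[symmetric])
      then show ?thesis by (simp add: real_sqrt_mult)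
    qed
    finally show ?thesis .
  qed
  show ?thesis
    unfolding exponentially_unstable_def
  proof (intro bexI exI conjI allI impI)
    show "v 0 \<in> L2_on (strip \<gamma>) \<inter> F_space \<gamma>" unfolding v_def by (rule memv)
    show "0 < sqrt (\<gamma> * sqrt (pi / 2) * c)" using g cs by simp
    show "0 < \<sigma> / 2" using cs by simp
    show "linearized_solution \<gamma> \<tau> v" by (rule sol)
    show "w t = v t" if "linearized_solution \<gamma> \<tau> w \<and> w 0 = v 0" "0 \<le> t" for w t
      using linearized_solution_unique[OF g phim phib sol] that by blast
    show "sqrt (\<gamma> * sqrt (pi / 2) * c) * exp (\<sigma> / 2 * t) \<le> L2_norm_on (strip \<gamma>) (v t)" if "0 \<le> t" for t
      by (rule lower[OF that])
  qed simp
qed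

end
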